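(* Consider the offline adaptive method with parameter $0<\theta<1$, its multiscale velocities $v_{\text{ms}}^m$, the snapshot velocity $v_{\text{snap}}$, and the indicators $S_i^m = \|R_i^m\|_{(V_{\text{snap}}^{(i)})^*} (\lambda_{l_i^{m}+1}^{(i)})^{-1/2}$. There exist positive constants $\delta_0$ (the tolerance fixed in the enrichment step of the method), $\rho$, and a decreasing (i.e. nonincreasing) sequence of positive numbers $\{L_j\}$ such that, for any $j\le m$, $$ \|v_{\text{snap}} - v_{\text{ms}}^{m+1}\|_{\mathcal{L}^2(D; \kappa^{-1})}^2 + \frac{1}{L_j} \sum_{i = 1}^{N_e} (S_i^{m+1})^2 \leq \epsilon_j \left( \|v_{\text{snap}} - v_{\text{ms}}^{m}\|_{\mathcal{L}^2(D; \kappa^{-1})}^2 + \frac{1}{L_j} \sum_{i = 1}^{N_e} (S_i^m)^2 \right),$$ where $\delta_0$ and $\rho$ satisfy $$ \frac{\lambda_{l_i^m+1}^{(i)}}{\lambda_{l_i^{m+1}+1}^{(i)}} \leq \delta_0 < 1 - (1 - \delta_0)\theta^2 < \rho < 1$$ for any coarse neighborhood $\omega_i$ selected at level $m$ for the addition of basis functions, and $$ \epsilon_j = \frac{C_{\text{err}} L_j + \rho}{C_{\text{err}} L_j + 1}.$$ The sequence is given by $$L_m = N_{\mathcal{T}}(1+\alpha^{-1})\max_{1\le i\le N_e} D_m^i,\qquad D_m^i = 2 (\lambda_{l_i^{m+1}+1}^{(i)})^{-1} (\max \{C_{\text{sup}}^{i, m}, 1 \})^2,$$ where $\alpha>0$ is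 the number determined by $\rho=(1+\alpha)(1-(1-\delta_0)\theta^2)$.
   Context: Problem and meshes. $D\subset\mathbb{R}^d$ is a domain with outward unit normal $n$; $\kappa>0$ is a permeability field; the flow problem is $\kappa^{-1}v+\nabla p=0$, $\mathrm{div}(v)=f$ in $D$, $v\cdot n=g$ on $\partial D$. $\mathcal{T}^H$ is a partition of $D$ into finite elements (coarse blocks) of size $H$, refined to a fine partition $\mathcal{T}^h$ of size $h$ conforming across coarse faces. For a coarse face $E_i$, $\omega_i$ is the union of the coarse blocks having $E_i$ as a face, and $n_i$ is a fixed unit normal on $E_i$. The indices $i=1,\dots,N_e$ in sums, maxima and the selection step refer to the faces whose neighborhood is a union of two coarse blocks, $\omega_i=K_1\cup K_2$. (Basis functions attached to faces on $\partial D$ serve only to impose the boundary condition.) $N_{\mathcal{T}}$ is the maximum number of faces of a coarse block. $Q$ is the space of functions constant on each coarse block. $\|v\|_{\mathcal{L}^2(\Omega;\kappa^{-1})}^2=\int_\Omega\kappa^{-1}|v|^2$ and $\|v\|_{H(\text{div};\Omega;\kappa^{-1})}^2=\int_\Omega\kappa^{-1}|v|^2+\int_\Omega\mathrm{div}(v)^2$. Snapshot space. Write $E_i=\bigcup_{j=1}^{J_i}e_j$ with $e_j$ the fine faces contained in $E_i$. For each $j$, $v_j^{(i)}$ is the (fine-grid mixed finite element) solution, computed separately on each coarse block $K\subseteq\omega_i$, of $\kappa^{-1}v_j^{(i)}+\nabla p_j^{(i)}=0$, $\mathrm{div}(v_j^{(i)})=\alpha_j^{(i)}$, with zero normal component on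 $\partial\omega_i$ (apart from $E_i$ itself) and $v_j^{(i)}\cdot n_i$ equal to $1$ on $e_j$ and $0$ on $E_i\setminus e_j$; $\alpha_j^{(i)}$ is constant on each coarse block and satisfies the compatibility condition $\int_K\alpha_j^{(i)}=\int_{\partial K}v_j^{(i)}\cdot n_{\partial K}$ ($n_{\partial K}$ the outward unit normal of $K$). These functions are extended by zero outside $\omega_i$. $V_{\text{snap}}^{(i)}=\mathrm{span}\{v_j^{(i)}\}_{j=1}^{J_i}$, $V_{\text{snap}}=\bigoplus_iV_{\text{snap}}^{(i)}$ over all coarse faces. Spectral problem 1. On each $\omega_i$: find $\lambda\in\mathbb{R}$, $v\in V_{\text{snap}}^{(i)}$ with $a_i(v,w)=\lambda s_i(v,w)$ for all $w\in V_{\text{snap}}^{(i)}$, where $a_i(v,w)=\int_{E_i}\kappa^{-1}(v\cdot n_i)(w\cdot n_i)$, $s_i(v,w)=\frac1H\left(\int_{\omega_i}\kappa^{-1}v\cdot w+\int_{\omega_i}\mathrm{div}(v)\,\mathrm{div}(w)\right)$. Eigenvalues are ordered $\lambda_1^{(i)}\le\dots\le\lambda_{J_i}^{(i)}$ with eigenfunctions $\phi_j^{(i)}$. Discrete solutions. For a subspace $V\subseteq V_{\text{snap}}$ let $V^0=\{v\in V:v\cdot n=0\text{ on }\partial D\}$; the solution in $V\times Q$ is a pair $(v_V,p_V)$ with $v_V\cdot n=g_H$ on $\partial D$, $\int_D\kappa^{-1}v_V\cdot w-\int_D\mathrm{div}(w)p_V=0$ for all $w\in V^0$, and $\int_D\mathrm{div}(v_V)q=\int_Dfq$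 for all $q\in Q$. Here $g_H$, constant on each fine face of $\partial D$, satisfies $\int_{E_i}(g_H-g)\phi\cdot n=0$ for all $\phi$ in the snapshot basis $\{v_j^{(i)}\}_j$ and all $E_i\subseteq\partial D$. $(v_{\text{snap}},p_{\text{snap}})$ is the solution for $V=V_{\text{snap}}$, and $(v_{\text{ms}}^m,p_{\text{ms}}^m)$ the solution for $V=V_{\text{ms}}^m$, where $V_{\text{ms}}^{(i),m}=\mathrm{span}\{\phi_1^{(i)},\dots,\phi_{l_i^m}^{(i)}\}$ and $V_{\text{ms}}^m=\bigoplus_iV_{\text{ms}}^{(i),m}$. These solutions are assumed to exist. Residuals and constants. $R_i^m(v)=\int_{\omega_i}\kappa^{-1}v_{\text{ms}}^m\cdot v-\int_{\omega_i}\mathrm{div}(v)p_{\text{ms}}^m$ for $v\in V_{\text{snap}}^{(i)}$, and $\|R_i^m\|_{(V_{\text{snap}}^{(i)})^*}=\sup_{0\ne v\in V_{\text{snap}}^{(i)}}|R_i^m(v)|/\|v\|_{H(\text{div};\omega_i;\kappa^{-1})}$. $C_{\text{sup}}^{i,m}$ is the infimum of $\sqrt{\frac{|K_1||K_2|}{|K_1|+|K_2|}}\,\|v\|_{\mathcal{L}^2(\omega_i;\kappa^{-1})}$ over all $v\in V_{\text{ms}}^{(i),m}$ with $\int_{E_i}v\cdot n_i=1$; it is assumed that each $V_{\text{ms}}^{(i),0}$ contains a function that is not divergence free, so this set is nonempty. $C_{\text{err}}=\frac{C_VH}{h}$ is the constant in the a-posteriori bound $\|v_{\text{snap}}-v_{\text{ms}}^m\|_{\mathcal{L}^2(D;\kappa^{-1})}^2\le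 C_{\text{err}}\sum_{i=1}^{N_e}(S_i^m)^2$ for spectral problem 1, with $C_V$ a constant depending on the polynomial order of the fine grid basis functions in $V_{\text{snap}}$. Offline adaptive method. Fix $0<\theta,\delta_0<1$ and initial numbers $l_i^0$. At level $m=0,1,2,\dots$: (1) compute $(v_{\text{ms}}^m,p_{\text{ms}}^m)$; (2) compute $\eta_i^2=(S_i^m)^2$ and reorder so that $\eta_1\ge\eta_2\ge\dots\ge\eta_{N_e}$; (3) take the smallest $k$ with $\theta^2\sum_{i=1}^{N_e}\eta_i^2\le\sum_{i=1}^k\eta_i^2$ and select $\omega_1,\dots,\omega_k$; (4) for each selected $\omega_i$ take the smallest $s_i$ such that $\lambda_{l_i^m+1}^{(i)}/\lambda_{l_i^m+s_i+1}^{(i)}\le\delta_0$ and set $l_i^{m+1}=l_i^m+s_i$; for the other neighborhoods set $l_i^{m+1}=l_i^m$. The levels considered are those for which all eigenvalues appearing exist (i.e. $l_i^m<J_i$). *)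

theory Defs
  imports "HOL-Analysis.Analysis"
begin

definition lin_span :: "'i set \<Rightarrow> ('i \<Rightarrow> 'a \<Rightarrow> 'b::real_vector) \<Rightarrow> ('a \<Rightarrow> 'b) set" where
  "lin_span I b = {f. \<exists>c. f = (\<lambda>x. \<Sum>i\<in>I. c i *\<^sub>R b i x)}"

definition sum_space :: "'i set \<Rightarrow> ('i \<Rightarrow> ('a \<Rightarrow> 'b::real_vector) set) \<Rightarrow> ('a \<Rightarrow> 'b) set" where
  "sum_space I V = {f. \<exists>u. (\<forall>i\<in>I. u i \<in> V i) \<and> f = (\<lambda>x. \<Sum>i\<in>I. u i x)}"

definition divergence :: "('a::euclidean_space \<Rightarrow> 'a) \<Rightarrow> 'a \<Rightarrow> real" where
  "divergence v x = (\<Sum>b\<in>Basis. frechet_derivative v (at x) b \<bullet> b)"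

text \<open>Conforming partition of the closure of \<open>D\<close> into full-dimensional convex polytopes
  (the condition on intersections is the one used in the library's \<open>triangulation\<close>).\<close>

definition fe_partition :: "'a::euclidean_space set \<Rightarrow> 'a set set \<Rightarrow> bool" where
  "fe_partition D T \<longleftrightarrow>
     finite T \<and> \<Union>T = closure D \<and>
     (\<forall>K\<in>T. polytope K \<and> interior K \<noteq> {}) \<and>
     (\<forall>K\<in>T. \<forall>K'\<in>T. (K \<inter> K') face_of K \<and> (K \<inter> K') face_of K')"

definition faces :: "'a::euclidean_space set set \<Rightarrow> 'a set set" where
  "faces T = {F. \<exists>K\<in>T. F facet_of K}"

definition mesh_size :: "'a::euclidean_space set set \<Rightarrow> real" where
  "mesh_size T = Max (diameter ` T)"

definition max_faces :: "'a::euclidean_space set set \<Rightarrow> nat" where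
  "max_faces T = Max ((\<lambda>K. card {F. F facet_of K}) ` T)"

definition unit_normal :: "'a::euclidean_space set \<Rightarrow> 'a \<Rightarrow> bool" where
  "unit_normal E n \<longleftrightarrow> norm n = 1 \<and> (\<forall>x\<in>E. \<forall>y\<in>E. n \<bullet> (x - y) = 0)"

definition outer_normal :: "'a::euclidean_space set \<Rightarrow> 'a set \<Rightarrow> 'a" where
  "outer_normal K E = (THE n. unit_normal E n \<and> (\<forall>x\<in>K. \<forall>y\<in>E. n \<bullet> (x - y) \<le> 0))"

text \<open>The library has no surface measure. For a flat face \<open>E\<close> with unit normal \<open>n\<close>, the
  \<open>(d-1)\<close>-dimensional Lebesgue measure on \<open>E\<close> is the image of the \<open>d\<close>-dimensional Lebesgue
  measure on the prism \<open>E + [0,1] n\<close> of unit height under orthogonal projection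
  (\<open>closest_point\<close>) onto the hyperplane of \<open>E\<close>; it does not depend on the sign of \<open>n\<close>.\<close>

definition prism :: "'a::euclidean_space set \<Rightarrow> 'a set" where
  "prism E = {x + t *\<^sub>R (SOME n. unit_normal E n) | x t. x \<in> E \<and> 0 \<le> t \<and> t \<le> 1}"

definition face_integrable :: "'a::euclidean_space set \<Rightarrow> ('a \<Rightarrow> real) \<Rightarrow> bool" where
  "face_integrable E f \<longleftrightarrow>
     set_integrable lebesgue (prism E) (\<lambda>y. f (closest_point (affine hull E) y))"

definition face_integral :: "'a::euclidean_space set \<Rightarrow> ('a \<Rightarrow> real) \<Rightarrow> real" where
  "face_integral E f = (LINT y:prism E|lebesgue. f (closest_point (affine hull E) y))"

text \<open>Coarse faces are indexed by themselves. \<open>vel_el\<close> and \<open>pres_el\<close> are the local velocity and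
  pressure spaces of the fine-grid mixed finite element, e.g. Raviart--Thomas of some order.
  \<open>fface E j\<close>, \<open>snap E j\<close>, \<open>eigval E j\<close>, \<open>eigfun E j\<close> for \<open>1 \<le> j \<le> nfine E\<close> are
  \<open>e\<^sub>j\<close>, \<open>v\<^sub>j\<close>, \<open>\<lambda>\<^sub>j\<close>, \<open>\<phi>\<^sub>j\<close> on the neighborhood of \<open>E\<close>.\<close>

record 'a gms =
  flow_dom :: "'a set"
  perm :: "'a \<Rightarrow> real"
  source :: "'a \<Rightarrow> real"
  bflux :: "'a \<Rightarrow> real"
  bflux_h :: "'a \<Rightarrow> real"
  coarse_grid :: "'a set set"
  fine_grid :: "'a set set"
  fnormal :: "'a set \<Rightarrow> 'a"
  vel_el :: "'a set \<Rightarrow> ('a \<Rightarrow> 'a) set"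
  pres_el :: "'a set \<Rightarrow> ('a \<Rightarrow> real) set"
  fface :: "'a set \<Rightarrow> nat \<Rightarrow> 'a set"
  snap :: "'a set \<Rightarrow> nat \<Rightarrow> 'a \<Rightarrow> 'a"
  eigval :: "'a set \<Rightarrow> nat \<Rightarrow> real"
  eigfun :: "'a set \<Rightarrow> nat \<Rightarrow> 'a \<Rightarrow> 'a"

definition blocks :: "('a::euclidean_space) gms \<Rightarrow> 'a set \<Rightarrow> 'a set set" where
  "blocks S E = {K \<in> coarse_grid S. E facet_of K}"

definition nbhd :: "('a::euclidean_space) gms \<Rightarrow> 'a set \<Rightarrow> 'a set" where
  "nbhd S E = \<Union>(blocks S E)"

definition interior_faces :: "('a::euclidean_space) gms \<Rightarrow> 'a set set" where
  "interior_faces S = {E \<in> faces (coarse_grid S). card (blocks S E) = 2}"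

definition boundary_faces :: "('a::euclidean_space) gms \<Rightarrow> 'a set set" where
  "boundary_faces S = {E \<in> faces (coarse_grid S). E \<subseteq> frontier (flow_dom S)}"

definition fine_in :: "('a::euclidean_space) gms \<Rightarrow> 'a set \<Rightarrow> 'a set set" where
  "fine_in S E = {e \<in> faces (fine_grid S). e \<subseteq> E}"

definition nfine :: "('a::euclidean_space) gms \<Rightarrow> 'a set \<Rightarrow> nat" where
  "nfine S E = card (fine_in S E)"

definition poly_space :: "('a::euclidean_space \<Rightarrow> 'b::euclidean_space) set \<Rightarrow> bool" where
  "poly_space V \<longleftrightarrow>
     (\<exists>N b. (\<forall>i<N. polynomial_function (b i)) \<and> V = lin_span {..<N::nat} b)"

definition mixed_element ::
    "('a::euclidean_space \<Rightarrow> 'a) set \<Rightarrow> ('a \<Rightarrow> real) set \<Rightarrow> bool" where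
  "mixed_element V Q \<longleftrightarrow>
     poly_space V \<and> poly_space Q \<and> divergence ` V = Q \<and> (\<forall>c. (\<lambda>_. c) \<in> Q)"

definition cells :: "('a::euclidean_space) gms \<Rightarrow> 'a set" where
  "cells S = (\<Union>\<tau>\<in>fine_grid S. interior \<tau>)"

text \<open>Normal trace of a piecewise polynomial field: the limit of \<open>v \<bullet> n\<close> taken through the
  element interiors. On a boundary face the limit is one-sided; on a face between two
  elements its existence is the continuity of the normal component. The trace is only used
  at points in the relative interior of fine faces, that is, almost everywhere on every face.\<close>

definition ntrace :: "('a::euclidean_space) gms \<Rightarrow> ('a \<Rightarrow> 'a) \<Rightarrow> 'a \<Rightarrow> 'a \<Rightarrow> real" where
  "ntrace S v n x = Lim (at x within cells S) (\<lambda>y. v y \<bullet> n)"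

text \<open>Fields vanish off the element interiors (a null set of \<open>D\<close>), which makes the
  representative of the almost-everywhere class unique. By normal continuity the weak
  divergence is the elementwise one.\<close>

definition vel_h :: "('a::euclidean_space) gms \<Rightarrow> ('a \<Rightarrow> 'a) set" where
  "vel_h S = {v.
     (\<forall>\<tau>\<in>fine_grid S. \<exists>P\<in>vel_el S \<tau>. \<forall>x\<in>interior \<tau>. v x = P x) \<and>
     (\<forall>x. x \<notin> cells S \<longrightarrow> v x = 0) \<and>
     (\<forall>e\<in>faces (fine_grid S). \<forall>x\<in>rel_interior e. \<forall>n. unit_normal e n \<longrightarrow>
        (\<exists>l. ((\<lambda>y. v y \<bullet> n) \<longlongrightarrow> l) (at x within cells S)))}"

definition pres_h :: "('a::euclidean_space) gms \<Rightarrow> ('a \<Rightarrow> real) set" where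
  "pres_h S = {q. \<forall>\<tau>\<in>fine_grid S. \<exists>P\<in>pres_el S \<tau>. \<forall>x\<in>interior \<tau>. q x = P x}"

definition pres_H :: "('a::euclidean_space) gms \<Rightarrow> ('a \<Rightarrow> real) set" where
  "pres_H S = {q. \<forall>K\<in>coarse_grid S. \<exists>c. \<forall>x\<in>interior K. q x = c}"

definition zero_ntrace :: "('a::euclidean_space) gms \<Rightarrow> ('a \<Rightarrow> 'a) \<Rightarrow> 'a set \<Rightarrow> bool" where
  "zero_ntrace S v e \<longleftrightarrow> (\<forall>x\<in>rel_interior e. \<forall>n. unit_normal e n \<longrightarrow> ntrace S v n x = 0)"

definition vel_h0 :: "('a::euclidean_space) gms \<Rightarrow> 'a set \<Rightarrow> ('a \<Rightarrow> 'a) set" where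
  "vel_h0 S K = {w \<in> vel_h S. (\<forall>x. x \<notin> K \<longrightarrow> w x = 0) \<and>
     (\<forall>e\<in>fine_in S (frontier K). zero_ntrace S w e)}"

definition wform ::
    "('a::euclidean_space) gms \<Rightarrow> 'a set \<Rightarrow> ('a \<Rightarrow> 'a) \<Rightarrow> ('a \<Rightarrow> 'a) \<Rightarrow> real" where
  "wform S A v w = (LINT x:A|lebesgue. inverse (perm S x) * (v x \<bullet> w x))"

definition dform ::
    "'a::euclidean_space set \<Rightarrow> ('a \<Rightarrow> 'a) \<Rightarrow> ('a \<Rightarrow> real) \<Rightarrow> real" where
  "dform A v q = (LINT x:A|lebesgue. divergence v x * q x)"

definition wnorm :: "('a::euclidean_space) gms \<Rightarrow> 'a set \<Rightarrow> ('a \<Rightarrow> 'a) \<Rightarrow> real" where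
  "wnorm S A v = sqrt (LINT x:A|lebesgue. inverse (perm S x) * (norm (v x))\<^sup>2)"

definition hdiv_norm :: "('a::euclidean_space) gms \<Rightarrow> 'a set \<Rightarrow> ('a \<Rightarrow> 'a) \<Rightarrow> real" where
  "hdiv_norm S A v =
     sqrt ((LINT x:A|lebesgue. inverse (perm S x) * (norm (v x))\<^sup>2)
           + (LINT x:A|lebesgue. (divergence v x)\<^sup>2))"

definition is_snapshot ::
    "('a::euclidean_space) gms \<Rightarrow> 'a set \<Rightarrow> nat \<Rightarrow> ('a \<Rightarrow> 'a) \<Rightarrow> bool" where
  "is_snapshot S E j v \<longleftrightarrow>
     v \<in> vel_h S \<and> (\<forall>x. x \<notin> nbhd S E \<longrightarrow> v x = 0) \<and>
     (\<forall>k\<in>{1..nfine S E}. \<forall>x\<in>rel_interior (fface S E k).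
        ntrace S v (fnormal S E) x = (if k = j then 1 else 0)) \<and>
     (\<forall>e\<in>fine_in S (frontier (nbhd S E)). \<not> e \<subseteq> E \<longrightarrow> zero_ntrace S v e) \<and>
     (\<forall>K\<in>blocks S E. \<exists>a::real. \<exists>p\<in>pres_h S.
        (\<forall>w\<in>vel_h0 S K. wform S K v w - dform K w p = 0) \<and>
        (\<forall>q\<in>pres_h S. dform K v q = (LINT x:K|lebesgue. a * q x)) \<and>
        (LINT x:K|lebesgue. a) =
          (\<Sum>F | F facet_of K. face_integral F (ntrace S v (outer_normal K F))))"

definition snap_local :: "('a::euclidean_space) gms \<Rightarrow> 'a set \<Rightarrow> ('a \<Rightarrow> 'a) set" where
  "snap_local S E = lin_span {1..nfine S E} (snap S E)"

definition snap_space :: "('a::euclidean_space) gms \<Rightarrow> ('a \<Rightarrow> 'a) set" where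
  "snap_space S = sum_space (faces (coarse_grid S)) (snap_local S)"

definition a_form ::
    "('a::euclidean_space) gms \<Rightarrow> 'a set \<Rightarrow> ('a \<Rightarrow> 'a) \<Rightarrow> ('a \<Rightarrow> 'a) \<Rightarrow> real" where
  "a_form S E v w = face_integral E (\<lambda>x.
     inverse (perm S x) * ntrace S v (fnormal S E) x * ntrace S w (fnormal S E) x)"

definition s_form ::
    "('a::euclidean_space) gms \<Rightarrow> 'a set \<Rightarrow> ('a \<Rightarrow> 'a) \<Rightarrow> ('a \<Rightarrow> 'a) \<Rightarrow> real" where
  "s_form S E v w = 1 / mesh_size (coarse_grid S) *
     (wform S (nbhd S E) v w + dform (nbhd S E) v (divergence w))"

text \<open>A complete ordered list of eigenvalues, repeated according to multiplicity.\<close>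

definition spectral_problem :: "('a::euclidean_space) gms \<Rightarrow> 'a set \<Rightarrow> bool" where
  "spectral_problem S E \<longleftrightarrow>
     (\<forall>j\<in>{1..nfine S E}.
        eigfun S E j \<in> snap_local S E \<and> eigfun S E j \<noteq> (\<lambda>_. 0) \<and>
        (\<forall>w\<in>snap_local S E.
           a_form S E (eigfun S E j) w = eigval S E j * s_form S E (eigfun S E j) w)) \<and>
     (\<forall>j k. 1 \<le> j \<and> j \<le> k \<and> k \<le> nfine S E \<longrightarrow> eigval S E j \<le> eigval S E k) \<and>
     lin_span {1..nfine S E} (eigfun S E) = snap_local S E"

definition bdry_trace :: "('a::euclidean_space) gms \<Rightarrow> ('a \<Rightarrow> 'a) \<Rightarrow> ('a \<Rightarrow> real) \<Rightarrow> bool" where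
  "bdry_trace S v b \<longleftrightarrow>
     (\<forall>E\<in>boundary_faces S. \<forall>K\<in>blocks S E. \<forall>e\<in>fine_in S E. \<forall>x\<in>rel_interior e.
        ntrace S v (outer_normal K E) x = b x)"

definition discrete_solution ::
    "('a::euclidean_space) gms \<Rightarrow> ('a \<Rightarrow> 'a) set \<Rightarrow> ('a \<Rightarrow> 'a) \<Rightarrow> ('a \<Rightarrow> real) \<Rightarrow> bool" where
  "discrete_solution S V v p \<longleftrightarrow>
     v \<in> V \<and> p \<in> pres_H S \<and> bdry_trace S v (bflux_h S) \<and>
     (\<forall>w\<in>V. bdry_trace S w (\<lambda>_. 0) \<longrightarrow> wform S (flow_dom S) v w - dform (flow_dom S) w p = 0) \<and>
     (\<forall>q\<in>pres_H S. dform (flow_dom S) v q = (LINT x:flow_dom S|lebesgue. source S x * q x))"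

text \<open>The condition \<open>flow_dom S = interior (closure (flow_dom S))\<close> excludes slits, so that the
  domain has an outward normal on its boundary. The integrability conditions say that the data
  terms and the bilinear forms are finite.\<close>

definition flow_problem :: "('a::euclidean_space) gms \<Rightarrow> bool" where
  "flow_problem S \<longleftrightarrow>
     open (flow_dom S) \<and> connected (flow_dom S) \<and> flow_dom S \<noteq> {} \<and>
     flow_dom S = interior (closure (flow_dom S)) \<and>
     (\<forall>x\<in>closure (flow_dom S). perm S x > 0) \<and>
     set_integrable lebesgue (flow_dom S) (\<lambda>x. inverse (perm S x)) \<and>
     (\<forall>E\<in>faces (coarse_grid S). face_integrable E (\<lambda>x. inverse (perm S x))) \<and>
     set_integrable lebesgue (flow_dom S) (source S) \<and>
     (\<forall>E\<in>boundary_faces S. face_integrable E (bflux S))"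

definition grids :: "('a::euclidean_space) gms \<Rightarrow> bool" where
  "grids S \<longleftrightarrow>
     fe_partition (flow_dom S) (coarse_grid S) \<and> fe_partition (flow_dom S) (fine_grid S) \<and>
     (\<forall>\<tau>\<in>fine_grid S. \<exists>K\<in>coarse_grid S. \<tau> \<subseteq> K) \<and>
     (\<forall>\<tau>\<in>fine_grid S. mixed_element (vel_el S \<tau>) (pres_el S \<tau>)) \<and>
     (\<forall>E\<in>faces (coarse_grid S).
        unit_normal E (fnormal S E) \<and>
        bij_betw (fface S E) {1..nfine S E} (fine_in S E) \<and>
        E = (\<Union>j\<in>{1..nfine S E}. fface S E j))"

definition boundary_data :: "('a::euclidean_space) gms \<Rightarrow> bool" where
  "boundary_data S \<longleftrightarrow>
     (\<forall>E\<in>boundary_faces S.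
        (\<forall>e\<in>fine_in S E. \<exists>c. \<forall>x\<in>rel_interior e. bflux_h S x = c) \<and>
        (\<forall>K\<in>blocks S E. \<forall>j\<in>{1..nfine S E}.
           face_integral E (\<lambda>x. (bflux_h S x - bflux S x) *
             ntrace S (snap S E j) (outer_normal K E) x) = 0))"

definition gms_setting :: "('a::euclidean_space) gms \<Rightarrow> bool" where
  "gms_setting S \<longleftrightarrow>
     flow_problem S \<and> grids S \<and>
     (\<forall>E\<in>faces (coarse_grid S).
        (\<forall>j\<in>{1..nfine S E}. is_snapshot S E j (snap S E j)) \<and> spectral_problem S E) \<and>
     boundary_data S"

text \<open>\<open>l E\<close> is the number of eigenfunctions used on the neighborhood of \<open>E\<close>.\<close>

definition ms_local :: "('a::euclidean_space) gms \<Rightarrow> ('a set \<Rightarrow> nat) \<Rightarrow> 'a set \<Rightarrow> ('a \<Rightarrow> 'a) set" where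
  "ms_local S l E = lin_span {1..l E} (eigfun S E)"

definition ms_space :: "('a::euclidean_space) gms \<Rightarrow> ('a set \<Rightarrow> nat) \<Rightarrow> ('a \<Rightarrow> 'a) set" where
  "ms_space S l = sum_space (faces (coarse_grid S)) (ms_local S l)"

definition residual ::
    "('a::euclidean_space) gms \<Rightarrow> 'a set \<Rightarrow> ('a \<Rightarrow> 'a) \<Rightarrow> ('a \<Rightarrow> real) \<Rightarrow> ('a \<Rightarrow> 'a) \<Rightarrow> real" where
  "residual S E v p w = wform S (nbhd S E) v w - dform (nbhd S E) w p"

definition residual_norm ::
    "('a::euclidean_space) gms \<Rightarrow> 'a set \<Rightarrow> ('a \<Rightarrow> 'a) \<Rightarrow> ('a \<Rightarrow> real) \<Rightarrow> real" where
  "residual_norm S E v p =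
     (SUP w \<in> snap_local S E - {\<lambda>_. 0}. \<bar>residual S E v p w\<bar> / hdiv_norm S (nbhd S E) w)"

definition err_indicator ::
    "('a::euclidean_space) gms \<Rightarrow> ('a set \<Rightarrow> nat) \<Rightarrow> ('a \<Rightarrow> 'a) \<Rightarrow> ('a \<Rightarrow> real) \<Rightarrow> 'a set \<Rightarrow> real" where
  "err_indicator S l v p E = residual_norm S E v p * eigval S E (l E + 1) powr (- 1 / 2)"

definition C_sup :: "('a::euclidean_space) gms \<Rightarrow> ('a set \<Rightarrow> nat) \<Rightarrow> 'a set \<Rightarrow> real" where
  "C_sup S l E = Inf {sqrt ((\<Prod>K\<in>blocks S E. measure lebesgue K) /
                             (\<Sum>K\<in>blocks S E. measure lebesgue K)) * wnorm S (nbhd S E) v | v.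
                       v \<in> ms_local S l E \<and>
                       face_integral E (ntrace S v (fnormal S E)) = 1}"

definition marked :: "real \<Rightarrow> 'i set \<Rightarrow> ('i \<Rightarrow> real) \<Rightarrow> 'i set \<Rightarrow> bool" where
  "marked \<theta> A \<eta> X \<longleftrightarrow>
     (\<exists>\<sigma>. bij_betw \<sigma> {1..card A} A \<and>
        (\<forall>a b. 1 \<le> a \<and> a \<le> b \<and> b \<le> card A \<longrightarrow> \<eta> (\<sigma> b) \<le> \<eta> (\<sigma> a)) \<and>
        X = \<sigma> ` {1..(LEAST k. \<theta>\<^sup>2 * (\<Sum>i\<in>A. (\<eta> i)\<^sup>2) \<le> (\<Sum>a=1..k. (\<eta> (\<sigma> a))\<^sup>2))})"

definition enriched :: "real \<Rightarrow> nat \<Rightarrow> (nat \<Rightarrow> real) \<Rightarrow> nat \<Rightarrow> nat \<Rightarrow> bool" where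
  "enriched \<delta>0 J ev k k' \<longleftrightarrow>
     (\<exists>s. k' = k + s \<and> k + s + 1 \<le> J \<and> ev (k + 1) / ev (k + s + 1) \<le> \<delta>0 \<and>
        (\<forall>t<s. \<not> ev (k + 1) / ev (k + t + 1) \<le> \<delta>0))"

text \<open>A run reaching all levels \<open>m \<le> M\<close>, where \<open>M = \<infinity>\<close> is allowed. \<open>sel m\<close> is the set of faces
  whose neighborhoods are enriched between levels \<open>m\<close> and \<open>m + 1\<close>.\<close>

definition adaptive_run ::
    "('a::euclidean_space) gms \<Rightarrow> real \<Rightarrow> real \<Rightarrow> enat \<Rightarrow> (nat \<Rightarrow> 'a set \<Rightarrow> nat) \<Rightarrow>
     (nat \<Rightarrow> 'a set set) \<Rightarrow> (nat \<Rightarrow> 'a \<Rightarrow> 'a) \<Rightarrow> (nat \<Rightarrow> 'a \<Rightarrow> real) \<Rightarrow> bool" where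
  "adaptive_run S \<theta> \<delta>0 M l sel v p \<longleftrightarrow>
     (\<forall>E\<in>faces (coarse_grid S). l 0 E \<le> nfine S E) \<and>
     (\<forall>m. enat m \<le> M \<longrightarrow>
        (\<forall>E\<in>interior_faces S. l m E < nfine S E) \<and>
        discrete_solution S (ms_space S (l m)) (v m) (p m)) \<and>
     (\<forall>m. enat m < M \<longrightarrow>
        marked \<theta> (interior_faces S) (err_indicator S (l m) (v m) (p m)) (sel m) \<and>
        (\<forall>E\<in>sel m. enriched \<delta>0 (nfine S E) (eigval S E) (l m E) (l (Suc m) E)) \<and>
        (\<forall>E\<in>faces (coarse_grid S) - sel m. l (Suc m) E = l m E))"

end

theory Submission
  imports Defs
begin

text \<open>
  Write \<open>e\<^sub>m\<close> for the velocity error at level \<open>m\<close> and \<open>\<eta>\<^sub>m\<close> for the square root of the sum of the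
  squared indicators. The proof combines three facts.

  Galerkin orthogonality (\<open>galerkin_orthogonality\<close>). The spaces of successive levels are nested
  and all solutions have the same discrete divergence and the same boundary flux. So the increment
  \<open>\<Delta> = v\<^sub>m\<^sub>+\<^sub>1 - v\<^sub>m\<close> is an admissible test field whose divergence is orthogonal to all
  coarse pressures, and
  \<open>|e\<^sub>m|\<^sup>2 = |e\<^sub>m\<^sub>+\<^sub>1|\<^sup>2 + |\<Delta>|\<^sup>2\<close>.

  Change of the residuals (\<open>residual_change\<close>). On a block \<open>K\<close> of the neighborhood of \<open>E\<close>, the
  divergence of a snapshot field is the constant \<open>\<plusminus> s / |K|\<close>, where \<open>s\<close> is its flux through \<open>E\<close>
  (\<open>divergence_snap_local\<close>). Hence the pairing of the divergence with a pressure is a multiple of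
  \<open>s\<close>, and \<open>|s|\<close> is the norm of the divergence times the geometric factor in \<open>C_sup\<close>. Testing the
  equations of two levels with a coarse field of flux one, whose existence is guaranteed by the
  field that is not divergence free, bounds the change of the multiplier of \<open>s\<close> by the norm of the
  increment on the neighborhood. This gives
  \<open>|R\<^sub>m\<^sub>+\<^sub>1| \<le> |R\<^sub>m| + sqrt 2 * max C_sup 1 * |\<Delta>|\<close> for the dual norms of the residuals.

  Reduction of the indicators (\<open>indicator_sum_step\<close>). Squaring with a weight \<open>\<alpha>\<close>, dividing by
  the new eigenvalue (positive by \<open>eigval_pos\<close>), and summing, the eigenvalue ratio, which is at most
  \<open>\<delta>0\<close> on the selected neighborhoods, and the marking rule give
  \<open>\<eta>\<^sub>m\<^sub>+\<^sub>1\<^sup>2 \<le> \<rho> \<eta>\<^sub>m\<^sup>2 + L\<^sub>m |\<Delta>|\<^sup>2\<close>; the maximal number of faces enters because a block lies in at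
  most that many neighborhoods.

  Since \<open>L\<^sub>m \<le> L\<^sub>j\<close>, dividing by \<open>L\<^sub>j\<close> cancels \<open>|\<Delta>|\<^sup>2\<close> against the first identity, and the
  a-posteriori bound turns the remaining estimate into a contraction (\<open>contraction_step\<close>).

  Most of the text below supplies the analysis behind these steps: conforming partitions into
  polytopes, integrals of piecewise continuous functions, surface integrals of piecewise constant
  functions, and the linearity of normal traces.
\<close>

section \<open>Facets of polytopes and their normals\<close>

lemma unit_normal_subset: "unit_normal E n \<Longrightarrow> e \<subseteq> E \<Longrightarrow> unit_normal e n"
  by (auto simp: unit_normal_def)

lemma affine_hull_unit_normal:
  fixes F :: "'a::euclidean_space set"
  assumes n: "unit_normal F n" and dim: "aff_dim F = int DIM('a) - 1" and x: "x \<in> F"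
  shows "affine hull F = {y. n \<bullet> y = n \<bullet> x}"
proof -
  have "norm n = 1" and *: "\<And>x y. x \<in> F \<Longrightarrow> y \<in> F \<Longrightarrow> n \<bullet> (x - y) = 0"
    using n by (auto simp: unit_normal_def)
  then have "n \<noteq> 0" by auto
  have sub: "F \<subseteq> {y. n \<bullet> y = n \<bullet> x}"
    using *[OF _ x] by (auto simp: inner_diff_right)
  have "aff_dim {y. n \<bullet> y = n \<bullet> x} = aff_dim F"
    using \<open>n \<noteq> 0\<close> dim by (simp add: aff_dim_hyperplane)
  moreover have "affine hull F \<subseteq> {y. n \<bullet> y = n \<bullet> x}"
    using sub affine_hyperplane by (rule hull_minimal)
  moreover have "affine hull F \<noteq> {}" using x by auto
  ultimately show ?thesis
    by (intro affine_dim_equal) (simp_all add: affine_hyperplane)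
qed

lemma unit_normal_unique:
  fixes F :: "'a::euclidean_space set"
  assumes n: "unit_normal F n" and m: "unit_normal F m"
    and dim: "aff_dim F = int DIM('a) - 1" and ne: "F \<noteq> {}"
  shows "m = n \<or> m = - n"
proof -
  obtain x where x: "x \<in> F" using ne by auto
  define z where "z = m - (m \<bullet> n) *\<^sub>R n"
  have nn: "n \<bullet> n = 1" "m \<bullet> m = 1"
    using n m by (auto simp: unit_normal_def dot_square_norm)
  have nz: "n \<bullet> z = 0"
    by (simp add: z_def inner_diff_right nn inner_commute)
  then have "x + z \<in> affine hull F"
    using affine_hull_unit_normal[OF n dim x] by (simp add: inner_add_right)
  then have mz: "m \<bullet> z = 0"
    using affine_hull_unit_normal[OF m dim x] by (simp add: inner_add_right)
  have "z \<bullet> z = m \<bullet> z - (m \<bullet> n) * (n \<bullet> z)"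
    by (simp add: z_def inner_diff_left inner_diff_right algebra_simps inner_commute)
  then have "z = 0" using nz mz by simp
  then have eq: "m = (m \<bullet> n) *\<^sub>R n" by (simp add: z_def)
  then have "norm m = \<bar>m \<bullet> n\<bar> * norm n" by (metis norm_scaleR)
  then have "\<bar>m \<bullet> n\<bar> = 1" using n m by (simp add: unit_normal_def)
  then show ?thesis using eq by (cases "m \<bullet> n \<ge> 0") auto
qed

lemma aff_dim_facet:
  fixes K :: "'a::euclidean_space set"
  assumes "F facet_of K" "interior K \<noteq> {}"
  shows "aff_dim F = int DIM('a) - 1"
  using assms aff_dim_nonempty_interior[of K] by (auto simp: facet_of_def)

text \<open>On a facet of a full-dimensional polytope, \<^const>\<open>outer_normal\<close> is well defined.\<close>

lemma outer_normal:
  fixes K :: "'a::euclidean_space set"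
  assumes K: "polytope K" "interior K \<noteq> {}" and F: "F facet_of K"
  shows "unit_normal F (outer_normal K F)"
    and "\<And>x y. x \<in> K \<Longrightarrow> y \<in> F \<Longrightarrow> outer_normal K F \<bullet> (x - y) \<le> 0"
proof -
  obtain a b where a: "a \<noteq> 0" "K \<subseteq> {x. a \<bullet> x \<le> b}" "F = K \<inter> {x. a \<bullet> x = b}"
    using facet_of_polyhedron[OF polytope_imp_polyhedron[OF K(1)] F] by metis
  define n where "n = a /\<^sub>R norm a"
  have n: "unit_normal F n \<and> (\<forall>x\<in>K. \<forall>y\<in>F. n \<bullet> (x - y) \<le> 0)"
    using a by (auto simp: unit_normal_def n_def inner_diff_right divide_simps
        intro!: mult_left_mono)
  have dim: "aff_dim F = int DIM('a) - 1" using aff_dim_facet F K by blast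
  have ne: "F \<noteq> {}" using F by (auto simp: facet_of_def)
  have uniq: "m = n" if m: "unit_normal F m \<and> (\<forall>x\<in>K. \<forall>y\<in>F. m \<bullet> (x - y) \<le> 0)" for m
  proof (rule ccontr)
    assume "m \<noteq> n"
    then have m: "\<forall>x\<in>K. \<forall>y\<in>F. - n \<bullet> (x - y) \<le> 0"
      using unit_normal_unique[of F n m] n m dim ne by auto
    obtain y where y: "y \<in> F" using ne by auto
    have "K \<subseteq> {x. n \<bullet> x = n \<bullet> y}"
      using m n y by (force simp: inner_diff_right)
    then have "interior K \<subseteq> interior {x. n \<bullet> x = n \<bullet> y}" by (rule interior_mono)
    moreover have "n \<noteq> 0" using n by (auto simp: unit_normal_def)
    ultimately show False using K(2) by simp
  qed
  have "unit_normal F (outer_normal K F) \<and> (\<forall>x\<in>K. \<forall>y\<in>F. outer_normal K F \<bullet> (x - y) \<le> 0)"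
    unfolding outer_normal_def by (rule theI[of _ n]) (use n uniq in blast)+
  then show "unit_normal F (outer_normal K F)"
    and "\<And>x y. x \<in> K \<Longrightarrow> y \<in> F \<Longrightarrow> outer_normal K F \<bullet> (x - y) \<le> 0"
    by auto
qed

section \<open>Conforming partitions\<close>

text \<open>The blocks and faces of one conforming partition; used for the coarse and the fine grid.\<close>

locale conforming_partition =
  fixes D :: "'a::euclidean_space set" and T :: "'a set set"
  assumes partition: "fe_partition D T"
begin

lemma finite_T: "finite T"
  and Union_T: "\<Union>T = closure D"
  and polytope_T: "K \<in> T \<Longrightarrow> polytope K"
  and interior_T: "K \<in> T \<Longrightarrow> interior K \<noteq> {}"
  and Int_face_left: "K \<in> T \<Longrightarrow> K' \<in> T \<Longrightarrow> (K \<inter> K') face_of K"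
  and Int_face_right: "K \<in> T \<Longrightarrow> K' \<in> T \<Longrightarrow> (K \<inter> K') face_of K'"
  using partition by (auto simp: fe_partition_def)

lemma convex_T: "K \<in> T \<Longrightarrow> convex K"
  and closed_T: "K \<in> T \<Longrightarrow> closed K"
  and compact_T: "K \<in> T \<Longrightarrow> compact K"
  and bounded_T: "K \<in> T \<Longrightarrow> bounded K"
  using polytope_T by (auto simp: polytope_imp_convex polytope_imp_closed polytope_imp_compact
      polytope_imp_bounded)

lemma subset_closure: "K \<in> T \<Longrightarrow> K \<subseteq> closure D"
  using Union_T by auto

lemma closure_interior_T: "K \<in> T \<Longrightarrow> closure (interior K) = K"
  using convex_closure_interior[of K] convex_T interior_T closed_T by auto

lemma block_unique:
  assumes K: "K \<in> T" "K' \<in> T" and x: "x \<in> interior K" "x \<in> K'"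
  shows "K = K'"
proof -
  have "K \<inter> K' = K"
    using face_of_disjoint_interior[OF Int_face_left[OF K]] x interior_subset[of K] by blast
  then have sub: "K \<subseteq> K'" by auto
  have "interior K \<subseteq> interior K'" using sub by (rule interior_mono)
  then have "(K \<inter> K') \<inter> interior K' \<noteq> {}"
    using x interior_subset[of K] by auto
  then have "K \<inter> K' = K'"
    using face_of_disjoint_interior[OF Int_face_right[OF K]] by blast
  with \<open>K \<inter> K' = K\<close> show ?thesis by simp
qed

lemma Int_proper:
  assumes "K \<in> T" "K' \<in> T" "K \<noteq> K'"
  shows "K \<inter> K' \<noteq> K"
  using block_unique[OF assms(1,2)] assms interior_T[of K] interior_subset[of K] by blast

lemma facesD:
  assumes "e \<in> faces T"
  obtains K where "K \<in> T" "e facet_of K"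
  using assms by (auto simp: faces_def)

lemma
  assumes "e \<in> faces T"
  shows polytope_faces: "polytope e" and faces_ne: "e \<noteq> {}"
    and aff_dim_faces: "aff_dim e = int DIM('a) - 1"
    and rel_interior_faces: "rel_interior e \<noteq> {}"
proof -
  obtain K where K: "K \<in> T" "e facet_of K" using assms by (rule facesD)
  then show p: "polytope e" using face_of_polytope_polytope polytope_T
    by (metis facet_of_imp_face_of)
  show ne: "e \<noteq> {}" using K by (auto simp: facet_of_def)
  show "aff_dim e = int DIM('a) - 1" using aff_dim_facet K interior_T by blast
  show "rel_interior e \<noteq> {}"
    using p ne rel_interior_eq_empty polytope_imp_convex by blast
qed

lemma finite_facets: "K \<in> T \<Longrightarrow> finite {F. F facet_of K}"
  using finite_polytope_facets polytope_T by blast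

lemma finite_faces: "finite (faces T)"
proof -
  have "faces T = (\<Union>K\<in>T. {F. F facet_of K})" by (auto simp: faces_def)
  then show ?thesis using finite_T finite_facets by auto
qed

lemma face_subset_closure: "e \<in> faces T \<Longrightarrow> e \<subseteq> closure D"
  by (meson facesD facet_of_imp_subset subset_closure subset_trans)

lemma Int_eq_facet:
  assumes K: "K \<in> T" "K' \<in> T" "K \<noteq> K'" and e: "e facet_of K" "e \<subseteq> K'"
  shows "K \<inter> K' = e"
proof (rule ccontr)
  assume ne: "K \<inter> K' \<noteq> e"
  have lt: "aff_dim (K \<inter> K') < aff_dim K"
    using face_of_aff_dim_lt[OF convex_T[OF K(1)] Int_face_left[OF K(1,2)]] Int_proper[OF K] by auto
  have "e face_of (K \<inter> K')"
    using face_of_face[OF Int_face_left[OF K(1,2)]] e facet_of_imp_face_of facet_of_imp_subset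
    by blast
  then have "aff_dim e < aff_dim (K \<inter> K')"
    using face_of_aff_dim_lt[of "K \<inter> K'" e] ne convex_T K convex_Int by blast
  then show False using lt e(1) by (simp add: facet_of_def)
qed

text \<open>Conformity at the level of faces: a block containing a relative interior point of a face
  has that face as a facet, and distinct faces have disjoint relative interiors.\<close>

lemma facet_of_if_meets:
  assumes e: "e \<in> faces T" and K: "K \<in> T" and x: "x \<in> rel_interior e" "x \<in> K"
  shows "e facet_of K"
proof -
  obtain K' where K': "K' \<in> T" "e facet_of K'" using e by (rule facesD)
  show ?thesis
  proof (cases "K = K'")
    case False
    have ef: "e face_of K'" using K' facet_of_imp_face_of by blast
    have xe: "x \<in> e" using x rel_interior_subset by blast
    have sub: "e \<subseteq> K' \<inter> K"
      by (rule subset_of_face_of[OF Int_face_left[OF K'(1) K]])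
        (use face_of_imp_subset[OF ef] xe x in auto)
    have "e = K' \<inter> K"
      using Int_eq_facet[OF K'(1) K _ K'(2)] sub False by auto
    then have "e face_of K" using Int_face_right[OF K'(1) K] by simp
    then show ?thesis
      using K'(2) aff_dim_nonempty_interior[OF interior_T[OF K]]
        aff_dim_nonempty_interior[OF interior_T[OF K'(1)]] by (simp add: facet_of_def)
  qed (use K' in simp)
qed

lemma face_unique:
  assumes e: "e \<in> faces T" "e' \<in> faces T" and x: "x \<in> rel_interior e" "x \<in> e'"
  shows "e = e'"
proof -
  obtain K where K: "K \<in> T" "e' facet_of K" using e(2) by (rule facesD)
  have xK: "x \<in> K" using x(2) K facet_of_imp_subset by blast
  have eK: "e facet_of K" by (rule facet_of_if_meets[OF e(1) K(1) x(1) xK])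
  have sub: "e \<subseteq> e'"
    by (rule subset_of_face_of[of e' K]) (use K eK x facet_of_imp_subset facet_of_imp_face_of in auto)
  have "e face_of e'"
    using face_of_subset[of e K e'] eK sub K facet_of_imp_face_of facet_of_imp_subset by blast
  moreover have "convex e'" using polytope_faces[OF e(2)] polytope_imp_convex by blast
  moreover have "aff_dim e = aff_dim e'" using aff_dim_faces e by simp
  ultimately show ?thesis using face_of_aff_dim_lt by fastforce
qed

end

text \<open>Let \<open>E\<close> span a hyperplane. A convex set that contains \<open>E\<close> and a point strictly on one side of the
  hyperplane contains a half ball on that side around each relative interior point of \<open>E\<close>.\<close>

lemma half_ball:
  fixes K :: "'a::euclidean_space set"
  assumes K: "convex K" and EK: "E \<subseteq> K" and x: "x \<in> rel_interior E"
    and aff: "affine hull E = {y. n \<bullet> y = n \<bullet> x}"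
    and a: "a \<in> K" "n \<bullet> a < n \<bullet> x"
  obtains \<epsilon> where "\<epsilon> > 0" "\<And>y. dist x y < \<epsilon> \<Longrightarrow> n \<bullet> y \<le> n \<bullet> x \<Longrightarrow> y \<in> K"
proof -
  obtain r where r: "r > 0" "ball x r \<inter> affine hull E \<subseteq> E"
    using x by (auto simp: mem_rel_interior_ball)
  define t where "t = n \<bullet> x - n \<bullet> a"
  have t: "t > 0" using a by (simp add: t_def)
  \<comment> \<open>Every \<open>y\<close> is the convex combination of \<open>a\<close> and \<open>z y\<close> with weight \<open>s y\<close>, where \<open>z y\<close> lies in the
    hyperplane and tends to \<open>x\<close> as \<open>y\<close> does.\<close>
  define s where "s y = (n \<bullet> x - n \<bullet> y) / t" for y
  define z where "z y = x + ((y - x) - s y *\<^sub>R (a - x)) /\<^sub>R (1 - s y)" for y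
  have "continuous (at x) s" unfolding s_def using t by (intro continuous_intros) auto
  moreover have "s x = 0" by (simp add: s_def)
  ultimately have sl: "(s \<longlongrightarrow> 0) (at x)" by (simp add: isCont_def)
  have "(z \<longlongrightarrow> x + ((x - x) - 0 *\<^sub>R (a - x)) /\<^sub>R (1 - 0)) (at x)"
    unfolding z_def by (intro tendsto_intros sl) auto
  then have zl: "(z \<longlongrightarrow> x) (at x)" by simp
  have "\<forall>\<^sub>F y in at x. dist (s y) 0 < 1 \<and> dist (z y) x < r"
    using tendstoD[OF sl, of 1] tendstoD[OF zl r(1)] eventually_conj by fastforce
  then obtain \<epsilon> where \<epsilon>: "\<epsilon> > 0"
    "\<And>y. y \<noteq> x \<Longrightarrow> dist y x < \<epsilon> \<Longrightarrow> dist (s y) 0 < 1 \<and> dist (z y) x < r"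
    unfolding eventually_at by auto
  show ?thesis
  proof (rule that[OF \<epsilon>(1)])
    fix y assume y: "dist x y < \<epsilon>" "n \<bullet> y \<le> n \<bullet> x"
    show "y \<in> K"
    proof (cases "y = x")
      case True
      then show ?thesis using EK x rel_interior_subset by blast
    next
      case False
      then have s1: "\<bar>s y\<bar> < 1" and zr: "dist (z y) x < r" using \<epsilon>(2)[of y] y by (auto simp: dist_commute)
      have s0: "s y \<ge> 0" using y t by (simp add: s_def)
      have "n \<bullet> ((y - x) - s y *\<^sub>R (a - x)) = 0"
        using t by (simp add: inner_diff_right s_def t_def divide_simps) (simp add: algebra_simps)
      then have "n \<bullet> z y = n \<bullet> x" by (simp add: z_def inner_add_right)
      then have "z y \<in> E" using r(2) aff zr by (auto simp: dist_commute)
      then have "z y \<in> K" using EK by auto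
      then have "(1 - s y) *\<^sub>R z y + s y *\<^sub>R a \<in> K"
        using K a s0 s1 by (intro convexD) auto
      also have "(1 - s y) *\<^sub>R z y + s y *\<^sub>R a = y"
        using s1 by (simp add: z_def scaleR_add_right) (simp add: algebra_simps)
      finally show ?thesis .
    qed
  qed
qed

context conforming_partition
begin

text \<open>Two blocks sharing a face lie on opposite sides of it (a hyperplane separating their
  interiors has to contain the face), so relative interior points of the face are interior to
  their union.\<close>

lemma rel_interior_subset_interior_Un:
  assumes K: "K \<in> T" "K' \<in> T" "K \<noteq> K'" and E: "E facet_of K" "E facet_of K'"
    and x: "x \<in> rel_interior E"
  shows "x \<in> interior (K \<union> K')"
proof -
  have disj: "interior K \<inter> interior K' = {}"
    using block_unique[OF K(1,2)] K(3) interior_subset[of K'] by blast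
  obtain a b where ab: "a \<noteq> 0" "\<forall>x\<in>interior K. a \<bullet> x \<le> b" "\<forall>x\<in>interior K'. a \<bullet> x \<ge> b"
    using separating_hyperplane_sets[OF _ _ interior_T[OF K(1)] interior_T[OF K(2)] disj]
      convex_T convex_interior K by blast
  have "closure (interior K) \<subseteq> {x. a \<bullet> x \<le> b}"
    by (rule closure_minimal) (use ab closed_halfspace_le in auto)
  then have 1: "K \<subseteq> {x. a \<bullet> x \<le> b}" using closure_interior_T K by auto
  have "closure (interior K') \<subseteq> {x. a \<bullet> x \<ge> b}"
    by (rule closure_minimal) (use ab closed_halfspace_ge in auto)
  then have 2: "K' \<subseteq> {x. a \<bullet> x \<ge> b}" using closure_interior_T K by auto
  have EE: "E \<subseteq> K" "E \<subseteq> K'" using E facet_of_imp_subset by auto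
  have xE: "x \<in> E" using x rel_interior_subset by blast
  have axb: "a \<bullet> y = b" if "y \<in> E" for y using 1 2 EE that by force
  define n where "n = a /\<^sub>R norm a"
  have n: "unit_normal E n" using ab axb by (auto simp: unit_normal_def n_def inner_diff_right)
  have aff: "affine hull E = {y. n \<bullet> y = n \<bullet> x}"
    using affine_hull_unit_normal[OF n _ xE] aff_dim_facet E K interior_T by blast
  have aff': "affine hull E = {y. (-n) \<bullet> y = (-n) \<bullet> x}" using aff by simp
  have nb: "n \<bullet> y = (a \<bullet> y) / norm a" for y by (simp add: n_def divide_inverse mult.commute)
  have ex: "\<exists>c\<in>J. a \<bullet> c \<noteq> b" if "J \<in> T" for J
  proof (rule ccontr)
    assume "\<not> ?thesis"
    then have "J \<subseteq> {x. a \<bullet> x = b}" by auto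
    then have "interior J \<subseteq> interior {x. a \<bullet> x = b}" by (rule interior_mono)
    then show False using interior_T[OF that] ab(1) by simp
  qed
  obtain c where c: "c \<in> K" "a \<bullet> c < b" using ex[OF K(1)] 1 by force
  obtain c' where c': "c' \<in> K'" "a \<bullet> c' > b" using ex[OF K(2)] 2 by force
  have na: "norm a > 0" using ab by simp
  have nc: "n \<bullet> c < n \<bullet> x" using c axb[OF xE] na by (simp add: nb divide_strict_right_mono)
  have nc': "(-n) \<bullet> c' < (-n) \<bullet> x" using c' axb[OF xE] na by (simp add: nb divide_strict_right_mono)
  obtain \<epsilon> where e: "\<epsilon> > 0" "\<And>y. dist x y < \<epsilon> \<Longrightarrow> n \<bullet> y \<le> n \<bullet> x \<Longrightarrow> y \<in> K"
    using half_ball[OF convex_T[OF K(1)] EE(1) x aff c(1) nc] by metis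
  obtain \<epsilon>' where e': "\<epsilon>' > 0" "\<And>y. dist x y < \<epsilon>' \<Longrightarrow> (-n) \<bullet> y \<le> (-n) \<bullet> x \<Longrightarrow> y \<in> K'"
    using half_ball[OF convex_T[OF K(2)] EE(2) x aff' c'(1) nc'] by metis
  have "ball x (min \<epsilon> \<epsilon>') \<subseteq> K \<union> K'"
  proof
    fix y assume "y \<in> ball x (min \<epsilon> \<epsilon>')"
    then show "y \<in> K \<union> K'" using e(2)[of y] e'(2)[of y] by (cases "n \<bullet> y \<le> n \<bullet> x") auto
  qed
  then show ?thesis using e(1) e'(1) by (intro interiorI[of "ball x (min \<epsilon> \<epsilon>')"]) auto
qed

lemma mesh_size_nonneg:
  assumes "T \<noteq> {}" shows "0 \<le> mesh_size T"
proof -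
  have "mesh_size T \<in> diameter ` T"
    unfolding mesh_size_def using finite_T assms by (intro Max_in) auto
  then obtain K where "K \<in> T" "mesh_size T = diameter K" by auto
  then show ?thesis using diameter_ge_0[OF bounded_T] by simp
qed

lemma negligible_closure_minus_interiors: "negligible (closure D - (\<Union>K\<in>T. interior K))"
proof (rule negligible_subset)
  show "negligible (\<Union>K\<in>T. frontier K)"
    using finite_T convex_T negligible_convex_frontier by (intro negligible_Union) auto
  show "closure D - (\<Union>K\<in>T. interior K) \<subseteq> (\<Union>K\<in>T. frontier K)"
    unfolding Union_T[symmetric] using closed_T by (fastforce simp: frontier_def)
qed

end

section \<open>Piecewise continuous integrands\<close>

text \<open>No measurability is required, because Lebesgue measure is complete.\<close>

lemma set_integral_negligible_cong:
  fixes f g :: "'a::euclidean_space \<Rightarrow> real"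
  assumes N: "negligible N"
    and eq: "\<And>x. x \<notin> N \<Longrightarrow> indicator A x *\<^sub>R f x = indicator B x *\<^sub>R g x"
  shows "set_integrable lebesgue A f \<longleftrightarrow> set_integrable lebesgue B g"
    and "(LINT x:A|lebesgue. f x) = (LINT x:B|lebesgue. g x)"
proof -
  define F where "F x = indicator A x *\<^sub>R f x" for x
  define G where "G x = indicator B x *\<^sub>R g x" for x
  have FG: "F x = G x" if "x \<notin> N" for x using eq that by (simp add: F_def G_def)
  have iF: "integrable lebesgue F \<longleftrightarrow> F absolutely_integrable_on UNIV"
    and iG: "integrable lebesgue G \<longleftrightarrow> G absolutely_integrable_on UNIV"
    by (simp_all add: set_integrable_def)
  have iff: "integrable lebesgue F \<longleftrightarrow> integrable lebesgue G"
    unfolding iF iG using absolutely_integrable_spike_eq[OF N, of UNIV G F] FG by auto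
  then show "set_integrable lebesgue A f \<longleftrightarrow> set_integrable lebesgue B g"
    by (simp add: set_integrable_def F_def[abs_def] G_def[abs_def])
  have "integral\<^sup>L lebesgue F = integral\<^sup>L lebesgue G"
  proof (cases "integrable lebesgue F")
    case True
    then have "integral\<^sup>L lebesgue F = integral UNIV F" "integral\<^sup>L lebesgue G = integral UNIV G"
      using iff iF iG set_lebesgue_integral_eq_integral(2)[of UNIV F]
        set_lebesgue_integral_eq_integral(2)[of UNIV G] by (simp_all add: set_lebesgue_integral_def)
    moreover have "integral UNIV F = integral UNIV G"
      by (rule integral_spike[OF N]) (use FG in auto)
    ultimately show ?thesis by simp
  next
    case False
    then show ?thesis using iff by (simp add: not_integrable_integral_eq)
  qed
  then show "(LINT x:A|lebesgue. f x) = (LINT x:B|lebesgue. g x)"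
    by (simp add: set_lebesgue_integral_def F_def[abs_def] G_def[abs_def])
qed

lemma set_lebesgue_integral_nonneg:
  fixes f :: "'a \<Rightarrow> real"
  assumes "\<And>x. x \<in> A \<Longrightarrow> 0 \<le> f x"
  shows "0 \<le> (LINT x:A|M. f x)"
  unfolding set_lebesgue_integral_def
  using assms by (intro Bochner_Integration.integral_nonneg) (auto simp: indicator_def)

text \<open>The discriminant of a nonnegative quadratic polynomial is nonpositive.\<close>

lemma discriminant_nonneg_quadratic:
  fixes a b c :: real
  assumes "\<And>t. 0 \<le> a + 2 * t * b + t\<^sup>2 * c" "0 \<le> c"
  shows "b\<^sup>2 \<le> a * c"
proof (cases "c = 0")
  case True
  have "b = 0"
  proof (rule ccontr)
    assume "b \<noteq> 0"
    then show False using assms(1)[of "- (a + 1) / (2 * b)"] True by (simp add: field_simps)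
  qed
  then show ?thesis using True by simp
next
  case False
  then have "c > 0" using assms by simp
  have "0 \<le> a + 2 * (- b / c) * b + (- b / c)\<^sup>2 * c" by (rule assms)
  also have "\<dots> = a - b\<^sup>2 / c" using False by (simp add: power2_eq_square field_simps)
  finally show ?thesis using \<open>c > 0\<close> by (simp add: field_simps)
qed

text \<open>On the interior of each cell the function agrees with a globally continuous one. Thus it is
  bounded on the cell interiors; its values elsewhere do not matter.\<close>

definition pw_continuous :: "('a::euclidean_space) gms \<Rightarrow> ('a \<Rightarrow> 'b::topological_space) \<Rightarrow> bool" where
  "pw_continuous S f \<longleftrightarrow>
     (\<forall>\<tau>\<in>fine_grid S. \<exists>P. continuous_on UNIV P \<and> (\<forall>x\<in>interior \<tau>. f x = P x))"

lemma pw_continuous_const [simp]: "pw_continuous S (\<lambda>_. c)"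
  unfolding pw_continuous_def using continuous_on_const by blast

lemma pw_continuous_compose2:
  assumes f: "pw_continuous S f" and g: "pw_continuous S g"
    and h: "continuous_on UNIV (\<lambda>z. h (fst z) (snd z))"
  shows "pw_continuous S (\<lambda>x. h (f x) (g x))"
  unfolding pw_continuous_def
proof
  fix \<tau> assume t: "\<tau> \<in> fine_grid S"
  obtain P where P: "continuous_on UNIV P" "\<forall>x\<in>interior \<tau>. f x = P x"
    using f t by (auto simp: pw_continuous_def)
  obtain Q where Q: "continuous_on UNIV Q" "\<forall>x\<in>interior \<tau>. g x = Q x"
    using g t by (auto simp: pw_continuous_def)
  have "continuous_on UNIV (\<lambda>x. h (fst (P x, Q x)) (snd (P x, Q x)))"
    by (rule continuous_on_compose2[OF h]) (auto intro: continuous_on_Pair P Q)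
  then show "\<exists>R. continuous_on UNIV R \<and> (\<forall>x\<in>interior \<tau>. h (f x) (g x) = R x)"
    using P Q by (intro exI[of _ "\<lambda>x. h (P x) (Q x)"]) auto
qed

lemma pw_continuous_add:
  fixes f g :: "'a::euclidean_space \<Rightarrow> 'b::real_normed_vector"
  shows "pw_continuous S f \<Longrightarrow> pw_continuous S g \<Longrightarrow> pw_continuous S (\<lambda>x. f x + g x)"
  by (rule pw_continuous_compose2[where h="(+)"]) (assumption | intro continuous_intros)+

lemma pw_continuous_diff:
  fixes f g :: "'a::euclidean_space \<Rightarrow> 'b::real_normed_vector"
  shows "pw_continuous S f \<Longrightarrow> pw_continuous S g \<Longrightarrow> pw_continuous S (\<lambda>x. f x - g x)"
  by (rule pw_continuous_compose2[where h="(-)"]) (assumption | intro continuous_intros)+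

lemma pw_continuous_mult:
  fixes f g :: "'a::euclidean_space \<Rightarrow> real"
  shows "pw_continuous S f \<Longrightarrow> pw_continuous S g \<Longrightarrow> pw_continuous S (\<lambda>x. f x * g x)"
  by (rule pw_continuous_compose2[where h="(*)"]) (assumption | intro continuous_intros)+

lemma pw_continuous_scaleR:
  fixes g :: "'a::euclidean_space \<Rightarrow> 'b::real_normed_vector"
  shows "pw_continuous S g \<Longrightarrow> pw_continuous S (\<lambda>x. c *\<^sub>R g x)"
  by (rule pw_continuous_compose2[where h="\<lambda>x y. c *\<^sub>R y" and f=g]) (assumption | intro continuous_intros)+

lemma pw_continuous_inner:
  fixes f g :: "'a::euclidean_space \<Rightarrow> 'b::real_inner"
  shows "pw_continuous S f \<Longrightarrow> pw_continuous S g \<Longrightarrow> pw_continuous S (\<lambda>x. f x \<bullet> g x)"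
  by (rule pw_continuous_compose2[where h="(\<bullet>)"]) (assumption | intro continuous_intros)+

lemma pw_continuous_power2:
  fixes f :: "'a::euclidean_space \<Rightarrow> real"
  shows "pw_continuous S f \<Longrightarrow> pw_continuous S (\<lambda>x. (f x)\<^sup>2)"
  unfolding power2_eq_square by (rule pw_continuous_mult)

lemmas pw_continuous_intros = pw_continuous_const pw_continuous_add pw_continuous_diff
  pw_continuous_mult pw_continuous_scaleR pw_continuous_inner pw_continuous_power2

lemma wform_commute: "wform S A v w = wform S A w v"
  by (simp add: wform_def inner_commute)

text \<open>The setting of the multiscale method; it provides both grids as conforming partitions.\<close>

locale gms_method =
  fixes S :: "('a::euclidean_space) gms"
  assumes setting: "gms_setting S"
begin

lemma flow: "flow_problem S" and grids: "grids S"
  using setting by (auto simp: gms_setting_def)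

sublocale coarse: conforming_partition "flow_dom S" "coarse_grid S"
  using grids by unfold_locales (simp add: grids_def)

sublocale fine: conforming_partition "flow_dom S" "fine_grid S"
  using grids by unfold_locales (simp add: grids_def)

lemma open_cells: "open (cells S)"
  by (auto simp: cells_def)

lemma cells_subset_flow_dom: "cells S \<subseteq> flow_dom S"
proof -
  have "flow_dom S = interior (closure (flow_dom S))"
    using flow by (simp add: flow_problem_def)
  then show ?thesis
    unfolding cells_def using fine.subset_closure interior_mono by blast
qed

lemma negligible_closure_minus_cells: "negligible (closure (flow_dom S) - cells S)"
  using fine.negligible_closure_minus_interiors by (simp add: cells_def)

lemma cells_Int_block: 
  assumes "x \<in> cells S" "K \<in> coarse_grid S" "x \<in> K"
  shows "x \<in> interior K"
proof -
  obtain \<tau> where t: "\<tau> \<in> fine_grid S" "x \<in> interior \<tau>" using assms by (auto simp: cells_def)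
  obtain K' where K': "K' \<in> coarse_grid S" "\<tau> \<subseteq> K'" using grids t by (auto simp: grids_def)
  then have "x \<in> interior K'" using t interior_mono by blast
  then show ?thesis using coarse.block_unique[of K' K x] assms K' by simp
qed

text \<open>The sets over which integrals are taken below.\<close>

definition region :: "'a set \<Rightarrow> bool" where
  "region A \<longleftrightarrow> A \<in> sets lebesgue \<and> A \<subseteq> closure (flow_dom S)"

lemma region_flow_dom: "region (flow_dom S)"
  using flow closure_subset by (auto simp: region_def flow_problem_def intro!: lborelD)

lemma region_block: "K \<in> coarse_grid S \<Longrightarrow> region K"
  using coarse.compact_T coarse.subset_closure by (auto simp: region_def intro!: lborelD borel_compact)

lemma closed_nbhd: "closed (nbhd S E)"
  unfolding nbhd_def using coarse.finite_T coarse.closed_T by (intro closed_Union) (auto simp: blocks_def)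

lemma nbhd_subset: "nbhd S E \<subseteq> closure (flow_dom S)"
  using coarse.subset_closure by (auto simp: nbhd_def blocks_def)

lemma region_nbhd: "region (nbhd S E)"
  using nbhd_subset closed_nbhd by (auto simp: region_def intro!: lborelD borel_closed)

lemma perm_pos: "x \<in> closure (flow_dom S) \<Longrightarrow> 0 < perm S x"
  using flow by (auto simp: flow_problem_def)

lemma
  assumes A: "region A" "region B"
    and eq: "\<And>x. x \<in> cells S \<Longrightarrow> x \<in> A \<Longrightarrow> x \<in> B \<Longrightarrow> f x = g x"
    and "\<And>x. x \<in> cells S \<Longrightarrow> x \<in> A \<Longrightarrow> x \<notin> B \<Longrightarrow> f x = 0"
    and "\<And>x. x \<in> cells S \<Longrightarrow> x \<in> B \<Longrightarrow> x \<notin> A \<Longrightarrow> g x = 0"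
  shows set_integrable_cells_cong: "set_integrable lebesgue A f \<longleftrightarrow> set_integrable lebesgue B (g::'a \<Rightarrow> real)"
    and set_integral_cells_cong: "(LINT x:A|lebesgue. f x) = (LINT x:B|lebesgue. g x)"
proof -
  have *: "indicator A x *\<^sub>R f x = indicator B x *\<^sub>R g x"
    if "x \<notin> closure (flow_dom S) - cells S" for x
    using that assms by (cases "x \<in> A"; cases "x \<in> B") (auto simp: region_def)
  show "set_integrable lebesgue A f \<longleftrightarrow> set_integrable lebesgue B g"
    and "(LINT x:A|lebesgue. f x) = (LINT x:B|lebesgue. g x)"
    using set_integral_negligible_cong[OF negligible_closure_minus_cells *] by blast+
qed

lemma pw_continuous_on_cells:
  assumes "pw_continuous S f"
  shows "continuous_on (cells S) f"
  unfolding cells_def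
proof (rule continuous_on_open_UN)
  fix \<tau> assume "\<tau> \<in> fine_grid S"
  then obtain P where P: "continuous_on UNIV P" "\<forall>x\<in>interior \<tau>. f x = P x"
    using assms by (auto simp: pw_continuous_def)
  then have "continuous_on (interior \<tau>) P" using continuous_on_subset by blast
  then show "continuous_on (interior \<tau>) f" using P continuous_on_eq by metis
qed auto

lemma pw_continuous_bounded:
  fixes f :: "'a \<Rightarrow> 'b::metric_space"
  assumes "pw_continuous S f"
  shows "bounded (f ` cells S)"
  unfolding cells_def image_UN
proof (rule bounded_UN[OF fine.finite_T], safe)
  fix \<tau> assume t: "\<tau> \<in> fine_grid S"
  then obtain P where P: "continuous_on UNIV P" "\<forall>x\<in>interior \<tau>. f x = P x"
    using assms by (auto simp: pw_continuous_def)
  have "compact (P ` \<tau>)"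
    using P fine.compact_T[OF t] by (intro compact_continuous_image) (auto intro: continuous_on_subset)
  moreover have "f ` interior \<tau> \<subseteq> P ` \<tau>" using P interior_subset[of \<tau>] by auto
  ultimately show "bounded (f ` interior \<tau>)" using compact_imp_bounded bounded_subset by blast
qed

lemma set_integrable_product:
  fixes f g :: "'a \<Rightarrow> real"
  assumes A: "region A" and g: "set_integrable lebesgue (flow_dom S) g" and f: "pw_continuous S f"
  shows "set_integrable lebesgue A (\<lambda>x. g x * f x)"
proof -
  have C: "cells S \<in> sets lebesgue" using open_cells by (auto intro!: lborelD)
  have gC: "set_integrable lebesgue (cells S) g"
    by (rule set_integrable_subset[OF g C cells_subset_flow_dom])
  have "set_integrable lebesgue (cells S) (\<lambda>x. f x * g x)"
    by (rule absolutely_integrable_bounded_measurable_product[OF bilinear_times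
          continuous_imp_measurable_on_sets_lebesgue[OF pw_continuous_on_cells[OF f] C] C
          pw_continuous_bounded[OF f] gC])
  then have "set_integrable lebesgue (A \<inter> cells S) (\<lambda>x. f x * g x)"
    by (rule set_integrable_subset) (use A C in \<open>auto simp: region_def\<close>)
  moreover have "region (A \<inter> cells S)" using A C by (auto simp: region_def)
  ultimately show ?thesis
    using set_integrable_cells_cong[of A "A \<inter> cells S" "\<lambda>x. g x * f x" "\<lambda>x. f x * g x"] A by simp
qed

lemma set_integrable_one_flow_dom: "set_integrable lebesgue (flow_dom S) (\<lambda>_. 1::real)"
proof -
  have "bounded (closure (flow_dom S))"
    using fine.Union_T fine.finite_T fine.bounded_T bounded_Union by metis
  then have "flow_dom S \<in> lmeasurable"
    using flow bounded_subset[OF _ closure_subset]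
    by (intro bounded_set_imp_lmeasurable) (auto simp: flow_problem_def intro!: lborelD)
  then show ?thesis by (simp add: absolutely_integrable_on_const)
qed

lemma set_integrable_pw_continuous:
  fixes f :: "'a \<Rightarrow> real"
  assumes "region A" "pw_continuous S f"
  shows "set_integrable lebesgue A f"
  using set_integrable_product[OF assms(1) set_integrable_one_flow_dom assms(2)] by simp

lemma set_integrable_weighted:
  fixes f :: "'a \<Rightarrow> real"
  assumes "region A" "pw_continuous S f"
  shows "set_integrable lebesgue A (\<lambda>x. inverse (perm S x) * f x)"
  using set_integrable_product[OF assms(1) _ assms(2)] flow by (auto simp: flow_problem_def)

text \<open>A piecewise continuous function whose square has integral zero over a block vanishes at
  every point of the block in the interior of a cell.\<close>

lemma integral_square_zero_imp:
  fixes f :: "'a \<Rightarrow> real"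
  assumes f: "pw_continuous S f" and K: "K \<in> coarse_grid S"
    and zero: "(LINT x:K|lebesgue. (f x)\<^sup>2) = 0" and x: "x \<in> K" "x \<in> cells S"
  shows "f x = 0"
proof -
  \<comment> \<open>An open null set, hence empty.\<close>
  define U where "U = {x \<in> interior K \<inter> cells S. f x \<noteq> 0}"
  have "set_integrable lebesgue K (\<lambda>x. (f x)\<^sup>2)"
    using region_block[OF K] f by (intro set_integrable_pw_continuous pw_continuous_intros)
  then have "AE x in lebesgue. indicator K x *\<^sub>R (f x)\<^sup>2 = 0"
    using zero integral_nonneg_eq_0_iff_AE[of lebesgue "\<lambda>x. indicator K x *\<^sub>R (f x)\<^sup>2"]
    by (simp add: set_integrable_def set_lebesgue_integral_def)
  then obtain N where N: "N \<in> null_sets lebesgue" "{x. indicator K x *\<^sub>R (f x)\<^sup>2 \<noteq> 0} \<subseteq> N"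
    unfolding eventually_ae_filter by auto
  have "U \<subseteq> N" using N(2) interior_subset[of K] by (force simp: U_def)
  then have neg: "negligible U" using N(1) negligible_iff_null_sets negligible_subset by blast
  have "continuous_on (interior K \<inter> cells S) f"
    using pw_continuous_on_cells[OF f] continuous_on_subset by blast
  then have "open (interior K \<inter> cells S \<inter> f -` (- {0}))"
    using open_cells by (intro continuous_open_preimage) auto
  also have "interior K \<inter> cells S \<inter> f -` (- {0}) = U" by (auto simp: U_def)
  finally have "U = {}" using neg open_not_negligible by blast
  then show ?thesis using cells_Int_block[OF x(2) K x(1)] x by (auto simp: U_def)
qed

lemma wform_add_left:
  assumes "region A" "pw_continuous S u" "pw_continuous S v" "pw_continuous S w"
  shows "wform S A (\<lambda>x. u x + v x) w = wform S A u w + wform S A v w"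
proof -
  note i = set_integrable_weighted[OF assms(1) pw_continuous_inner]
  show ?thesis
    using set_integral_add(2)[OF i[OF assms(2,4)] i[OF assms(3,4)]]
    by (simp add: wform_def inner_add_left distrib_left)
qed

lemma wform_diff_left:
  assumes "region A" "pw_continuous S u" "pw_continuous S v" "pw_continuous S w"
  shows "wform S A (\<lambda>x. u x - v x) w = wform S A u w - wform S A v w"
proof -
  note i = set_integrable_weighted[OF assms(1) pw_continuous_inner]
  show ?thesis
    using set_integral_diff(2)[OF i[OF assms(2,4)] i[OF assms(3,4)]]
    by (simp add: wform_def inner_diff_left right_diff_distrib)
qed

lemma wform_scaleR_left: "wform S A (\<lambda>x. c *\<^sub>R u x) w = c * wform S A u w"
proof -
  have "inverse (perm S x) * (c *\<^sub>R u x \<bullet> w x) = c * (inverse (perm S x) * (u x \<bullet> w x))" for x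
    by (simp add: mult.left_commute)
  then show ?thesis
    unfolding wform_def by (simp only: set_integral_mult_right)
qed

lemma wform_nonneg: "region A \<Longrightarrow> 0 \<le> wform S A v v"
  unfolding wform_def using perm_pos
  by (intro set_lebesgue_integral_nonneg) (force simp: region_def intro!: mult_nonneg_nonneg)

lemma wnorm_eq: "wnorm S A v = sqrt (wform S A v v)"
  by (simp add: wnorm_def wform_def power2_norm_eq_inner)

lemma wnorm_power2: "region A \<Longrightarrow> (wnorm S A v)\<^sup>2 = wform S A v v"
  using wform_nonneg by (simp add: wnorm_eq)

lemma wnorm_nonneg: "region A \<Longrightarrow> 0 \<le> wnorm S A v"
  using wform_nonneg by (simp add: wnorm_eq)

lemma wform_Cauchy_Schwarz:
  assumes A: "region A" and u: "pw_continuous S u" and v: "pw_continuous S v"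
  shows "\<bar>wform S A u v\<bar> \<le> wnorm S A u * wnorm S A v"
proof -
  have "0 \<le> wform S A u u + 2 * t * wform S A u v + t\<^sup>2 * wform S A v v" for t
  proof -
    have tv: "pw_continuous S (\<lambda>x. t *\<^sub>R v x)" by (intro pw_continuous_intros v)
    have s: "pw_continuous S (\<lambda>x. u x + t *\<^sub>R v x)" by (intro pw_continuous_intros u v)
    have "0 \<le> wform S A (\<lambda>x. u x + t *\<^sub>R v x) (\<lambda>x. u x + t *\<^sub>R v x)"
      by (rule wform_nonneg[OF A])
    also have "\<dots> = wform S A u (\<lambda>x. u x + t *\<^sub>R v x) + t * wform S A v (\<lambda>x. u x + t *\<^sub>R v x)"
      using wform_add_left[OF A u tv s] by (simp add: wform_scaleR_left)
    also have "\<dots> = wform S A u u + 2 * t * wform S A u v + t\<^sup>2 * wform S A v v"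
      using wform_add_left[OF A u tv u] wform_add_left[OF A u tv v]
      by (simp add: wform_commute[of S A _ "\<lambda>x. u x + t *\<^sub>R v x"] wform_scaleR_left
          wform_commute[of S A v u] power2_eq_square algebra_simps)
    finally show ?thesis .
  qed
  then have "(wform S A u v)\<^sup>2 \<le> wform S A u u * wform S A v v"
    using wform_nonneg[OF A] by (rule discriminant_nonneg_quadratic)
  then show ?thesis
    unfolding wnorm_eq real_sqrt_mult[symmetric] by (metis real_sqrt_abs real_sqrt_le_iff)
qed

end

section \<open>Discrete velocity fields\<close>

lemma islimpt_open:
  fixes U :: "'a::perfect_space set"
  assumes "open U" "x \<in> closure U"
  shows "x islimpt U"
proof (cases "x \<in> U")
  case True
  then show ?thesis using assms interior_limit_point interior_open by metis
next
  case False
  then show ?thesis using assms by (auto simp: closure_def)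
qed

lemma lin_span_zero: "(\<lambda>_. 0) \<in> lin_span I b"
  unfolding lin_span_def by (intro CollectI exI[of _ "\<lambda>_. 0"]) simp

lemma lin_span_add: "f \<in> lin_span I b \<Longrightarrow> g \<in> lin_span I b \<Longrightarrow> (\<lambda>x. f x + g x) \<in> lin_span I b"
  unfolding lin_span_def
proof clarify
  fix c d
  show "\<exists>e. (\<lambda>x. (\<Sum>i\<in>I. c i *\<^sub>R b i x) + (\<Sum>i\<in>I. d i *\<^sub>R b i x)) = (\<lambda>x. \<Sum>i\<in>I. e i *\<^sub>R b i x)"
    by (intro exI[of _ "\<lambda>i. c i + d i"]) (simp add: scaleR_add_left sum.distrib)
qed

lemma lin_span_scaleR: "f \<in> lin_span I b \<Longrightarrow> (\<lambda>x. r *\<^sub>R f x) \<in> lin_span I b"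
  unfolding lin_span_def
proof clarify
  fix c
  show "\<exists>e. (\<lambda>x. r *\<^sub>R (\<Sum>i\<in>I. c i *\<^sub>R b i x)) = (\<lambda>x. \<Sum>i\<in>I. e i *\<^sub>R b i x)"
    by (intro exI[of _ "\<lambda>i. r * c i"]) (simp add: scaleR_sum_right)
qed

lemma lin_span_diff: "f \<in> lin_span I b \<Longrightarrow> g \<in> lin_span I b \<Longrightarrow> (\<lambda>x. f x - g x) \<in> lin_span I b"
  using lin_span_add[OF _ lin_span_scaleR, of f I b g "- 1"] by simp

lemma lin_span_base:
  assumes "finite I" "j \<in> I" shows "b j \<in> lin_span I b"
proof -
  have "(\<Sum>i\<in>I. (if i = j then 1 else 0) *\<^sub>R b i x) = b j x" for x
  proof -
    have "(\<Sum>i\<in>I. (if i = j then 1 else 0) *\<^sub>R b i x) = (\<Sum>i\<in>I. if i = j then b i x else 0)"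
      by (intro sum.cong) auto
    then show ?thesis using assms by simp
  qed
  then show ?thesis
    unfolding lin_span_def by (intro CollectI exI[of _ "\<lambda>i. if i = j then 1 else 0"]) simp
qed

lemma lin_span_mono:
  assumes "I \<subseteq> J" "finite J" shows "lin_span I b \<subseteq> lin_span J b"
proof
  fix f assume "f \<in> lin_span I b"
  then obtain c where f: "f = (\<lambda>x. \<Sum>i\<in>I. c i *\<^sub>R b i x)" by (auto simp: lin_span_def)
  have "f x = (\<Sum>i\<in>J. (if i \<in> I then c i else 0) *\<^sub>R b i x)" for x
    unfolding f using assms by (intro sum.mono_neutral_cong_left) auto
  then show "f \<in> lin_span J b"
    unfolding lin_span_def by (intro CollectI exI[of _ "\<lambda>i. if i \<in> I then c i else 0"]) auto
qed

lemma poly_space_polynomial: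
  assumes "poly_space V" "P \<in> V"
  shows "polynomial_function P"
  using assms unfolding poly_space_def lin_span_def
  by (auto intro!: polynomial_function_sum polynomial_function_cmul)

lemma poly_space_zero: "poly_space V \<Longrightarrow> (\<lambda>_. 0) \<in> V"
  and poly_space_add: "poly_space V \<Longrightarrow> P \<in> V \<Longrightarrow> Q \<in> V \<Longrightarrow> (\<lambda>x. P x + Q x) \<in> V"
  and poly_space_diff: "poly_space V \<Longrightarrow> P \<in> V \<Longrightarrow> Q \<in> V \<Longrightarrow> (\<lambda>x. P x - Q x) \<in> V"
  and poly_space_scaleR: "poly_space V \<Longrightarrow> P \<in> V \<Longrightarrow> (\<lambda>x. r *\<^sub>R P x) \<in> V"
  by (auto simp: poly_space_def lin_span_zero lin_span_add lin_span_scaleR lin_span_diff)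

lemma divergence_add:
  assumes "v differentiable at x" "w differentiable at x"
  shows "divergence (\<lambda>x. v x + w x) x = divergence v x + divergence w x"
proof -
  have "frechet_derivative (\<lambda>x. v x + w x) (at x)
      = (\<lambda>h. frechet_derivative v (at x) h + frechet_derivative w (at x) h)"
    using assms unfolding frechet_derivative_works
    by (intro frechet_derivative_at[symmetric] has_derivative_add)
  then show ?thesis by (simp add: divergence_def inner_add_left sum.distrib)
qed

lemma divergence_scaleR:
  assumes "v differentiable at x"
  shows "divergence (\<lambda>x. c *\<^sub>R v x) x = c * divergence v x"
proof -
  have "frechet_derivative (\<lambda>x. c *\<^sub>R v x) (at x) = (\<lambda>h. c *\<^sub>R frechet_derivative v (at x) h)"
    using assms unfolding frechet_derivative_works
    by (intro frechet_derivative_at[symmetric] has_derivative_scaleR_right)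
  then show ?thesis by (simp add: divergence_def sum_distrib_left)
qed

lemma divergence_cong_open:
  assumes "w differentiable at x" "open U" "x \<in> U" "\<And>y. y \<in> U \<Longrightarrow> w y = v y"
  shows "divergence v x = divergence w x"
  unfolding divergence_def using frechet_derivative_transform_within_open[OF assms] by simp

context gms_method
begin

lemma mixed: "\<tau> \<in> fine_grid S \<Longrightarrow> mixed_element (vel_el S \<tau>) (pres_el S \<tau>)"
  using grids by (auto simp: grids_def)

lemma vel_el_poly: "\<tau> \<in> fine_grid S \<Longrightarrow> poly_space (vel_el S \<tau>)"
  and pres_el_poly: "\<tau> \<in> fine_grid S \<Longrightarrow> poly_space (pres_el S \<tau>)"
  and divergence_vel_el: "\<tau> \<in> fine_grid S \<Longrightarrow> P \<in> vel_el S \<tau> \<Longrightarrow> divergence P \<in> pres_el S \<tau>"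
  and const_pres_el: "\<tau> \<in> fine_grid S \<Longrightarrow> (\<lambda>_. c) \<in> pres_el S \<tau>"
  using mixed by (auto simp: mixed_element_def)

text \<open>In the interior of a cell the divergence of a discrete velocity is that of a polynomial field,
  and the divergences of such fields form the pressure space of the cell.\<close>

lemma vel_h_local:
  assumes "v \<in> vel_h S" "\<tau> \<in> fine_grid S"
  obtains P where "P \<in> vel_el S \<tau>" "polynomial_function P" "\<And>x. x \<in> interior \<tau> \<Longrightarrow> v x = P x"
    "\<And>x. x \<in> interior \<tau> \<Longrightarrow> v differentiable at x"
    "\<And>x. x \<in> interior \<tau> \<Longrightarrow> divergence v x = divergence P x"
proof -
  obtain P where P: "P \<in> vel_el S \<tau>" "\<forall>x\<in>interior \<tau>. v x = P x"
    using assms by (auto simp: vel_h_def)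
  have p: "polynomial_function P" using poly_space_polynomial vel_el_poly P assms by blast
  have d: "P differentiable at x" for x using differentiable_at_polynomial_function[OF p] .
  show ?thesis
  proof (rule that[OF P(1) p])
    fix x assume x: "x \<in> interior \<tau>"
    then show "v x = P x" using P by simp
    show "v differentiable at x"
      using d[of x] x P unfolding differentiable_def
      using has_derivative_transform_within_open[of P _ x UNIV "interior \<tau>" v] by auto
    show "divergence v x = divergence P x"
      using d x P by (intro divergence_cong_open[of P x "interior \<tau>"]) auto
  qed
qed

lemma differentiable_vel_h: "v \<in> vel_h S \<Longrightarrow> x \<in> cells S \<Longrightarrow> v differentiable at x"
  unfolding cells_def by (auto elim!: vel_h_local)

lemma pw_continuous_vel_h: 
  assumes "v \<in> vel_h S" shows "pw_continuous S v"
  unfolding pw_continuous_def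
proof
  fix \<tau> assume "\<tau> \<in> fine_grid S"
  with assms obtain P where "polynomial_function P" "\<And>x. x \<in> interior \<tau> \<Longrightarrow> v x = P x"
    by (metis vel_h_local)
  then show "\<exists>P. continuous_on UNIV P \<and> (\<forall>x\<in>interior \<tau>. v x = P x)"
    using continuous_on_polymonial_function by blast
qed

lemma pres_h_divergence:
  assumes "v \<in> vel_h S" shows "(\<lambda>x. divergence v x - a) \<in> pres_h S"
  unfolding pres_h_def
proof (intro CollectI ballI)
  fix \<tau> assume t: "\<tau> \<in> fine_grid S"
  obtain P where P: "P \<in> vel_el S \<tau>" "\<And>x. x \<in> interior \<tau> \<Longrightarrow> divergence v x = divergence P x"
    using vel_h_local[OF assms t] by metis
  have "(\<lambda>x. divergence P x - a) \<in> pres_el S \<tau>"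
    by (rule poly_space_diff[OF pres_el_poly[OF t] divergence_vel_el[OF t P(1)] const_pres_el[OF t]])
  then show "\<exists>Pa\<in>pres_el S \<tau>. \<forall>x\<in>interior \<tau>. divergence v x - a = Pa x"
    using P(2) by (intro bexI[of _ "\<lambda>x. divergence P x - a"]) auto
qed

lemma pw_continuous_pres_h:
  assumes "q \<in> pres_h S" shows "pw_continuous S q"
  unfolding pw_continuous_def
proof
  fix \<tau> assume t: "\<tau> \<in> fine_grid S"
  with assms obtain P where P: "P \<in> pres_el S \<tau>" "\<forall>x\<in>interior \<tau>. q x = P x"
    by (auto simp: pres_h_def)
  then have "polynomial_function P" using poly_space_polynomial pres_el_poly t by blast
  then show "\<exists>P. continuous_on UNIV P \<and> (\<forall>x\<in>interior \<tau>. q x = P x)"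
    using continuous_on_polymonial_function P by blast
qed

lemma pw_continuous_divergence: "v \<in> vel_h S \<Longrightarrow> pw_continuous S (divergence v)"
  using pw_continuous_pres_h[OF pres_h_divergence[of v 0]] by simp

lemma pw_continuous_pres_H:
  assumes "q \<in> pres_H S" shows "pw_continuous S q"
  unfolding pw_continuous_def
proof
  fix \<tau> assume t: "\<tau> \<in> fine_grid S"
  obtain K where K: "K \<in> coarse_grid S" "\<tau> \<subseteq> K" using grids t by (auto simp: grids_def)
  obtain c where "\<forall>x\<in>interior K. q x = c" using assms K unfolding pres_H_def by blast
  then have "\<forall>x\<in>interior \<tau>. q x = c" using interior_mono[OF K(2)] by blast
  then show "\<exists>P. continuous_on UNIV P \<and> (\<forall>x\<in>interior \<tau>. q x = P x)"
    by (intro exI[of _ "\<lambda>_. c"]) auto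
qed

lemma vel_h_zero: "(\<lambda>_. 0) \<in> vel_h S"
  unfolding vel_h_def using poly_space_zero vel_el_poly by (fastforce intro: tendsto_const)

lemma vel_h_add:
  assumes "v \<in> vel_h S" "w \<in> vel_h S" shows "(\<lambda>x. v x + w x) \<in> vel_h S"
  unfolding vel_h_def
proof (intro CollectI conjI ballI allI impI)
  fix \<tau> assume t: "\<tau> \<in> fine_grid S"
  obtain P Q where "P \<in> vel_el S \<tau>" "\<forall>x\<in>interior \<tau>. v x = P x"
    "Q \<in> vel_el S \<tau>" "\<forall>x\<in>interior \<tau>. w x = Q x"
    using assms t unfolding vel_h_def by blast
  then show "\<exists>P\<in>vel_el S \<tau>. \<forall>x\<in>interior \<tau>. v x + w x = P x"
    using poly_space_add[OF vel_el_poly[OF t]] by (intro bexI[of _ "\<lambda>x. P x + Q x"]) auto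
next
  fix x assume "x \<notin> cells S" then show "v x + w x = 0" using assms by (auto simp: vel_h_def)
next
  fix e x n assume "e \<in> faces (fine_grid S)" "x \<in> rel_interior e" "unit_normal e n"
  then obtain k l where "((\<lambda>y. v y \<bullet> n) \<longlongrightarrow> k) (at x within cells S)"
    "((\<lambda>y. w y \<bullet> n) \<longlongrightarrow> l) (at x within cells S)"
    using assms unfolding vel_h_def by blast
  then show "\<exists>l. ((\<lambda>y. (v y + w y) \<bullet> n) \<longlongrightarrow> l) (at x within cells S)"
    unfolding inner_add_left using tendsto_add by blast
qed

lemma vel_h_scaleR:
  assumes "v \<in> vel_h S" shows "(\<lambda>x. c *\<^sub>R v x) \<in> vel_h S"
  unfolding vel_h_def
proof (intro CollectI conjI ballI allI impI)
  fix \<tau> assume t: "\<tau> \<in> fine_grid S"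
  obtain P where "P \<in> vel_el S \<tau>" "\<forall>x\<in>interior \<tau>. v x = P x"
    using assms t unfolding vel_h_def by blast
  then show "\<exists>P\<in>vel_el S \<tau>. \<forall>x\<in>interior \<tau>. c *\<^sub>R v x = P x"
    using poly_space_scaleR[OF vel_el_poly[OF t]] by (intro bexI[of _ "\<lambda>x. c *\<^sub>R P x"]) auto
next
  fix x assume "x \<notin> cells S" then show "c *\<^sub>R v x = 0" using assms by (auto simp: vel_h_def)
next
  fix e x n assume "e \<in> faces (fine_grid S)" "x \<in> rel_interior e" "unit_normal e n"
  then obtain k where "((\<lambda>y. v y \<bullet> n) \<longlongrightarrow> k) (at x within cells S)"
    using assms unfolding vel_h_def by blast
  then show "\<exists>l. ((\<lambda>y. (c *\<^sub>R v y) \<bullet> n) \<longlongrightarrow> l) (at x within cells S)"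
    unfolding inner_scaleR_left using tendsto_mult_left by blast
qed

lemma vel_h_diff:
  assumes "v \<in> vel_h S" "w \<in> vel_h S" shows "(\<lambda>x. v x - w x) \<in> vel_h S"
  using vel_h_add[OF assms(1) vel_h_scaleR[OF assms(2), of "- 1"]] by simp

lemma vel_h_sum:
  assumes "\<And>i. i \<in> I \<Longrightarrow> v i \<in> vel_h S" shows "(\<lambda>x. \<Sum>i\<in>I. v i x) \<in> vel_h S"
  using assms by (induction I rule: infinite_finite_induct) (simp_all add: vel_h_zero vel_h_add)

lemma divergence_vel_h_diff:
  assumes "v \<in> vel_h S" "w \<in> vel_h S" "x \<in> cells S"
  shows "divergence (\<lambda>x. v x - w x) x = divergence v x - divergence w x"
  using divergence_add[OF differentiable_vel_h[OF assms(1,3)]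
      differentiable_vel_h[OF vel_h_scaleR[OF assms(2), of "- 1"] assms(3)]]
    divergence_scaleR[OF differentiable_vel_h[OF assms(2,3)], of "- 1"] by simp

lemma divergence_lin_comb:
  assumes "\<And>i. i \<in> I \<Longrightarrow> v i \<in> vel_h S" "x \<in> cells S"
  shows "divergence (\<lambda>x. \<Sum>i\<in>I. c i *\<^sub>R v i x) x = (\<Sum>i\<in>I. c i * divergence (v i) x)"
  using assms(1)
proof (induction I rule: infinite_finite_induct)
  case (insert i I)
  have "v i \<in> vel_h S" "(\<lambda>x. \<Sum>i\<in>I. c i *\<^sub>R v i x) \<in> vel_h S"
    using insert.prems by (auto intro!: vel_h_sum vel_h_scaleR)
  then show ?case
    using insert divergence_add[OF differentiable_vel_h[OF vel_h_scaleR] differentiable_vel_h]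
      divergence_scaleR[OF differentiable_vel_h] assms(2) by simp
qed (simp_all add: divergence_def)

lemma divergence_eq_0:
  assumes "closed A" "\<And>y. y \<notin> A \<Longrightarrow> v y = 0" "x \<notin> A"
  shows "divergence v x = 0"
proof -
  have "divergence v x = divergence (\<lambda>_. 0) x"
    by (rule divergence_cong_open[of _ _ "- A"]) (use assms in auto)
  then show ?thesis by (simp add: divergence_def)
qed

subsection \<open>Normal traces\<close>

lemma closure_cells: "closure (cells S) = closure (flow_dom S)"
proof
  show "closure (cells S) \<subseteq> closure (flow_dom S)"
    using cells_subset_flow_dom closure_mono by blast
  have "\<tau> \<subseteq> closure (cells S)" if "\<tau> \<in> fine_grid S" for \<tau>
  proof -
    have "closure (interior \<tau>) \<subseteq> closure (cells S)"
      using that by (intro closure_mono) (auto simp: cells_def)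
    then show ?thesis using fine.closure_interior_T that by simp
  qed
  then show "closure (flow_dom S) \<subseteq> closure (cells S)" using fine.Union_T by blast
qed

lemma islimpt_cells: "x \<in> closure (flow_dom S) \<Longrightarrow> x islimpt cells S"
  using islimpt_open[OF open_cells] closure_cells by simp

lemma ntrace_limit:
  assumes "v \<in> vel_h S" "e \<in> faces (fine_grid S)" "x \<in> rel_interior e" "unit_normal e n"
  shows "((\<lambda>y. v y \<bullet> n) \<longlongrightarrow> ntrace S v n x) (at x within cells S)"
proof -
  obtain l where l: "((\<lambda>y. v y \<bullet> n) \<longlongrightarrow> l) (at x within cells S)"
    using assms unfolding vel_h_def by blast
  have "x \<in> closure (flow_dom S)"
    using fine.face_subset_closure[OF assms(2)] assms(3) rel_interior_subset by blast
  then have "ntrace S v n x = l"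
    unfolding ntrace_def using l islimpt_cells by (intro tendsto_Lim) (simp_all add: trivial_limit_within)
  then show ?thesis using l by simp
qed

lemma ntrace_eqI:
  assumes "((\<lambda>y. v y \<bullet> n) \<longlongrightarrow> l) (at x within cells S)" "x \<in> closure (flow_dom S)"
  shows "ntrace S v n x = l"
  unfolding ntrace_def using assms islimpt_cells by (intro tendsto_Lim) (simp_all add: trivial_limit_within)

lemma fine_point_closure:
  "e \<in> faces (fine_grid S) \<Longrightarrow> x \<in> rel_interior e \<Longrightarrow> x \<in> closure (flow_dom S)"
  using fine.face_subset_closure rel_interior_subset by blast

lemma ntrace_lin_comb:
  assumes "\<And>i. i \<in> I \<Longrightarrow> v i \<in> vel_h S" 
    and e: "e \<in> faces (fine_grid S)" "x \<in> rel_interior e" "unit_normal e n"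
  shows "ntrace S (\<lambda>x. \<Sum>i\<in>I. c i *\<^sub>R v i x) n x = (\<Sum>i\<in>I. c i * ntrace S (v i) n x)"
proof (rule ntrace_eqI)
  show "((\<lambda>y. (\<Sum>i\<in>I. c i *\<^sub>R v i y) \<bullet> n) \<longlongrightarrow> (\<Sum>i\<in>I. c i * ntrace S (v i) n x)) (at x within cells S)"
    unfolding inner_sum_left inner_scaleR_left
    by (intro tendsto_sum tendsto_mult_left ntrace_limit[OF _ e] assms(1))
qed (use fine_point_closure e in blast)

lemma ntrace_diff:
  assumes "v \<in> vel_h S" "w \<in> vel_h S"
    and e: "e \<in> faces (fine_grid S)" "x \<in> rel_interior e" "unit_normal e n"
  shows "ntrace S (\<lambda>x. v x - w x) n x = ntrace S v n x - ntrace S w n x"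
  by (rule ntrace_eqI) (use fine_point_closure e in
      \<open>auto simp: inner_diff_left intro!: tendsto_diff ntrace_limit assms\<close>)

lemma ntrace_minus:
  assumes "v \<in> vel_h S"
    and e: "e \<in> faces (fine_grid S)" "x \<in> rel_interior e" "unit_normal e n"
  shows "ntrace S v (- n) x = - ntrace S v n x"
  by (rule ntrace_eqI) (use fine_point_closure e in
      \<open>auto simp: inner_minus_right intro!: tendsto_minus ntrace_limit assms\<close>)

lemma bdry_trace_diff:
  assumes "v \<in> vel_h S" "w \<in> vel_h S" "bdry_trace S v b" "bdry_trace S w b"
  shows "bdry_trace S (\<lambda>x. v x - w x) (\<lambda>_. 0)"
  unfolding bdry_trace_def
proof (intro ballI)
  fix E K e x
  assume *: "E \<in> boundary_faces S" "K \<in> blocks S E" "e \<in> fine_in S E" "x \<in> rel_interior e"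
  have "E facet_of K" "K \<in> coarse_grid S" using * by (auto simp: blocks_def)
  then have "unit_normal E (outer_normal K E)"
    using outer_normal(1) coarse.polytope_T coarse.interior_T by blast
  then have "unit_normal e (outer_normal K E)"
    using * unit_normal_subset by (auto simp: fine_in_def)
  then have "ntrace S (\<lambda>x. v x - w x) (outer_normal K E) x =
      ntrace S v (outer_normal K E) x - ntrace S w (outer_normal K E) x"
    using * by (intro ntrace_diff[OF assms(1,2)]) (auto simp: fine_in_def)
  then show "ntrace S (\<lambda>x. v x - w x) (outer_normal K E) x = 0"
    using assms(3,4) * by (simp add: bdry_trace_def)
qed

subsection \<open>Splitting integrals over blocks\<close>

text \<open>Distinct blocks have no point of a cell interior in common.\<close>

lemma set_integral_Union_blocks:
  fixes f :: "'a \<Rightarrow> real"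
  assumes T: "T \<subseteq> coarse_grid S" and f: "\<And>K. K \<in> T \<Longrightarrow> set_integrable lebesgue K f"
  shows "(LINT x:\<Union>T|lebesgue. f x) = (\<Sum>K\<in>T. LINT x:K|lebesgue. f x)"
proof -
  have fin: "finite T" using T coarse.finite_T finite_subset by blast
  have C: "cells S \<in> sets lebesgue" using open_cells by (auto intro!: lborelD)
  have reg: "region K" "region (K \<inter> cells S)" if "K \<in> T" for K
    using region_block that T C by (auto simp: region_def)
  have regU: "region (\<Union>T)" "region (\<Union>K\<in>T. K \<inter> cells S)"
    using fin reg C unfolding region_def by (auto intro!: sets.finite_Union)
  have int: "set_integrable lebesgue (K \<inter> cells S) f" if "K \<in> T" for K
    using f[OF that] reg[OF that] set_integrable_subset[of lebesgue K f "K \<inter> cells S"]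
    by (auto simp: region_def)
  have disj: "disjoint_family_on (\<lambda>K. K \<inter> cells S) T"
    unfolding disjoint_family_on_def
  proof (intro ballI impI)
    fix K K' assume "K \<in> T" "K' \<in> T" "K \<noteq> K'"
    then show "K \<inter> cells S \<inter> (K' \<inter> cells S) = {}"
      using coarse.block_unique[of K K'] cells_Int_block[of _ K] T by blast
  qed
  have "(LINT x:\<Union>T|lebesgue. f x) = (LINT x:(\<Union>K\<in>T. K \<inter> cells S)|lebesgue. f x)"
    by (rule set_integral_cells_cong[OF regU]) auto
  also have "\<dots> = (\<Sum>K\<in>T. LINT x:K \<inter> cells S|lebesgue. f x)"
    using fin disj int reg by (intro set_integral_finite_Union) (auto simp: region_def)
  also have "\<dots> = (\<Sum>K\<in>T. LINT x:K|lebesgue. f x)"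
    by (intro sum.cong refl set_integral_cells_cong reg) auto
  finally show ?thesis .
qed

lemma measure_block_pos:
  assumes "K \<in> coarse_grid S" shows "0 < measure lebesgue K"
proof (rule ccontr)
  have K: "K \<in> lmeasurable" using coarse.compact_T[OF assms] by (rule lmeasurable_compact)
  assume "\<not> ?thesis"
  then have "measure lebesgue K = 0" using measure_nonneg[of lebesgue K] by linarith
  then have "negligible K" using negligible_iff_measure0[OF K] by simp
  then have "negligible (interior K)" using negligible_subset interior_subset by blast
  then show False using open_not_negligible coarse.interior_T[OF assms] by blast
qed

lemma set_integral_const_block:
  "K \<in> coarse_grid S \<Longrightarrow> (LINT x:K|lebesgue. c) = c * measure lebesgue K"
  using lmeasurable_compact[OF coarse.compact_T]
  by (simp add: set_lebesgue_integral_def fmeasurable_def mult.commute)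

text \<open>A block lies in at most \<^const>\<open>max_faces\<close> of the neighborhoods.\<close>

lemma sum_wform_nbhd_le:
  assumes u: "pw_continuous S u"
  shows "(\<Sum>E\<in>interior_faces S. wform S (nbhd S E) u u)
    \<le> real (max_faces (coarse_grid S)) * wform S (flow_dom S) u u"
proof -
  define f where "f x = inverse (perm S x) * (u x \<bullet> u x)" for x
  have f: "set_integrable lebesgue A f" if "region A" for A
    unfolding f_def[abs_def] by (intro set_integrable_weighted that pw_continuous_intros u)
  define I where "I K = (LINT x:K|lebesgue. f x)" for K
  have I0: "0 \<le> I K" if "K \<in> coarse_grid S" for K
    using wform_nonneg[OF region_block[OF that], of u] by (simp add: I_def f_def[abs_def] wform_def)
  have fin: "finite (coarse_grid S)" "finite (interior_faces S)"
    using coarse.finite_T coarse.finite_faces by (auto simp: interior_faces_def)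
  have "(\<Sum>E\<in>interior_faces S. wform S (nbhd S E) u u)
      = (\<Sum>E\<in>interior_faces S. \<Sum>K | K \<in> coarse_grid S \<and> E facet_of K. I K)"
  proof (rule sum.cong[OF refl])
    fix E
    have "wform S (nbhd S E) u u = (LINT x:\<Union>(blocks S E)|lebesgue. f x)"
      by (simp add: wform_def f_def[abs_def] nbhd_def)
    also have "\<dots> = (\<Sum>K\<in>blocks S E. I K)"
      unfolding I_def by (rule set_integral_Union_blocks) (auto simp: blocks_def intro!: f region_block)
    finally show "wform S (nbhd S E) u u = (\<Sum>K | K \<in> coarse_grid S \<and> E facet_of K. I K)"
      by (simp add: blocks_def)
  qed
  also have "\<dots> = (\<Sum>K\<in>coarse_grid S. \<Sum>E | E \<in> interior_faces S \<and> E facet_of K. I K)"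
    by (rule sum.swap_restrict[OF fin(2,1)])
  also have "\<dots> = (\<Sum>K\<in>coarse_grid S. real (card {E \<in> interior_faces S. E facet_of K}) * I K)"
    by simp
  also have "\<dots> \<le> (\<Sum>K\<in>coarse_grid S. real (max_faces (coarse_grid S)) * I K)"
  proof (rule sum_mono)
    fix K assume K: "K \<in> coarse_grid S"
    have "card {E \<in> interior_faces S. E facet_of K} \<le> card {F. F facet_of K}"
      using coarse.finite_facets[OF K] by (intro card_mono) auto
    also have "\<dots> \<le> max_faces (coarse_grid S)"
      unfolding max_faces_def using fin K by (intro Max_ge) auto
    finally show "real (card {E \<in> interior_faces S. E facet_of K}) * I K
        \<le> real (max_faces (coarse_grid S)) * I K"
      using I0[OF K] by (intro mult_right_mono) auto
  qed
  also have "\<dots> = real (max_faces (coarse_grid S)) * (LINT x:\<Union>(coarse_grid S)|lebesgue. f x)"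
    unfolding sum_distrib_left[symmetric] I_def
    by (subst set_integral_Union_blocks) (auto intro!: f region_block)
  also have "(LINT x:\<Union>(coarse_grid S)|lebesgue. f x) = (LINT x:flow_dom S|lebesgue. f x)"
  proof (rule set_integral_cells_cong)
    show "region (\<Union>(coarse_grid S))"
      unfolding coarse.Union_T by (auto simp: region_def intro!: lborelD)
  qed (use region_flow_dom cells_subset_flow_dom coarse.Union_T closure_subset in blast)+
  also have "\<dots> = wform S (flow_dom S) u u" by (simp add: wform_def f_def[abs_def])
  finally show ?thesis .
qed

end

section \<open>Surface integrals over a face split into fine faces\<close>

text \<open>The prism of height one over \<open>X\<close> in the direction \<open>n\<close>. For a face with its chosen normal this is
  \<^const>\<open>prism\<close>; with the normal kept fixed it applies to the fine faces contained in that face.\<close>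

definition prism_over :: "'a::euclidean_space \<Rightarrow> 'a set \<Rightarrow> 'a set" where
  "prism_over n X = {x + t *\<^sub>R n | x t. x \<in> X \<and> 0 \<le> t \<and> t \<le> 1}"

lemma prism_eq: "prism E = prism_over (SOME n. unit_normal E n) E"
  by (simp add: prism_def prism_over_def)

lemma closest_point_hyperplane:
  fixes n :: "'a::euclidean_space"
  assumes "norm n = 1"
  shows "closest_point {x. n \<bullet> x = c} y = y - (n \<bullet> y - c) *\<^sub>R n"
proof (rule closest_point_unique[symmetric])
  have nn: "n \<bullet> n = 1" using assms by (simp add: dot_square_norm)
  show "y - (n \<bullet> y - c) *\<^sub>R n \<in> {x. n \<bullet> x = c}" by (simp add: inner_diff_right nn)
  show "\<forall>z\<in>{x. n \<bullet> x = c}. dist y (y - (n \<bullet> y - c) *\<^sub>R n) \<le> dist y z"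
  proof
    fix z assume "z \<in> {x. n \<bullet> x = c}"
    then have "\<bar>n \<bullet> y - c\<bar> = \<bar>n \<bullet> (y - z)\<bar>" by (simp add: inner_diff_right)
    also have "\<dots> \<le> norm n * norm (y - z)" by (rule Cauchy_Schwarz_ineq2)
    finally show "dist y (y - (n \<bullet> y - c) *\<^sub>R n) \<le> dist y z"
      using assms by (simp add: dist_norm)
  qed
qed (simp_all add: convex_hyperplane closed_hyperplane)

text \<open>The prism of height one over a compact convex set \<open>e\<close> that spans the hyperplane
  \<open>n \<bullet> x = c\<close>. Points over the relative boundary of \<open>e\<close> lie on the frontier of the prism,
  which is a null set.\<close>

locale flat_face =
  fixes n :: "'a::euclidean_space" and c :: real and e :: "'a set"
  assumes norm_n: "norm n = 1" and hull: "affine hull e = {x. n \<bullet> x = c}"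
    and compact_e: "compact e" and convex_e: "convex e" and e_ne: "e \<noteq> {}"
begin

lemma nn: "n \<bullet> n = 1"
  using norm_n by (simp add: dot_square_norm)

lemma on_hyperplane: "x \<in> e \<Longrightarrow> n \<bullet> x = c"
  using hull hull_subset[of e affine] by auto

lemma mem_prism_over:
  "y \<in> prism_over n e \<longleftrightarrow> c \<le> n \<bullet> y \<and> n \<bullet> y \<le> c + 1 \<and> closest_point {x. n \<bullet> x = c} y \<in> e"
  unfolding closest_point_hyperplane[OF norm_n]
proof
  assume "y \<in> prism_over n e"
  then obtain x t where "y = x + t *\<^sub>R n" "x \<in> e" "0 \<le> t" "t \<le> 1" by (auto simp: prism_over_def)
  then show "c \<le> n \<bullet> y \<and> n \<bullet> y \<le> c + 1 \<and> y - (n \<bullet> y - c) *\<^sub>R n \<in> e"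
    using on_hyperplane[of x] by (simp add: inner_add_right nn)
next
  assume "c \<le> n \<bullet> y \<and> n \<bullet> y \<le> c + 1 \<and> y - (n \<bullet> y - c) *\<^sub>R n \<in> e"
  then show "y \<in> prism_over n e"
    unfolding prism_over_def
    by (intro CollectI exI[of _ "y - (n \<bullet> y - c) *\<^sub>R n"] exI[of _ "n \<bullet> y - c"]) auto
qed

lemma prism_over_image: "prism_over n e = (\<lambda>p. fst p + snd p *\<^sub>R n) ` (e \<times> {0..1})"
  by (force simp: prism_over_def image_iff)

lemma compact_prism_over: "compact (prism_over n e)"
  unfolding prism_over_image
  by (intro compact_continuous_image compact_Times compact_e compact_Icc continuous_intros)

lemma convex_prism_over: "convex (prism_over n e)"
proof -
  have "linear (\<lambda>p :: 'a \<times> real. fst p + snd p *\<^sub>R n)"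
    by (rule linearI) (simp_all add: algebra_simps)
  then show ?thesis
    unfolding prism_over_image by (intro convex_linear_image convex_Times convex_e convex_real_interval)
qed

lemma negligible_frontier_prism: "negligible (frontier (prism_over n e))"
  using convex_prism_over by (rule negligible_convex_frontier)

lemma interior_prism_over:
  assumes "y \<in> interior (prism_over n e)"
  shows "closest_point {x. n \<bullet> x = c} y \<in> rel_interior e"
proof -
  obtain r where r: "r > 0" "ball y r \<subseteq> prism_over n e"
    using assms by (meson mem_interior)
  define z where "z = closest_point {x. n \<bullet> x = c} y"
  have z: "z = y - (n \<bullet> y - c) *\<^sub>R n" by (simp add: z_def closest_point_hyperplane norm_n)
  have "y \<in> prism_over n e" using r centre_in_ball[of y r] by blast
  then have "z \<in> e" unfolding mem_prism_over z_def by blast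
  moreover have "ball z r \<inter> affine hull e \<subseteq> e"
  proof
    fix w assume w: "w \<in> ball z r \<inter> affine hull e"
    define y' where "y' = w + (n \<bullet> y - c) *\<^sub>R n"
    have "dist y y' = dist z w" by (simp add: y'_def z dist_norm algebra_simps)
    then have "y' \<in> prism_over n e" using r w by auto
    moreover have "closest_point {x. n \<bullet> x = c} y' = w"
      using w by (simp add: y'_def closest_point_hyperplane norm_n hull inner_add_right nn)
    ultimately show "w \<in> e" by (simp add: mem_prism_over)
  qed
  ultimately show ?thesis using r(1) unfolding z_def[symmetric] mem_rel_interior_ball by blast
qed

lemma not_frontier_prism:
  assumes "y \<in> prism_over n e" "y \<notin> frontier (prism_over n e)"
  shows "closest_point {x. n \<bullet> x = c} y \<in> rel_interior e"
  using assms interior_prism_over closure_subset by (auto simp: frontier_def)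

lemma prism_over_not_negligible: "\<not> negligible (prism_over n e)"
proof
  assume neg: "negligible (prism_over n e)"
  obtain x where x: "x \<in> rel_interior e"
    using e_ne convex_e rel_interior_eq_empty by blast
  obtain T where T: "open T" "rel_interior e = affine hull e \<inter> T"
    using openin_rel_interior[of e] by (auto simp: openin_open)
  define U where "U = {y. c < n \<bullet> y} \<inter> {y. n \<bullet> y < c + 1} \<inter> (\<lambda>y. y - (n \<bullet> y - c) *\<^sub>R n) -` T"
  have "open U"
    unfolding U_def
    by (intro open_Int open_halfspace_gt open_halfspace_lt open_vimage T(1) continuous_intros)
  moreover have "U \<subseteq> prism_over n e"
  proof
    fix y assume y: "y \<in> U"
    have "y - (n \<bullet> y - c) *\<^sub>R n \<in> affine hull e" by (simp add: hull inner_diff_right nn)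
    then have "y - (n \<bullet> y - c) *\<^sub>R n \<in> e"
      using y T(2) rel_interior_subset[of e] by (auto simp: U_def)
    then show "y \<in> prism_over n e" using y
      by (simp add: mem_prism_over closest_point_hyperplane norm_n U_def)
  qed
  moreover have "x + (1/2) *\<^sub>R n \<in> U"
    using x T(2) on_hyperplane[of x] rel_interior_subset[of e]
    by (auto simp: U_def inner_add_right nn)
  ultimately show False using neg open_not_negligible negligible_subset by blast
qed

end

text \<open>Integration of a weighted function that is constant on the relative interior of each piece of a
  face: the prisms over the pieces overlap in null sets only.\<close>

lemma face_integral_pieces:
  fixes F :: "'a::euclidean_space set" and k f :: "'a \<Rightarrow> real"
  defines "n \<equiv> SOME n. unit_normal F n"
  assumes n: "unit_normal F n"
    and J: "finite J" and F: "F = (\<Union>j\<in>J. e j)"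
    and hullF: "affine hull F = {x. n \<bullet> x = b}"
    and flat: "\<And>j. j \<in> J \<Longrightarrow> flat_face n b (e j)"
    and disj: "\<And>i j. i \<in> J \<Longrightarrow> j \<in> J \<Longrightarrow> i \<noteq> j \<Longrightarrow> rel_interior (e i) \<inter> e j = {}"
    and k: "face_integrable F k"
    and f: "\<And>j x. j \<in> J \<Longrightarrow> x \<in> rel_interior (e j) \<Longrightarrow> f x = c j"
  defines "w \<equiv> \<lambda>j. LINT y:prism_over n (e j)|lebesgue. k (closest_point (affine hull F) y)"
  shows "face_integral F (\<lambda>x. k x * f x) = (\<Sum>j\<in>J. c j * w j)"
    and "\<And>j. j \<in> J \<Longrightarrow> (\<And>x. x \<in> F \<Longrightarrow> 0 < k x) \<Longrightarrow> 0 < w j"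
proof -
  let ?P = "\<lambda>j. prism_over n (e j)" and ?\<pi> = "closest_point (affine hull F)"
  have prism: "prism F = (\<Union>j\<in>J. ?P j)"
    unfolding prism_eq n_def[symmetric] prism_over_def using F by blast
  have P: "?P j \<in> sets lebesgue" if "j \<in> J" for j
    using flat_face.compact_prism_over[OF flat[OF that]] by (auto intro!: lborelD borel_compact)
  have kP: "set_integrable lebesgue (?P j) (\<lambda>y. k (?\<pi> y))" if "j \<in> J" for j
    using k P[OF that] that unfolding face_integrable_def prism
    by (rule_tac set_integrable_subset) auto
  have fr: "?\<pi> y \<in> rel_interior (e j)" if "j \<in> J" "y \<in> ?P j" "y \<notin> frontier (?P j)" for j y
    using flat_face.not_frontier_prism[OF flat[OF that(1)] that(2,3)] hullF by simp
  have neg: "negligible (frontier (?P j))" if "j \<in> J" for j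
    using flat_face.negligible_frontier_prism[OF flat[OF that]] .
  have "((\<lambda>y. k (?\<pi> y) * f (?\<pi> y)) has_integral c j * w j) (?P j)" 
    and int: "set_integrable lebesgue (?P j) (\<lambda>y. k (?\<pi> y) * f (?\<pi> y))" if j: "j \<in> J" for j
  proof -
    have eq: "indicator (?P j) y *\<^sub>R (k (?\<pi> y) * f (?\<pi> y)) = indicator (?P j) y *\<^sub>R (c j * k (?\<pi> y))"
      if "y \<notin> frontier (?P j)" for y
      using fr[OF j _ that] f[OF j] by (auto simp: indicator_def)
    note cong = set_integral_negligible_cong[OF neg[OF j] eq]
    have ck: "set_integrable lebesgue (?P j) (\<lambda>y. c j * k (?\<pi> y))"
      using kP[OF j] by simp
    then show i: "set_integrable lebesgue (?P j) (\<lambda>y. k (?\<pi> y) * f (?\<pi> y))"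
      using cong(1) by simp
    have "(LINT y:?P j|lebesgue. k (?\<pi> y) * f (?\<pi> y)) = c j * w j"
      using cong(2) by (simp add: w_def)
    then show "((\<lambda>y. k (?\<pi> y) * f (?\<pi> y)) has_integral c j * w j) (?P j)"
      using has_integral_set_lebesgue[OF i] by simp
  qed
  moreover have "pairwise (\<lambda>i j. negligible (?P i \<inter> ?P j)) J"
    unfolding pairwise_def
  proof (intro ballI impI)
    fix i j assume ij: "i \<in> J" "j \<in> J" "i \<noteq> j"
    have "?P i \<inter> ?P j \<subseteq> frontier (?P i)"
    proof
      fix y assume y: "y \<in> ?P i \<inter> ?P j"
      then have "?\<pi> y \<in> e j"
        using flat_face.mem_prism_over[OF flat[OF ij(2)], of y] hullF by simp
      then show "y \<in> frontier (?P i)" using fr[OF ij(1), of y] y disj[OF ij] by blast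
    qed
    then show "negligible (?P i \<inter> ?P j)" using neg[OF ij(1)] negligible_subset by blast
  qed
  ultimately have "((\<lambda>y. k (?\<pi> y) * f (?\<pi> y)) has_integral (\<Sum>j\<in>J. c j * w j)) (prism F)"
    unfolding prism using J by (intro has_integral_UN)
  moreover have "set_integrable lebesgue (prism F) (\<lambda>y. k (?\<pi> y) * f (?\<pi> y))"
    unfolding prism using J int P by (intro set_integrable_UN)
  ultimately show "face_integral F (\<lambda>x. k x * f x) = (\<Sum>j\<in>J. c j * w j)"
    unfolding face_integral_def
    by (simp add: set_lebesgue_integral_eq_integral(2) integral_unique)
next
  fix j assume j: "j \<in> J" and pos: "\<And>x. x \<in> F \<Longrightarrow> 0 < k x"
  let ?P = "prism_over n (e j)" and ?\<pi> = "closest_point (affine hull F)"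
  let ?g = "\<lambda>y. indicator ?P y *\<^sub>R k (?\<pi> y)"
  have P: "?P \<in> sets lebesgue"
    using flat_face.compact_prism_over[OF flat[OF j]] by (auto intro!: lborelD borel_compact)
  have "?P \<subseteq> prism F" unfolding prism_eq n_def[symmetric] prism_over_def using F j by blast
  then have int: "integrable lebesgue ?g"
    using k P unfolding face_integrable_def set_integrable_def[symmetric]
    by (rule_tac set_integrable_subset) auto
  have gpos: "0 < ?g y" if "y \<in> ?P" for y
    using flat_face.mem_prism_over[OF flat[OF j], of y] that pos[of "?\<pi> y"] F j hullF by auto
  have g0: "0 \<le> ?g y" for y using gpos[of y] by (cases "y \<in> ?P") auto
  have "w j \<noteq> 0"
  proof
    assume "w j = 0"
    then have "AE y in lebesgue. ?g y = 0"
      using integral_nonneg_eq_0_iff_AE[OF int] g0 by (simp add: w_def set_lebesgue_integral_def)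
    then obtain N where N: "N \<in> null_sets lebesgue" "{y. ?g y \<noteq> 0} \<subseteq> N"
      unfolding eventually_ae_filter by auto
    then have "?P \<subseteq> N" using gpos by fastforce
    then show False
      using N(1) flat_face.prism_over_not_negligible[OF flat[OF j]] negligible_iff_null_sets
        negligible_subset by blast
  qed
  moreover have "0 \<le> w j"
    unfolding w_def set_lebesgue_integral_def using g0 by (rule Bochner_Integration.integral_nonneg)
  ultimately show "0 < w j" by simp
qed

context gms_method
begin

lemma coarse_face_pieces:
  assumes "E \<in> faces (coarse_grid S)"
  shows "unit_normal E (fnormal S E)" "bij_betw (fface S E) {1..nfine S E} (fine_in S E)"
    "E = (\<Union>j\<in>{1..nfine S E}. fface S E j)"
  using grids assms by (auto simp: grids_def)

lemma fface_fine:
  assumes "E \<in> faces (coarse_grid S)" "j \<in> {1..nfine S E}"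
  shows "fface S E j \<in> faces (fine_grid S)" "fface S E j \<subseteq> E"
  using bij_betwE[OF coarse_face_pieces(2)[OF assms(1)]] assms(2) by (auto simp: fine_in_def)

lemma rel_interior_fine_subset:
  assumes E: "E \<in> faces (coarse_grid S)" and e: "e \<in> faces (fine_grid S)" "e \<subseteq> E"
  shows "affine hull e = affine hull E" "rel_interior e \<subseteq> rel_interior E"
proof -
  have "aff_dim (affine hull e) = aff_dim (affine hull E)"
    using fine.aff_dim_faces[OF e(1)] coarse.aff_dim_faces[OF E] by simp
  then show hull: "affine hull e = affine hull E"
    using fine.faces_ne[OF e(1)] hull_mono[OF e(2), of affine]
    by (intro affine_dim_equal) auto
  then show "rel_interior e \<subseteq> rel_interior E" using e(2) by (rule subset_rel_interior[rotated])
qed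

text \<open>The integral of \<open>k\<close> over the \<open>j\<close>-th fine face of \<open>E\<close>, with the normal and the hyperplane of \<open>E\<close>.\<close>

definition face_weight :: "'a set \<Rightarrow> ('a \<Rightarrow> real) \<Rightarrow> nat \<Rightarrow> real" where
  "face_weight E k j = (LINT y:prism_over (SOME n. unit_normal E n) (fface S E j)|lebesgue.
     k (closest_point (affine hull E) y))"

lemma
  fixes k f :: "'a \<Rightarrow> real"
  assumes E: "E \<in> faces (coarse_grid S)" and k: "face_integrable E k"
  shows face_integral_fine:
    "(\<And>j x. j \<in> {1..nfine S E} \<Longrightarrow> x \<in> rel_interior (fface S E j) \<Longrightarrow> f x = c j) \<Longrightarrow>
     face_integral E (\<lambda>x. k x * f x) = (\<Sum>j\<in>{1..nfine S E}. c j * face_weight E k j)"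
    and face_weight_pos:
    "j \<in> {1..nfine S E} \<Longrightarrow> (\<And>x. x \<in> E \<Longrightarrow> 0 < k x) \<Longrightarrow> 0 < face_weight E k j"
proof -
  let ?n = "SOME n. unit_normal E n"
  have n: "unit_normal E ?n" using coarse_face_pieces(1)[OF E] by (rule someI)
  obtain x where x: "x \<in> E" using coarse.faces_ne[OF E] by auto
  have hull: "affine hull E = {y. ?n \<bullet> y = ?n \<bullet> x}"
    by (rule affine_hull_unit_normal[OF n coarse.aff_dim_faces[OF E] x])
  have flat: "flat_face ?n (?n \<bullet> x) (fface S E j)" if "j \<in> {1..nfine S E}" for j
  proof
    show "norm ?n = 1" using n by (simp add: unit_normal_def)
    note e = fface_fine[OF E that]
    show "affine hull fface S E j = {y. ?n \<bullet> y = ?n \<bullet> x}"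
      using rel_interior_fine_subset(1)[OF E e] hull by simp
    show "compact (fface S E j)" "convex (fface S E j)" "fface S E j \<noteq> {}"
      using fine.polytope_faces[OF e(1)] fine.faces_ne[OF e(1)]
      by (auto simp: polytope_imp_compact polytope_imp_convex)
  qed
  have disj: "rel_interior (fface S E i) \<inter> fface S E j = {}"
    if "i \<in> {1..nfine S E}" "j \<in> {1..nfine S E}" "i \<noteq> j" for i j
  proof -
    have "fface S E i \<noteq> fface S E j"
      using inj_on_eq_iff[OF bij_betw_imp_inj_on[OF coarse_face_pieces(2)[OF E]] that(1,2)] that(3)
      by simp
    then show ?thesis
      using fine.face_unique[OF fface_fine(1)[OF E that(1)] fface_fine(1)[OF E that(2)]] by auto
  qed
  note * = face_integral_pieces[OF n _ coarse_face_pieces(3)[OF E] hull flat disj k]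
  show "face_integral E (\<lambda>x. k x * f x) = (\<Sum>j\<in>{1..nfine S E}. c j * face_weight E k j)"
    if "\<And>j x. j \<in> {1..nfine S E} \<Longrightarrow> x \<in> rel_interior (fface S E j) \<Longrightarrow> f x = c j"
    unfolding face_weight_def using that by (intro *(1) finite_atLeastAtMost)
  show "0 < face_weight E k j" if "j \<in> {1..nfine S E}" "\<And>x. x \<in> E \<Longrightarrow> 0 < k x"
    unfolding face_weight_def using that
    by (intro *(2)[where f="\<lambda>_. 0" and c="\<lambda>_. 0"] finite_atLeastAtMost refl)
qed

lemma face_integrable_one:
  assumes E: "E \<in> faces (coarse_grid S)"
  shows "face_integrable E (\<lambda>_. 1)"
proof -
  let ?n = "SOME n. unit_normal E n"
  have n: "unit_normal E ?n" using coarse_face_pieces(1)[OF E] by (rule someI)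
  obtain x where x: "x \<in> E" using coarse.faces_ne[OF E] by auto
  have "flat_face ?n (?n \<bullet> x) E"
  proof
    show "norm ?n = 1" using n by (simp add: unit_normal_def)
    show "affine hull E = {y. ?n \<bullet> y = ?n \<bullet> x}"
      by (rule affine_hull_unit_normal[OF n coarse.aff_dim_faces[OF E] x])
    show "compact E" "convex E" "E \<noteq> {}"
      using coarse.polytope_faces[OF E] coarse.faces_ne[OF E]
      by (auto simp: polytope_imp_compact polytope_imp_convex)
  qed
  then have "compact (prism E)" unfolding prism_eq by (rule flat_face.compact_prism_over)
  then show ?thesis
    unfolding face_integrable_def by (simp add: absolutely_integrable_on_const lmeasurable_compact)
qed

end

section \<open>Snapshot fields\<close>

context gms_method
begin

lemma interior_facesD:
  assumes "E \<in> interior_faces S"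
  obtains K K' where "blocks S E = {K, K'}" "K \<noteq> K'" "K \<in> coarse_grid S" "K' \<in> coarse_grid S"
    "E facet_of K" "E facet_of K'"
proof -
  obtain K K' where K: "blocks S E = {K, K'}" "K \<noteq> K'"
    using assms by (auto simp: interior_faces_def card_2_iff)
  then have "K \<in> blocks S E" "K' \<in> blocks S E" by auto
  then show ?thesis using that[OF K] by (auto simp: blocks_def)
qed

lemma interior_faces_subset: "interior_faces S \<subseteq> faces (coarse_grid S)"
  by (auto simp: interior_faces_def)

lemma snapshot: "E \<in> faces (coarse_grid S) \<Longrightarrow> j \<in> {1..nfine S E} \<Longrightarrow> is_snapshot S E j (snap S E j)"
  using setting by (auto simp: gms_setting_def)

lemma snap_vel_h: "E \<in> faces (coarse_grid S) \<Longrightarrow> j \<in> {1..nfine S E} \<Longrightarrow> snap S E j \<in> vel_h S"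
  using snapshot by (auto simp: is_snapshot_def)

lemma snap_local_vel_h: 
  assumes "E \<in> faces (coarse_grid S)" shows "snap_local S E \<subseteq> vel_h S"
  unfolding snap_local_def lin_span_def
  using snap_vel_h[OF assms] by (auto intro!: vel_h_sum vel_h_scaleR)

lemma snap_local_outside:
  assumes E: "E \<in> faces (coarse_grid S)" and "v \<in> snap_local S E" "x \<notin> nbhd S E"
  shows "v x = 0" "divergence v x = 0"
proof -
  have "v y = 0" if "y \<notin> nbhd S E" for y
    using snapshot[OF E] assms(2) that
    by (auto simp: is_snapshot_def snap_local_def lin_span_def intro!: sum.neutral)
  then show "v x = 0" "divergence v x = 0"
    using assms(3) divergence_eq_0[OF closed_nbhd] by auto
qed

lemma pw_continuous_snap_local:
  assumes "E \<in> faces (coarse_grid S)" "v \<in> snap_local S E"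
  shows "pw_continuous S v" "pw_continuous S (divergence v)"
  using snap_local_vel_h[OF assms(1)] assms(2) pw_continuous_vel_h pw_continuous_divergence by auto

lemma ntrace_snap:
  assumes E: "E \<in> faces (coarse_grid S)" and "j \<in> {1..nfine S E}" "k \<in> {1..nfine S E}"
    and "x \<in> rel_interior (fface S E k)"
  shows "ntrace S (snap S E j) (fnormal S E) x = (if k = j then 1 else 0)"
  using snapshot[OF E] assms unfolding is_snapshot_def by blast

lemma fine_normal:
  assumes "E \<in> faces (coarse_grid S)" "k \<in> {1..nfine S E}" "unit_normal E n"
  shows "unit_normal (fface S E k) n"
  using fface_fine[OF assms(1,2)] assms(3) unit_normal_subset by blast

lemma ntrace_snap_comb:
  assumes E: "E \<in> faces (coarse_grid S)" and k: "k \<in> {1..nfine S E}"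
    and x: "x \<in> rel_interior (fface S E k)"
  shows "ntrace S (\<lambda>x. \<Sum>j\<in>{1..nfine S E}. c j *\<^sub>R snap S E j x) (fnormal S E) x = c k"
proof -
  have "ntrace S (\<lambda>x. \<Sum>j\<in>{1..nfine S E}. c j *\<^sub>R snap S E j x) (fnormal S E) x
      = (\<Sum>j\<in>{1..nfine S E}. c j * ntrace S (snap S E j) (fnormal S E) x)"
    using snap_vel_h[OF E] fface_fine(1)[OF E k] x fine_normal[OF E k coarse_face_pieces(1)[OF E]]
    by (rule ntrace_lin_comb)
  also have "\<dots> = (\<Sum>j\<in>{1..nfine S E}. if k = j then c j else 0)"
    by (intro sum.cong refl) (simp add: ntrace_snap[OF E _ k x])
  also have "\<dots> = c k" using k by simp
  finally show ?thesis .
qed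

text \<open>Total flux through \<open>E\<close> in the direction of its fixed normal.\<close>

definition flux :: "'a set \<Rightarrow> ('a \<Rightarrow> 'a) \<Rightarrow> real" where
  "flux E v = face_integral E (ntrace S v (fnormal S E))"

lemma face_integral_const_pieces:
  assumes E: "E \<in> faces (coarse_grid S)"
    and f: "\<And>j x. j \<in> {1..nfine S E} \<Longrightarrow> x \<in> rel_interior (fface S E j) \<Longrightarrow> f x = c j"
  shows "face_integral E f = (\<Sum>j\<in>{1..nfine S E}. c j * face_weight E (\<lambda>_. 1) j)"
  using face_integral_fine[OF E face_integrable_one[OF E] f] by simp

lemma flux_snap_comb:
  assumes E: "E \<in> faces (coarse_grid S)"
  shows "flux E (\<lambda>x. \<Sum>j\<in>{1..nfine S E}. c j *\<^sub>R snap S E j x)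
    = (\<Sum>j\<in>{1..nfine S E}. c j * flux E (snap S E j))"
proof -
  have 1: "flux E (\<lambda>x. \<Sum>j\<in>{1..nfine S E}. c j *\<^sub>R snap S E j x)
      = (\<Sum>j\<in>{1..nfine S E}. c j * face_weight E (\<lambda>_. 1) j)"
    unfolding flux_def by (intro face_integral_const_pieces ntrace_snap_comb E)
  have "flux E (snap S E j) = face_weight E (\<lambda>_. 1) j" if j: "j \<in> {1..nfine S E}" for j
  proof -
    have "flux E (snap S E j) = (\<Sum>k\<in>{1..nfine S E}. (if k = j then 1 else 0) * face_weight E (\<lambda>_. 1) k)"
      unfolding flux_def by (intro face_integral_const_pieces ntrace_snap E j)
    also have "\<dots> = (\<Sum>k\<in>{1..nfine S E}. if k = j then face_weight E (\<lambda>_. 1) k else 0)"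
      by (intro sum.cong) auto
    finally show ?thesis using j by simp
  qed
  then show ?thesis using 1 by simp
qed

text \<open>The form \<^const>\<open>a_form\<close> is positive definite on snapshot fields, because such a field is
  determined by its normal trace on the face; hence all eigenvalues are positive.\<close>

lemma eigval_pos:
  assumes E: "E \<in> faces (coarse_grid S)" and j: "j \<in> {1..nfine S E}"
  shows "0 < eigval S E j"
proof -
  let ?\<phi> = "eigfun S E j" and ?k = "\<lambda>x. inverse (perm S x)"
  have "spectral_problem S E" using setting E by (auto simp: gms_setting_def)
  then have phi: "?\<phi> \<in> snap_local S E" "?\<phi> \<noteq> (\<lambda>_. 0)"
    "a_form S E ?\<phi> ?\<phi> = eigval S E j * s_form S E ?\<phi> ?\<phi>"
    using j unfolding spectral_problem_def by blast+
  then obtain c where c: "?\<phi> = (\<lambda>x. \<Sum>i\<in>{1..nfine S E}. c i *\<^sub>R snap S E i x)"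
    by (auto simp: snap_local_def lin_span_def)
  have "\<exists>i\<in>{1..nfine S E}. c i \<noteq> 0"
  proof (rule ccontr)
    assume "\<not> ?thesis"
    then have "?\<phi> = (\<lambda>_. 0)" unfolding c by (intro ext sum.neutral) auto
    then show False using phi(2) by simp
  qed
  then obtain i where i: "i \<in> {1..nfine S E}" "c i \<noteq> 0" by blast
  have k: "face_integrable E ?k" using flow E by (simp add: flow_problem_def)
  have kpos: "0 < ?k x" if "x \<in> E" for x
    using perm_pos[of x] coarse.face_subset_closure[OF E] that by auto
  have "a_form S E ?\<phi> ?\<phi> = face_integral E (\<lambda>x. ?k x * (ntrace S ?\<phi> (fnormal S E) x)\<^sup>2)"
    by (simp add: a_form_def power2_eq_square mult.assoc)
  also have "\<dots> = (\<Sum>i\<in>{1..nfine S E}. (c i)\<^sup>2 * face_weight E ?k i)"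
    unfolding c by (rule face_integral_fine[OF E k]) (simp only: ntrace_snap_comb[OF E])
  also have "\<dots> > 0"
  proof (rule sum_pos2[OF _ i(1)])
    show "0 < (c i)\<^sup>2 * face_weight E ?k i" using i face_weight_pos[OF E k _ kpos] by simp
    show "0 \<le> (c i)\<^sup>2 * face_weight E ?k i" if "i \<in> {1..nfine S E}" for i
      using face_weight_pos[OF E k that kpos] by simp
  qed simp
  finally have pos: "0 < eigval S E j * s_form S E ?\<phi> ?\<phi>" using phi(3) by simp
  have "0 \<le> mesh_size (coarse_grid S)"
    using E by (intro coarse.mesh_size_nonneg) (auto simp: faces_def)
  moreover have "0 \<le> dform (nbhd S E) ?\<phi> (divergence ?\<phi>)"
    unfolding dform_def by (rule set_lebesgue_integral_nonneg) simp
  ultimately have "0 \<le> s_form S E ?\<phi> ?\<phi>"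
    using wform_nonneg[OF region_nbhd] unfolding s_form_def
    by (intro mult_nonneg_nonneg add_nonneg_nonneg) auto
  then show ?thesis using pos by (metis mult_nonpos_nonneg not_le)
qed

subsection \<open>Vanishing normal traces\<close>

text \<open>A facet of a block of the neighborhood other than \<open>E\<close> belongs to no further block of it, since two
  blocks share at most one facet; so it lies on the frontier of the neighborhood.\<close>

lemma facet_subset_frontier_nbhd:
  assumes K: "K \<in> blocks S E" and F: "F facet_of K" "F \<noteq> E"
  shows "F \<subseteq> frontier (nbhd S E)"
proof -
  have KE: "K \<in> coarse_grid S" "E facet_of K" using K by (auto simp: blocks_def)
  have Ff: "F \<in> faces (coarse_grid S)" using F KE by (auto simp: faces_def)
  have FK: "F \<subseteq> K" "F \<inter> interior K = {}"
    using F coarse.aff_dim_faces[OF Ff] aff_dim_nonempty_interior[OF coarse.interior_T[OF KE(1)]]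
      facet_of_imp_subset face_of_disjoint_interior[of F K] facet_of_imp_face_of by force+
  have "rel_interior F \<subseteq> frontier (nbhd S E)"
  proof
    fix x assume x: "x \<in> rel_interior F"
    then have xF: "x \<in> F" using rel_interior_subset by blast
    have other: "x \<notin> K'" if K': "K' \<in> blocks S E" "K' \<noteq> K" for K'
    proof
      assume "x \<in> K'"
      have K'': "K' \<in> coarse_grid S" "E facet_of K'" using K' by (auto simp: blocks_def)
      have "F facet_of K'" by (rule coarse.facet_of_if_meets[OF Ff K''(1) x \<open>x \<in> K'\<close>])
      then have "K \<inter> K' = F" "K \<inter> K' = E"
        using coarse.Int_eq_facet[OF KE(1) K''(1)] K' F KE(2) K''(2) facet_of_imp_subset by blast+
      then show False using F by simp
    qed
    have "x \<notin> interior (nbhd S E)"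
    proof
      assume x_int: "x \<in> interior (nbhd S E)"
      define U where "U = interior (nbhd S E) - \<Union>(blocks S E - {K})"
      have "closed (\<Union>(blocks S E - {K}))"
        using coarse.finite_T coarse.closed_T by (intro closed_Union) (auto simp: blocks_def)
      then have "open U" unfolding U_def by (intro open_Diff) auto
      moreover have "x \<in> U" using x_int other by (auto simp: U_def)
      moreover have "U \<subseteq> K" unfolding U_def using interior_subset[of "nbhd S E"] by (auto simp: nbhd_def)
      ultimately have "x \<in> interior K" by (rule interiorI)
      then show False using FK xF by blast
    qed
    moreover have "x \<in> nbhd S E" using xF FK K by (auto simp: nbhd_def)
    ultimately show "x \<in> frontier (nbhd S E)"
      using closure_subset by (auto simp: frontier_def)
  qed
  then have "closure (rel_interior F) \<subseteq> frontier (nbhd S E)"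
    by (simp add: closure_minimal)
  moreover have "closure (rel_interior F) = closure F"
    using coarse.polytope_faces[OF Ff] by (intro convex_closure_rel_interior polytope_imp_convex)
  ultimately show ?thesis using closure_subset by blast
qed

lemma zero_ntrace_other_facet:
  assumes E: "E \<in> faces (coarse_grid S)" and K: "K \<in> blocks S E" and F: "F facet_of K" "F \<noteq> E"
    and e: "e \<in> fine_in S F" and v: "v \<in> snap_local S E"
  shows "zero_ntrace S v e"
proof -
  have Ff: "F \<in> faces (coarse_grid S)" using F K by (auto simp: faces_def blocks_def)
  have ef: "e \<in> faces (fine_grid S)" "e \<subseteq> F" using e by (auto simp: fine_in_def)
  have "e \<subseteq> frontier (nbhd S E)" using ef facet_subset_frontier_nbhd[OF K F] by blast
  then have fr: "e \<in> fine_in S (frontier (nbhd S E))" using ef by (simp add: fine_in_def)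
  have notE: "\<not> e \<subseteq> E"
  proof
    assume "e \<subseteq> E"
    obtain x where x: "x \<in> rel_interior e" using fine.rel_interior_faces[OF ef(1)] by auto
    then have "x \<in> rel_interior F" "x \<in> E"
      using rel_interior_fine_subset(2)[OF Ff ef] \<open>e \<subseteq> E\<close> rel_interior_subset by blast+
    then show False using coarse.face_unique[OF Ff E] F by blast
  qed
  have snap0: "zero_ntrace S (snap S E j) e" if "j \<in> {1..nfine S E}" for j
    using snapshot[OF E that] fr notE unfolding is_snapshot_def by blast
  obtain c where c: "v = (\<lambda>x. \<Sum>i\<in>{1..nfine S E}. c i *\<^sub>R snap S E i x)"
    using v by (auto simp: snap_local_def lin_span_def)
  show ?thesis
    unfolding zero_ntrace_def
  proof (intro ballI allI impI)
    fix x n assume "x \<in> rel_interior e" "unit_normal e n"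
    then show "ntrace S v n x = 0"
      unfolding c using snap0 snap_vel_h[OF E]
      by (subst ntrace_lin_comb[OF _ ef(1)]) (auto simp: zero_ntrace_def intro!: sum.neutral)
  qed
qed

lemma interior_face_not_boundary:
  assumes "E \<in> interior_faces S"
  shows "E \<notin> boundary_faces S"
proof
  assume b: "E \<in> boundary_faces S"
  obtain K K' where K: "K \<noteq> K'" "K \<in> coarse_grid S" "K' \<in> coarse_grid S" "E facet_of K" "E facet_of K'"
    using interior_facesD[OF assms] by metis
  obtain x where x: "x \<in> rel_interior E"
    using coarse.rel_interior_faces assms by (auto simp: interior_faces_def)
  have "x \<in> interior (K \<union> K')" by (rule coarse.rel_interior_subset_interior_Un[OF K(2,3,1,4,5) x])
  moreover have "K \<union> K' \<subseteq> closure (flow_dom S)" using K coarse.subset_closure by blast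
  ultimately have "x \<in> interior (closure (flow_dom S))" using interior_mono by blast
  then have "x \<in> flow_dom S" using flow by (simp add: flow_problem_def)
  moreover have "x \<in> frontier (flow_dom S)"
    using b x rel_interior_subset by (auto simp: boundary_faces_def)
  ultimately show False
    using flow by (auto simp: frontier_def flow_problem_def interior_open)
qed

text \<open>Fields of an interior face have zero normal trace on the boundary of the domain. On a
  boundary facet of a block outside the neighborhood, the trace exists and can be computed from
  inside that block, where the field is zero.\<close>

lemma bdry_trace_snap_local:
  assumes E: "E \<in> interior_faces S" and v: "v \<in> snap_local S E"
  shows "bdry_trace S v (\<lambda>_. 0)"
  unfolding bdry_trace_def
proof (intro ballI)
  fix E' K e x
  assume E': "E' \<in> boundary_faces S" and K: "K \<in> blocks S E'" and e: "e \<in> fine_in S E'"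
    and x: "x \<in> rel_interior e"
  let ?n = "outer_normal K E'"
  have Ef: "E \<in> faces (coarse_grid S)" using E by (simp add: interior_faces_def)
  have K': "E' facet_of K" "K \<in> coarse_grid S" using K by (auto simp: blocks_def)
  have ef: "e \<in> faces (fine_grid S)" "e \<subseteq> E'" using e by (auto simp: fine_in_def)
  have "unit_normal E' ?n"
    using outer_normal(1) coarse.polytope_T coarse.interior_T K' by blast
  then have n: "unit_normal e ?n" using unit_normal_subset ef by blast
  show "ntrace S v ?n x = 0"
  proof (cases "K \<in> blocks S E")
    case True
    have "E' \<noteq> E" using interior_face_not_boundary[OF E] E' by blast
    then have "zero_ntrace S v e" using zero_ntrace_other_facet[OF Ef True K'(1) _ e v] by simp
    then show ?thesis using x n by (simp add: zero_ntrace_def)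
  next
    case False
    define U where "U = interior K \<inter> cells S"
    have "open U" using open_cells by (auto simp: U_def)
    have v0: "v y = 0" if "y \<in> U" for y
    proof (rule snap_local_outside(1)[OF Ef v])
      show "y \<notin> nbhd S E"
      proof
        assume "y \<in> nbhd S E"
        then obtain K'' where K'': "K'' \<in> blocks S E" "y \<in> K''" by (auto simp: nbhd_def)
        then have "K = K''"
          using coarse.block_unique[OF K'(2), of K'' y] that by (auto simp: U_def blocks_def)
        then show False using False K'' by simp
      qed
    qed
    have "interior K \<subseteq> closure (cells S)"
      using closure_cells coarse.subset_closure[OF K'(2)] interior_subset by blast
    then have "interior K \<subseteq> closure U"
      using open_Int_closure_subset[of "interior K" "cells S"] by (auto simp: U_def)
    then have "closure (interior K) \<subseteq> closure U" by (simp add: closure_minimal)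
    moreover have "x \<in> K"
      using x ef rel_interior_subset[of e] facet_of_imp_subset[OF K'(1)] by blast
    ultimately have "x \<in> closure U" using coarse.closure_interior_T[OF K'(2)] by blast
    then have lim: "x islimpt U" using islimpt_open \<open>open U\<close> by blast
    have vh: "v \<in> vel_h S" using snap_local_vel_h[OF Ef] v by blast
    have "((\<lambda>y. v y \<bullet> ?n) \<longlongrightarrow> ntrace S v ?n x) (at x within U)"
      using ntrace_limit[OF vh ef(1) x n] by (rule tendsto_within_subset) (simp add: U_def)
    moreover have "((\<lambda>y. v y \<bullet> ?n) \<longlongrightarrow> 0) (at x within U)"
      by (rule tendsto_eventually) (auto simp: eventually_at_filter v0)
    ultimately show ?thesis
      using lim by (intro tendsto_unique[of "at x within U"]) (auto simp: trivial_limit_within)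
  qed
qed

subsection \<open>Divergence of snapshot fields\<close>

text \<open>On a block the divergence of a snapshot is constant, because its difference from the constant
  source is an admissible test pressure; compatibility identifies the constant.\<close>

lemma divergence_snap:
  assumes E: "E \<in> faces (coarse_grid S)" and j: "j \<in> {1..nfine S E}" and K: "K \<in> blocks S E"
    and x: "x \<in> K" "x \<in> cells S"
  shows "divergence (snap S E j) x * measure lebesgue K
    = face_integral E (ntrace S (snap S E j) (outer_normal K E))"
proof -
  let ?v = "snap S E j"
  have KE: "K \<in> coarse_grid S" "E facet_of K" using K by (auto simp: blocks_def)
  have vh: "?v \<in> vel_h S" by (rule snap_vel_h[OF E j])
  have "\<exists>a. (\<forall>q\<in>pres_h S. dform K ?v q = (LINT x:K|lebesgue. a * q x)) \<and>
    (LINT x:K|lebesgue. a) = (\<Sum>F | F facet_of K. face_integral F (ntrace S ?v (outer_normal K F)))"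
    using snapshot[OF E j] unfolding is_snapshot_def
    by (elim conjE) (drule bspec[OF _ K], elim exE bexE conjE, intro exI conjI, assumption+)
  then obtain a where a: "\<And>q. q \<in> pres_h S \<Longrightarrow> dform K ?v q = (LINT x:K|lebesgue. a * q x)"
    "(LINT x:K|lebesgue. a) = (\<Sum>F | F facet_of K. face_integral F (ntrace S ?v (outer_normal K F)))"
    by blast
  define f where "f x = divergence ?v x - a" for x
  have f: "f \<in> pres_h S" unfolding f_def[abs_def] by (rule pres_h_divergence[OF vh])
  have pf: "pw_continuous S f" by (rule pw_continuous_pres_h[OF f])
  have int: "set_integrable lebesgue K (\<lambda>x. divergence ?v x * f x)" "set_integrable lebesgue K (\<lambda>x. a * f x)"
    by (intro set_integrable_pw_continuous region_block KE pw_continuous_intros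
        pw_continuous_divergence vh pf)+
  have "(LINT x:K|lebesgue. (f x)\<^sup>2) = (LINT x:K|lebesgue. divergence ?v x * f x - a * f x)"
    by (simp add: f_def power2_eq_square algebra_simps)
  also have "\<dots> = dform K ?v f - (LINT x:K|lebesgue. a * f x)"
    unfolding dform_def by (rule set_integral_diff(2)[OF int])
  also have "\<dots> = 0" using a(1)[OF f] by simp
  finally have "f x = 0" using integral_square_zero_imp[OF pf KE(1) _ x] by simp
  then have div: "divergence ?v x = a" by (simp add: f_def)
  have zero: "face_integral F (ntrace S ?v (outer_normal K F)) = 0" if F: "F facet_of K" "F \<noteq> E" for F
  proof -
    have Ff: "F \<in> faces (coarse_grid S)" using F KE by (auto simp: faces_def)
    have "face_integral F (ntrace S ?v (outer_normal K F))
        = (\<Sum>k\<in>{1..nfine S F}. 0 * face_weight F (\<lambda>_. 1) k)"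
    proof (rule face_integral_const_pieces[OF Ff])
      fix k y assume k: "k \<in> {1..nfine S F}" and y: "y \<in> rel_interior (fface S F k)"
      have vs: "?v \<in> snap_local S E"
        unfolding snap_local_def using j by (intro lin_span_base) auto
      have "fface S F k \<in> fine_in S F" using fface_fine[OF Ff k] by (simp add: fine_in_def)
      then have "zero_ntrace S ?v (fface S F k)" using zero_ntrace_other_facet[OF E K F _ vs] by simp
      moreover have "unit_normal F (outer_normal K F)"
        using outer_normal(1) coarse.polytope_T coarse.interior_T KE F by blast
      ultimately show "ntrace S ?v (outer_normal K F) y = 0"
        using y fine_normal[OF Ff k] by (simp add: zero_ntrace_def)
    qed
    then show ?thesis by simp
  qed
  have "(\<Sum>F | F facet_of K. face_integral F (ntrace S ?v (outer_normal K F)))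
      = face_integral E (ntrace S ?v (outer_normal K E))"
    using coarse.finite_facets[OF KE(1)] KE(2) zero by (subst sum.remove[of _ E]) auto
  then show ?thesis using a(2) div set_integral_const_block[OF KE(1)] by simp
qed

lemma divergence_snap_local:
  assumes E: "E \<in> faces (coarse_grid S)" and K: "K \<in> blocks S E"
  obtains \<sigma> :: real where "\<bar>\<sigma>\<bar> = 1"
    "\<And>v x. v \<in> snap_local S E \<Longrightarrow> x \<in> K \<Longrightarrow> x \<in> cells S \<Longrightarrow>
       divergence v x = \<sigma> * flux E v / measure lebesgue K"
proof -
  have KE: "K \<in> coarse_grid S" "E facet_of K" using K by (auto simp: blocks_def)
  have nE: "unit_normal E (fnormal S E)" by (rule coarse_face_pieces(1)[OF E])
  have "unit_normal E (outer_normal K E)"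
    using outer_normal(1) coarse.polytope_T coarse.interior_T KE by blast
  then have "outer_normal K E = fnormal S E \<or> outer_normal K E = - fnormal S E"
    using unit_normal_unique[OF nE _ coarse.aff_dim_faces[OF E] coarse.faces_ne[OF E]] by blast
  then obtain \<sigma> :: real where s: "\<bar>\<sigma>\<bar> = 1"
    "outer_normal K E = fnormal S E \<and> \<sigma> = 1 \<or> outer_normal K E = - fnormal S E \<and> \<sigma> = - 1"
    using abs_1 abs_minus_cancel by metis
  have snap: "divergence (snap S E j) x = \<sigma> * flux E (snap S E j) / measure lebesgue K"
    if j: "j \<in> {1..nfine S E}" and x: "x \<in> K" "x \<in> cells S" for j x
  proof -
    have tr: "ntrace S (snap S E j) (outer_normal K E) y = \<sigma> * (if k = j then 1 else 0)"
      if k: "k \<in> {1..nfine S E}" and y: "y \<in> rel_interior (fface S E k)" for k y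
      using s(2) ntrace_snap[OF E j k y]
        ntrace_minus[OF snap_vel_h[OF E j] fface_fine(1)[OF E k] y fine_normal[OF E k nE]] by auto
    have "face_integral E (ntrace S (snap S E j) (outer_normal K E))
        = (\<Sum>k\<in>{1..nfine S E}. \<sigma> * (if k = j then 1 else 0) * face_weight E (\<lambda>_. 1) k)"
      by (intro face_integral_const_pieces tr E)
    also have "\<dots> = \<sigma> * (\<Sum>k\<in>{1..nfine S E}. (if k = j then 1 else 0) * face_weight E (\<lambda>_. 1) k)"
      by (simp add: sum_distrib_left mult.assoc)
    also have "(\<Sum>k\<in>{1..nfine S E}. (if k = j then 1 else 0) * face_weight E (\<lambda>_. 1) k) = flux E (snap S E j)"
      unfolding flux_def by (intro face_integral_const_pieces[symmetric] ntrace_snap E j)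
    finally show ?thesis
      using divergence_snap[OF E j K x] measure_block_pos[OF KE(1)] by (simp add: field_simps)
  qed
  show ?thesis
  proof (rule that[OF s(1)])
    fix v x assume v: "v \<in> snap_local S E" and x: "x \<in> K" "x \<in> cells S"
    obtain c where c: "v = (\<lambda>x. \<Sum>i\<in>{1..nfine S E}. c i *\<^sub>R snap S E i x)"
      using v by (auto simp: snap_local_def lin_span_def)
    have "divergence v x = (\<Sum>i\<in>{1..nfine S E}. c i * divergence (snap S E i) x)"
      unfolding c using snap_vel_h[OF E] x by (intro divergence_lin_comb) auto
    also have "\<dots> = \<sigma> * flux E v / measure lebesgue K"
      unfolding c flux_snap_comb[OF E] sum_distrib_left sum_divide_distrib
      by (intro sum.cong refl) (simp add: snap x)
    finally show "divergence v x = \<sigma> * flux E v / measure lebesgue K" .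
  qed
qed

text \<open>The factor in the definition of \<^const>\<open>C_sup\<close>. For two blocks its inverse square is
  \<open>1 / |K\<^sub>1| + 1 / |K\<^sub>2|\<close>.\<close>

definition block_factor :: "'a set \<Rightarrow> real" where
  "block_factor E = sqrt ((\<Prod>K\<in>blocks S E. measure lebesgue K) / (\<Sum>K\<in>blocks S E. measure lebesgue K))"

lemma block_factor:
  assumes E: "E \<in> interior_faces S"
  shows "0 < block_factor E"
    "(\<Sum>K\<in>blocks S E. 1 / measure lebesgue K) = 1 / (block_factor E)\<^sup>2"
proof -
  obtain K K' where K: "blocks S E = {K, K'}" "K \<noteq> K'" "K \<in> coarse_grid S" "K' \<in> coarse_grid S"
    using interior_facesD[OF E] by metis
  define a b where "a = measure lebesgue K" and "b = measure lebesgue K'"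
  have ab: "a > 0" "b > 0" using measure_block_pos K by (auto simp: a_def b_def)
  have g: "block_factor E = sqrt (a * b / (a + b))" using K by (simp add: block_factor_def a_def b_def)
  show "0 < block_factor E" using ab by (simp add: g)
  have g2: "(block_factor E)\<^sup>2 = a * b / (a + b)" using ab by (simp add: g)
  have "(\<Sum>K\<in>blocks S E. 1 / measure lebesgue K) = 1 / a + 1 / b"
    using K by (simp add: a_def b_def)
  also have "\<dots> = 1 / (block_factor E)\<^sup>2"
    unfolding g2 using ab by (simp add: field_simps)
  finally show "(\<Sum>K\<in>blocks S E. 1 / measure lebesgue K) = 1 / (block_factor E)\<^sup>2" .
qed

text \<open>The \<open>L\<^sup>2\<close> norm of the divergence over the neighborhood of \<open>E\<close>.\<close>

definition div_norm :: "'a set \<Rightarrow> ('a \<Rightarrow> 'a) \<Rightarrow> real" where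
  "div_norm E v = sqrt (LINT x:nbhd S E|lebesgue. (divergence v x)\<^sup>2)"

lemma blocks_subset: "blocks S E \<subseteq> coarse_grid S"
  by (auto simp: blocks_def)

lemma abs_flux_eq:
  assumes E: "E \<in> interior_faces S" and v: "v \<in> snap_local S E"
  shows "\<bar>flux E v\<bar> = block_factor E * div_norm E v"
proof -
  have Ef: "E \<in> faces (coarse_grid S)" using E by (simp add: interior_faces_def)
  have "(LINT x:nbhd S E|lebesgue. (divergence v x)\<^sup>2)
      = (\<Sum>K\<in>blocks S E. LINT x:K|lebesgue. (divergence v x)\<^sup>2)"
    unfolding nbhd_def using pw_continuous_snap_local[OF Ef v] blocks_subset region_block
    by (intro set_integral_Union_blocks set_integrable_pw_continuous pw_continuous_intros) auto
  also have "\<dots> = (\<Sum>K\<in>blocks S E. (flux E v)\<^sup>2 * (1 / measure lebesgue K))"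
  proof (rule sum.cong[OF refl])
    fix K assume K: "K \<in> blocks S E"
    then have Kc: "K \<in> coarse_grid S" using blocks_subset by blast
    obtain \<sigma> :: real where s: "\<bar>\<sigma>\<bar> = 1"
      "\<And>x. x \<in> K \<Longrightarrow> x \<in> cells S \<Longrightarrow> divergence v x = \<sigma> * flux E v / measure lebesgue K"
      using divergence_snap_local[OF Ef K] v by metis
    have "(LINT x:K|lebesgue. (divergence v x)\<^sup>2) = (LINT x:K|lebesgue. (\<sigma> * flux E v / measure lebesgue K)\<^sup>2)"
      using s(2) by (intro set_integral_cells_cong region_block Kc) auto
    also have "\<dots> = (\<sigma> * flux E v / measure lebesgue K)\<^sup>2 * measure lebesgue K"
      by (rule set_integral_const_block[OF Kc])
    also have "\<sigma>\<^sup>2 = 1" using s(1) by (metis one_power2 power2_abs)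
    then have "(\<sigma> * flux E v / measure lebesgue K)\<^sup>2 * measure lebesgue K = (flux E v)\<^sup>2 * (1 / measure lebesgue K)"
      using measure_block_pos[OF Kc] by (simp add: power_mult_distrib power_divide) (simp add: power2_eq_square)
    finally show "(LINT x:K|lebesgue. (divergence v x)\<^sup>2) = (flux E v)\<^sup>2 * (1 / measure lebesgue K)" .
  qed
  also have "\<dots> = (flux E v)\<^sup>2 / (block_factor E)\<^sup>2"
    unfolding sum_distrib_left[symmetric] block_factor(2)[OF E] by simp
  finally have "div_norm E v = \<bar>flux E v\<bar> / block_factor E"
    using block_factor(1)[OF E] by (simp add: div_norm_def real_sqrt_divide)
  then show ?thesis using block_factor(1)[OF E] by simp
qed

text \<open>The multiplier \<open>\<beta>\<close> is, up to sign, the jump of the pressure across an interior face.\<close>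

lemma dform_pres_H_flux:
  assumes E: "E \<in> faces (coarse_grid S)" and p: "p \<in> pres_H S"
  obtains \<beta> where "\<And>v. v \<in> snap_local S E \<Longrightarrow> dform (nbhd S E) v p = \<beta> * flux E v"
proof -
  have "\<exists>\<beta>. \<forall>v\<in>snap_local S E. (LINT x:K|lebesgue. divergence v x * p x) = \<beta> * flux E v"
    if K: "K \<in> blocks S E" for K
  proof -
    have Kc: "K \<in> coarse_grid S" using blocks_subset K by blast
    obtain \<sigma> :: real where s:
      "\<And>v x. v \<in> snap_local S E \<Longrightarrow> x \<in> K \<Longrightarrow> x \<in> cells S \<Longrightarrow> divergence v x = \<sigma> * flux E v / measure lebesgue K"
      using divergence_snap_local[OF E K] by metis
    obtain c where c: "\<forall>x\<in>interior K. p x = c" using p Kc unfolding pres_H_def by blast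
    show ?thesis
    proof (intro exI ballI)
      fix v assume v: "v \<in> snap_local S E"
      have "(LINT x:K|lebesgue. divergence v x * p x) = (LINT x:K|lebesgue. \<sigma> * flux E v / measure lebesgue K * c)"
        using s[OF v] c cells_Int_block[OF _ Kc] by (intro set_integral_cells_cong region_block Kc) auto
      also have "\<dots> = \<sigma> * flux E v / measure lebesgue K * c * measure lebesgue K"
        by (rule set_integral_const_block[OF Kc])
      also have "\<dots> = \<sigma> * c * flux E v" using measure_block_pos[OF Kc] by simp
      finally show "(LINT x:K|lebesgue. divergence v x * p x) = \<sigma> * c * flux E v" .
    qed
  qed
  then obtain \<beta> where b: "\<And>K v. K \<in> blocks S E \<Longrightarrow> v \<in> snap_local S E \<Longrightarrow>
      (LINT x:K|lebesgue. divergence v x * p x) = \<beta> K * flux E v"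
    by metis
  show ?thesis
  proof (rule that)
    fix v assume v: "v \<in> snap_local S E"
    have "dform (nbhd S E) v p = (\<Sum>K\<in>blocks S E. LINT x:K|lebesgue. divergence v x * p x)"
      unfolding nbhd_def dform_def
      using pw_continuous_snap_local[OF E v] blocks_subset region_block pw_continuous_pres_H[OF p]
      by (intro set_integral_Union_blocks set_integrable_pw_continuous pw_continuous_intros) auto
    also have "\<dots> = (\<Sum>K\<in>blocks S E. \<beta> K) * flux E v"
      using b v by (simp add: sum_distrib_right)
    finally show "dform (nbhd S E) v p = (\<Sum>K\<in>blocks S E. \<beta> K) * flux E v" .
  qed
qed

lemma dform_flow_dom_nbhd:
  assumes E: "E \<in> faces (coarse_grid S)" and v: "v \<in> snap_local S E"
  shows "dform (flow_dom S) v p = dform (nbhd S E) v p"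
  unfolding dform_def using snap_local_outside(2)[OF E v] cells_subset_flow_dom
  by (intro set_integral_cells_cong region_flow_dom region_nbhd) auto

lemma wform_flow_dom_nbhd:
  assumes E: "E \<in> faces (coarse_grid S)" and v: "v \<in> snap_local S E"
  shows "wform S (flow_dom S) u v = wform S (nbhd S E) u v"
  unfolding wform_def using snap_local_outside(1)[OF E v] cells_subset_flow_dom
  by (intro set_integral_cells_cong region_flow_dom region_nbhd) auto

lemma hdiv_norm_eq:
  assumes "E \<in> faces (coarse_grid S)" "v \<in> snap_local S E"
  shows "hdiv_norm S (nbhd S E) v = sqrt ((wnorm S (nbhd S E) v)\<^sup>2 + (div_norm E v)\<^sup>2)"
proof -
  have "0 \<le> (LINT x:nbhd S E|lebesgue. (divergence v x)\<^sup>2)"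
    by (rule set_lebesgue_integral_nonneg) simp
  then show ?thesis
    by (simp add: hdiv_norm_def div_norm_def wnorm_power2[OF region_nbhd] wform_def power2_norm_eq_inner)
qed

end

section \<open>Residuals of successive multiscale solutions\<close>

lemma sum_space_mono:
  assumes "\<And>i. i \<in> I \<Longrightarrow> V i \<subseteq> W i" shows "sum_space I V \<subseteq> sum_space I W"
  unfolding sum_space_def using assms by blast

lemma sum_space_diff:
  assumes diff: "\<And>i f g. i \<in> I \<Longrightarrow> f \<in> V i \<Longrightarrow> g \<in> V i \<Longrightarrow> (\<lambda>x. f x - g x) \<in> V i"
    and "f \<in> sum_space I V" "g \<in> sum_space I V"
  shows "(\<lambda>x. f x - g x) \<in> sum_space I V"
proof -
  obtain a b where "\<forall>i\<in>I. a i \<in> V i" "f = (\<lambda>x. \<Sum>i\<in>I. a i x)" "\<forall>i\<in>I. b i \<in> V i" "g = (\<lambda>x. \<Sum>i\<in>I. b i x)"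
    using assms unfolding sum_space_def by blast
  then show ?thesis
    unfolding sum_space_def
    by (intro CollectI exI[of _ "\<lambda>i x. a i x - b i x"]) (simp add: diff sum_subtractf)
qed

lemma sum_space_component:
  assumes "finite I" "i \<in> I" "f \<in> V i" and zero: "\<And>i. i \<in> I \<Longrightarrow> (\<lambda>_. 0) \<in> V i"
  shows "f \<in> sum_space I V"
proof -
  have "f x = (\<Sum>j\<in>I. (if j = i then f else (\<lambda>_. 0)) x)" for x
  proof -
    have "(\<Sum>j\<in>I. (if j = i then f else (\<lambda>_. 0)) x) = (\<Sum>j\<in>I. if j = i then f x else 0)"
      by (intro sum.cong) auto
    then show ?thesis using assms by simp
  qed
  then show ?thesis
    unfolding sum_space_def using assms(3) zero
    by (intro CollectI exI[of _ "\<lambda>j. if j = i then f else (\<lambda>_. 0)"]) auto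
qed

lemma add_le_sqrt2:
  fixes a c :: real
  shows "a + c \<le> sqrt 2 * sqrt (a\<^sup>2 + c\<^sup>2)"
proof -
  have "(a + c)\<^sup>2 \<le> 2 * (a\<^sup>2 + c\<^sup>2)"
    using zero_le_power2[of "a - c"] by (simp add: power2_eq_square algebra_simps)
  then show ?thesis unfolding real_sqrt_mult[symmetric] by (rule real_le_rsqrt)
qed

lemma power2_add_le_weighted:
  fixes a b \<alpha> :: real
  assumes "0 < \<alpha>"
  shows "(a + b)\<^sup>2 \<le> (1 + \<alpha>) * a\<^sup>2 + (1 + inverse \<alpha>) * b\<^sup>2"
proof -
  have "0 \<le> (\<alpha> * a - b)\<^sup>2 / \<alpha>" using assms by simp
  also have "\<dots> = \<alpha> * a\<^sup>2 - 2 * a * b + inverse \<alpha> * b\<^sup>2"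
    using assms by (simp add: field_simps power2_eq_square)
  finally show ?thesis by (simp add: power2_eq_square algebra_simps)
qed

context gms_method
begin

lemma spectral:
  assumes "E \<in> faces (coarse_grid S)"
  shows "lin_span {1..nfine S E} (eigfun S E) = snap_local S E"
    "\<And>j k. 1 \<le> j \<Longrightarrow> j \<le> k \<Longrightarrow> k \<le> nfine S E \<Longrightarrow> eigval S E j \<le> eigval S E k"
    "\<And>j. j \<in> {1..nfine S E} \<Longrightarrow> eigfun S E j \<in> snap_local S E"
    "\<And>j. j \<in> {1..nfine S E} \<Longrightarrow> eigfun S E j \<noteq> (\<lambda>_. 0)"
proof -
  have "spectral_problem S E" using setting assms by (auto simp: gms_setting_def)
  note * = this[unfolded spectral_problem_def]
  show "lin_span {1..nfine S E} (eigfun S E) = snap_local S E" using * by (elim conjE)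
  show "\<And>j k. 1 \<le> j \<Longrightarrow> j \<le> k \<Longrightarrow> k \<le> nfine S E \<Longrightarrow> eigval S E j \<le> eigval S E k"
    using conjunct1[OF conjunct2[OF *]] by blast
  show "\<And>j. j \<in> {1..nfine S E} \<Longrightarrow> eigfun S E j \<in> snap_local S E"
    and "\<And>j. j \<in> {1..nfine S E} \<Longrightarrow> eigfun S E j \<noteq> (\<lambda>_. 0)"
    using conjunct1[OF *] by blast+
qed

lemma ms_local_mono: "l E \<le> l' E \<Longrightarrow> ms_local S l E \<subseteq> ms_local S l' E"
  unfolding ms_local_def by (intro lin_span_mono) auto

lemma ms_local_subset:
  assumes "E \<in> faces (coarse_grid S)" "l E \<le> nfine S E"
  shows "ms_local S l E \<subseteq> snap_local S E"
  unfolding ms_local_def spectral(1)[OF assms(1), symmetric] using assms(2)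
  by (intro lin_span_mono) auto

lemma snap_space_vel_h: "snap_space S \<subseteq> vel_h S"
  unfolding snap_space_def sum_space_def using snap_local_vel_h by (auto intro!: vel_h_sum)

text \<open>The increment between nested multiscale solutions is an admissible test field whose
  divergence is orthogonal to all coarse pressures.\<close>

lemma galerkin_orthogonality:
  assumes l: "\<And>E. E \<in> faces (coarse_grid S) \<Longrightarrow> l E \<le> l' E"
    and l': "\<And>E. E \<in> faces (coarse_grid S) \<Longrightarrow> l' E \<le> nfine S E"
    and u: "discrete_solution S (snap_space S) u r"
    and v: "discrete_solution S (ms_space S l) v p"
    and w: "discrete_solution S (ms_space S l') w q"
  shows "(wnorm S (flow_dom S) (\<lambda>x. u x - v x))\<^sup>2
    = (wnorm S (flow_dom S) (\<lambda>x. u x - w x))\<^sup>2 + (wnorm S (flow_dom S) (\<lambda>x. w x - v x))\<^sup>2"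
proof -
  let ?D = "flow_dom S" and ?\<delta> = "\<lambda>x. w x - v x"
  have VW: "ms_space S l \<subseteq> ms_space S l'"
    unfolding ms_space_def by (intro sum_space_mono ms_local_mono l)
  have WS: "ms_space S l' \<subseteq> snap_space S"
    unfolding ms_space_def snap_space_def by (intro sum_space_mono ms_local_subset l')
  have in_W: "v \<in> ms_space S l'" "w \<in> ms_space S l'"
    using v w VW by (auto simp: discrete_solution_def)
  then have vel: "u \<in> vel_h S" "v \<in> vel_h S" "w \<in> vel_h S"
    using u WS snap_space_vel_h by (auto simp: discrete_solution_def)
  have dW: "?\<delta> \<in> ms_space S l'"
    using in_W unfolding ms_space_def ms_local_def by (intro sum_space_diff lin_span_diff)
  have dS: "?\<delta> \<in> snap_space S" using dW WS by blast
  have dvel: "?\<delta> \<in> vel_h S" using vel by (intro vel_h_diff)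
  have b: "bdry_trace S ?\<delta> (\<lambda>_. 0)"
    using v w vel by (intro bdry_trace_diff[of _ _ "bflux_h S"]) (auto simp: discrete_solution_def)
  have div: "dform ?D ?\<delta> s = 0" if s: "s \<in> pres_H S" for s
  proof -
    have int: "set_integrable lebesgue ?D (\<lambda>x. divergence z x * s x)" if "z \<in> vel_h S" for z
      by (intro set_integrable_pw_continuous region_flow_dom pw_continuous_intros
          pw_continuous_divergence that pw_continuous_pres_H s)
    have "dform ?D ?\<delta> s = (LINT x:?D|lebesgue. divergence w x * s x - divergence v x * s x)"
      unfolding dform_def using vel
      by (intro set_integral_cells_cong region_flow_dom)
        (auto simp: divergence_vel_h_diff left_diff_distrib)
    also have "\<dots> = dform ?D w s - dform ?D v s"
      unfolding dform_def by (intro set_integral_diff(2) int vel)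
    also have "\<dots> = 0" using v w s by (simp add: discrete_solution_def)
    finally show ?thesis .
  qed
  have pc: "pw_continuous S u" "pw_continuous S v" "pw_continuous S w" "pw_continuous S ?\<delta>"
    using vel dvel by (auto intro: pw_continuous_vel_h)
  have "wform S ?D u ?\<delta> - dform ?D ?\<delta> r = 0" "r \<in> pres_H S"
    using u dS b unfolding discrete_solution_def by blast+
  moreover have "wform S ?D w ?\<delta> - dform ?D ?\<delta> q = 0" "q \<in> pres_H S"
    using w dW b unfolding discrete_solution_def by blast+
  ultimately have orth: "wform S ?D (\<lambda>x. u x - w x) ?\<delta> = 0"
    using wform_diff_left[OF region_flow_dom pc(1,3,4)] div by simp
  let ?e = "\<lambda>x. u x - w x"
  have pe: "pw_continuous S ?e" using pc by (intro pw_continuous_intros)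
  have pf: "pw_continuous S (\<lambda>x. ?e x + ?\<delta> x)" by (intro pw_continuous_add pe pc)
  note add = wform_add_left[OF region_flow_dom pe pc(4)]
  have "wform S ?D (\<lambda>x. ?e x + ?\<delta> x) (\<lambda>x. ?e x + ?\<delta> x) = wform S ?D ?e ?e + wform S ?D ?\<delta> ?\<delta>"
    unfolding add[OF pf]
    unfolding wform_commute[of S ?D _ "\<lambda>x. ?e x + ?\<delta> x"] add[OF pe] add[OF pc(4)]
    using orth wform_commute[of S ?D ?e ?\<delta>] by simp
  then show ?thesis by (simp add: wnorm_power2[OF region_flow_dom])
qed

lemma flux_scaleR:
  assumes E: "E \<in> faces (coarse_grid S)" and v: "v \<in> snap_local S E"
  shows "flux E (\<lambda>x. r *\<^sub>R v x) = r * flux E v"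
proof -
  obtain c where c: "v = (\<lambda>x. \<Sum>i\<in>{1..nfine S E}. c i *\<^sub>R snap S E i x)"
    using v by (auto simp: snap_local_def lin_span_def)
  have "(\<lambda>x. r *\<^sub>R v x) = (\<lambda>x. \<Sum>i\<in>{1..nfine S E}. (r * c i) *\<^sub>R snap S E i x)"
    by (simp add: c scaleR_sum_right)
  then show ?thesis
    using flux_snap_comb[OF E, of c] flux_snap_comb[OF E, of "\<lambda>i. r * c i"]
    by (simp add: c sum_distrib_left mult.assoc)
qed

lemma unit_flux_exists:
  assumes E: "E \<in> interior_faces S" and l: "l E \<le> nfine S E"
    and ex: "\<exists>v\<in>ms_local S l E. \<exists>x\<in>cells S. divergence v x \<noteq> 0"
  obtains z where "z \<in> ms_local S l E" "flux E z = 1"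
proof -
  have Ef: "E \<in> faces (coarse_grid S)" using E by (simp add: interior_faces_def)
  obtain v x where v: "v \<in> ms_local S l E" and x: "x \<in> cells S" and d: "divergence v x \<noteq> 0"
    using ex by blast
  have vs: "v \<in> snap_local S E" using ms_local_subset[OF Ef] l v by blast
  have "x \<in> nbhd S E" using snap_local_outside(2)[OF Ef vs] d by blast
  then obtain K where K: "K \<in> blocks S E" "x \<in> K" by (auto simp: nbhd_def)
  obtain \<sigma> :: real where "divergence v x = \<sigma> * flux E v / measure lebesgue K"
    using divergence_snap_local[OF Ef K(1)] vs K(2) x by metis
  then have "flux E v \<noteq> 0" using d by auto
  then have "flux E (\<lambda>x. (1 / flux E v) *\<^sub>R v x) = 1"
    using flux_scaleR[OF Ef vs] by simp
  moreover have "(\<lambda>x. (1 / flux E v) *\<^sub>R v x) \<in> ms_local S l E"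
    using v unfolding ms_local_def by (rule lin_span_scaleR)
  ultimately show ?thesis using that by blast
qed

lemma C_sup_eq:
  "C_sup S l E = Inf {block_factor E * wnorm S (nbhd S E) v | v. v \<in> ms_local S l E \<and> flux E v = 1}"
  by (simp add: C_sup_def block_factor_def flux_def)

lemma C_sup_antimono:
  assumes E: "E \<in> interior_faces S" and l: "l E \<le> l' E" "l E \<le> nfine S E"
    and ex: "\<exists>v\<in>ms_local S l E. \<exists>x\<in>cells S. divergence v x \<noteq> 0"
  shows "C_sup S l' E \<le> C_sup S l E"
  unfolding C_sup_eq
proof (rule cInf_superset_mono)
  show "{block_factor E * wnorm S (nbhd S E) v |v. v \<in> ms_local S l E \<and> flux E v = 1} \<noteq> {}"
    using unit_flux_exists[OF E l(2) ex] by auto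
  show "bdd_below {block_factor E * wnorm S (nbhd S E) v |v. v \<in> ms_local S l' E \<and> flux E v = 1}"
    using block_factor(1)[OF E] wnorm_nonneg[OF region_nbhd]
    by (intro bdd_belowI[of _ 0]) (auto intro!: mult_nonneg_nonneg)
  show "{block_factor E * wnorm S (nbhd S E) v |v. v \<in> ms_local S l E \<and> flux E v = 1}
    \<subseteq> {block_factor E * wnorm S (nbhd S E) v |v. v \<in> ms_local S l' E \<and> flux E v = 1}"
    using ms_local_mono[of l E l', OF l(1)] by auto
qed

lemma div_norm_nonneg: "0 \<le> div_norm E v"
  unfolding div_norm_def by (simp add: set_lebesgue_integral_nonneg)

text \<open>Testing both discrete problems with a field of unit flux through \<open>E\<close> controls the change of
  the pressure jump across \<open>E\<close> by the change of the velocity near \<open>E\<close>.\<close>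

lemma residual_change:
  assumes E: "E \<in> interior_faces S"
    and l: "\<And>E. E \<in> faces (coarse_grid S) \<Longrightarrow> l E \<le> l' E"
    and l': "\<And>E. E \<in> faces (coarse_grid S) \<Longrightarrow> l' E \<le> nfine S E"
    and v: "discrete_solution S (ms_space S l) v p"
    and w: "discrete_solution S (ms_space S l') w q"
    and ex: "\<exists>v\<in>ms_local S l E. \<exists>x\<in>cells S. divergence v x \<noteq> 0"
    and z: "z \<in> snap_local S E"
  shows "\<bar>residual S E w q z - residual S E v p z\<bar>
    \<le> sqrt 2 * max (C_sup S l E) 1 * wnorm S (nbhd S E) (\<lambda>x. w x - v x) * hdiv_norm S (nbhd S E) z"
proof -
  let ?N = "nbhd S E" and ?\<delta> = "\<lambda>x. w x - v x" and ?G = "block_factor E"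
  define d where "d = wnorm S ?N ?\<delta>"
  have Ef: "E \<in> faces (coarse_grid S)" using E by (simp add: interior_faces_def)
  have lE: "l E \<le> nfine S E" using l[OF Ef] l'[OF Ef] by simp
  have d0: "d \<ge> 0" unfolding d_def by (rule wnorm_nonneg[OF region_nbhd])
  have WS: "ms_space S l' \<subseteq> snap_space S"
    unfolding ms_space_def snap_space_def by (intro sum_space_mono ms_local_subset l')
  have VW: "ms_space S l \<subseteq> ms_space S l'"
    unfolding ms_space_def by (intro sum_space_mono ms_local_mono l)
  have vel: "v \<in> vel_h S" "w \<in> vel_h S" and pH: "p \<in> pres_H S" "q \<in> pres_H S"
    using v w VW WS snap_space_vel_h by (auto simp: discrete_solution_def)
  have pc: "pw_continuous S v" "pw_continuous S w" "pw_continuous S ?\<delta>"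
    using vel by (auto intro: pw_continuous_vel_h vel_h_diff)
  obtain \<beta>p where bp: "\<And>z. z \<in> snap_local S E \<Longrightarrow> dform ?N z p = \<beta>p * flux E z"
    using dform_pres_H_flux[OF Ef pH(1)] by metis
  obtain \<beta>q where bq: "\<And>z. z \<in> snap_local S E \<Longrightarrow> dform ?N z q = \<beta>q * flux E z"
    using dform_pres_H_flux[OF Ef pH(2)] by metis
  define b where "b = \<beta>q - \<beta>p"
  \<comment> \<open>The field \<open>y\<close> is admissible in both problems; subtract the two equations.\<close>
  have jump: "\<bar>b\<bar> \<le> d * wnorm S ?N y" if y: "y \<in> ms_local S l E" "flux E y = 1" for y
  proof -
    have ys: "y \<in> snap_local S E" using ms_local_subset[of E l, OF Ef lE] y(1) by blast
    have yV: "y \<in> ms_space S l"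
      unfolding ms_space_def using coarse.finite_faces Ef y(1)
      by (rule sum_space_component) (simp add: ms_local_def lin_span_zero)
    then have yW: "y \<in> ms_space S l'" using VW by blast
    have bt: "bdry_trace S y (\<lambda>_. 0)" by (rule bdry_trace_snap_local[OF E ys])
    have "wform S (flow_dom S) v y - dform (flow_dom S) y p = 0"
      "wform S (flow_dom S) w y - dform (flow_dom S) y q = 0"
      using v w yV yW bt unfolding discrete_solution_def by blast+
    then have "wform S ?N w y - wform S ?N v y = b"
      by (simp add: wform_flow_dom_nbhd[OF Ef ys] dform_flow_dom_nbhd[OF Ef ys] bp[OF ys] bq[OF ys] b_def y(2))
    then have "wform S ?N ?\<delta> y = b"
      using wform_diff_left[OF region_nbhd pc(2,1) pw_continuous_snap_local(1)[OF Ef ys]] by simp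
    then show ?thesis
      using wform_Cauchy_Schwarz[OF region_nbhd[of E] pc(3) pw_continuous_snap_local(1)[OF Ef ys]]
      by (simp add: d_def)
  qed
  \<comment> \<open>Take the infimum over \<open>y\<close>. For \<open>d = 0\<close> division is impossible, but then \<open>b = 0\<close>.\<close>
  have bG: "\<bar>b\<bar> * ?G \<le> C_sup S l E * d"
  proof (cases "d = 0")
    case True
    obtain y where "y \<in> ms_local S l E" "flux E y = 1" using unit_flux_exists[OF E lE ex] .
    then show ?thesis using jump[of y] True by simp
  next
    case False
    then have dpos: "d > 0" using d0 by simp
    have "\<bar>b\<bar> * ?G / d \<le> C_sup S l E"
      unfolding C_sup_eq
    proof (rule cInf_greatest)
      show "{?G * wnorm S ?N v |v. v \<in> ms_local S l E \<and> flux E v = 1} \<noteq> {}"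
        using unit_flux_exists[OF E lE ex] by auto
      fix s assume "s \<in> {?G * wnorm S ?N v |v. v \<in> ms_local S l E \<and> flux E v = 1}"
      then obtain y where y: "s = ?G * wnorm S ?N y" "y \<in> ms_local S l E" "flux E y = 1" by auto
      have "\<bar>b\<bar> * ?G \<le> (d * wnorm S ?N y) * ?G"
        using jump[OF y(2,3)] block_factor(1)[OF E] by (intro mult_right_mono) auto
      then show "\<bar>b\<bar> * ?G / d \<le> s" using dpos y(1) by (simp add: field_simps)
    qed
    then show ?thesis using dpos by (simp add: field_simps)
  qed
  define m where "m = max (C_sup S l E) 1"
  have m: "1 \<le> m" "C_sup S l E \<le> m" by (auto simp: m_def)
  define a c where "a = wnorm S ?N z" and "c = div_norm E z"
  have ac: "a \<ge> 0" "c \<ge> 0"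
    using wnorm_nonneg[OF region_nbhd] div_norm_nonneg by (auto simp: a_def c_def)
  have pz: "pw_continuous S z" by (rule pw_continuous_snap_local(1)[OF Ef z])
  have "residual S E w q z - residual S E v p z = wform S ?N ?\<delta> z - b * flux E z"
    by (simp add: residual_def bp[OF z] bq[OF z] b_def wform_diff_left[OF region_nbhd pc(2,1) pz]
        left_diff_distrib)
  also have "\<bar>\<dots>\<bar> \<le> \<bar>wform S ?N ?\<delta> z\<bar> + \<bar>b\<bar> * \<bar>flux E z\<bar>"
    using abs_triangle_ineq4[of "wform S ?N ?\<delta> z" "b * flux E z"] by (simp add: abs_mult)
  also have "\<dots> \<le> d * a + (\<bar>b\<bar> * ?G) * c"
    using wform_Cauchy_Schwarz[OF region_nbhd[of E] pc(3) pz] abs_flux_eq[OF E z]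
    by (simp add: d_def a_def c_def)
  also have "\<dots> \<le> (m * d) * a + (m * d) * c"
  proof (rule add_mono)
    have "1 * d \<le> m * d" using m d0 by (intro mult_right_mono) auto
    then show "d * a \<le> m * d * a" using ac by (intro mult_right_mono) auto
    have "C_sup S l E * d \<le> m * d" using m d0 by (intro mult_right_mono) auto
    then have "\<bar>b\<bar> * ?G \<le> m * d" using bG by simp
    then show "\<bar>b\<bar> * ?G * c \<le> m * d * c" using ac by (intro mult_right_mono) auto
  qed
  also have "\<dots> = (m * d) * (a + c)" by (simp add: distrib_left)
  also have "\<dots> \<le> (m * d) * (sqrt 2 * sqrt (a\<^sup>2 + c\<^sup>2))"
    using m d0 by (intro mult_left_mono add_le_sqrt2) auto
  also have "\<dots> = sqrt 2 * m * d * hdiv_norm S ?N z"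
    by (simp add: hdiv_norm_eq[OF Ef z] a_def c_def)
  finally show ?thesis by (simp add: m_def d_def)
qed

text \<open>A residual is bounded on the local snapshot space, so that the supremum in
  \<^const>\<open>residual_norm\<close> is a genuine one.\<close>

lemma residual_bounded:
  assumes E: "E \<in> interior_faces S" and v: "v \<in> vel_h S" and p: "p \<in> pres_H S"
  obtains B where "\<And>z. z \<in> snap_local S E \<Longrightarrow> \<bar>residual S E v p z\<bar> \<le> B * hdiv_norm S (nbhd S E) z"
proof -
  let ?N = "nbhd S E"
  have Ef: "E \<in> faces (coarse_grid S)" using E by (simp add: interior_faces_def)
  obtain \<beta> where b: "\<And>z. z \<in> snap_local S E \<Longrightarrow> dform ?N z p = \<beta> * flux E z"
    using dform_pres_H_flux[OF Ef p] by metis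
  show ?thesis
  proof (rule that)
    fix z assume z: "z \<in> snap_local S E"
    let ?h = "hdiv_norm S ?N z"
    have h: "wnorm S ?N z \<le> ?h" "div_norm E z \<le> ?h"
      using wnorm_nonneg[OF region_nbhd] div_norm_nonneg
      by (auto simp: hdiv_norm_eq[OF Ef z] intro!: real_le_rsqrt)
    have "\<bar>residual S E v p z\<bar> \<le> \<bar>wform S ?N v z\<bar> + \<bar>\<beta>\<bar> * \<bar>flux E z\<bar>"
      using abs_triangle_ineq4[of "wform S ?N v z" "\<beta> * flux E z"]
      by (simp add: residual_def b[OF z] abs_mult)
    also have "\<dots> \<le> wnorm S ?N v * wnorm S ?N z + \<bar>\<beta>\<bar> * (block_factor E * div_norm E z)"
      using wform_Cauchy_Schwarz[OF region_nbhd[of E] pw_continuous_vel_h[OF v] pw_continuous_snap_local(1)[OF Ef z]]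
      by (simp add: abs_flux_eq[OF E z])
    also have "\<dots> \<le> wnorm S ?N v * ?h + \<bar>\<beta>\<bar> * (block_factor E * ?h)"
      using h wnorm_nonneg[OF region_nbhd[of E], of v] block_factor(1)[OF E]
      by (intro add_mono mult_left_mono) auto
    also have "\<dots> = (wnorm S ?N v + \<bar>\<beta>\<bar> * block_factor E) * ?h" by (simp add: algebra_simps)
    finally show "\<bar>residual S E v p z\<bar> \<le> (wnorm S ?N v + \<bar>\<beta>\<bar> * block_factor E) * ?h" .
  qed
qed

lemma hdiv_norm_nonneg: "0 \<le> hdiv_norm S (nbhd S E) z"
proof -
  have "0 \<le> (LINT x:nbhd S E|lebesgue. inverse (perm S x) * (norm (z x))\<^sup>2)"
    using wform_nonneg[OF region_nbhd[of E], of z] by (simp add: wform_def power2_norm_eq_inner)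
  moreover have "0 \<le> (LINT x:nbhd S E|lebesgue. (divergence z x)\<^sup>2)"
    by (rule set_lebesgue_integral_nonneg) simp
  ultimately show ?thesis by (simp add: hdiv_norm_def)
qed

lemma residual_quotient_le:
  assumes E: "E \<in> interior_faces S" and v: "v \<in> vel_h S" and p: "p \<in> pres_H S"
    and z: "z \<in> snap_local S E - {\<lambda>_. 0}"
  shows "\<bar>residual S E v p z\<bar> / hdiv_norm S (nbhd S E) z \<le> residual_norm S E v p"
proof -
  obtain B where B: "\<And>z. z \<in> snap_local S E \<Longrightarrow> \<bar>residual S E v p z\<bar> \<le> B * hdiv_norm S (nbhd S E) z"
    using residual_bounded[OF E v p] by metis
  have "\<bar>residual S E v p z\<bar> / hdiv_norm S (nbhd S E) z \<le> \<bar>B\<bar>" if z: "z \<in> snap_local S E" for z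
  proof (cases "hdiv_norm S (nbhd S E) z = 0")
    case False
    then have "hdiv_norm S (nbhd S E) z > 0" using hdiv_norm_nonneg[of E z] by simp
    then have "\<bar>residual S E v p z\<bar> / hdiv_norm S (nbhd S E) z \<le> B"
      using B[OF z] by (simp add: field_simps)
    then show ?thesis by simp
  qed simp
  then have "bdd_above ((\<lambda>w. \<bar>residual S E v p w\<bar> / hdiv_norm S (nbhd S E) w) ` (snap_local S E - {\<lambda>_. 0}))"
    by (intro bdd_aboveI[of _ "\<bar>B\<bar>"]) auto
  then show ?thesis unfolding residual_norm_def by (rule cSUP_upper[OF z])
qed

lemma nonzero_snap_local:
  assumes "E \<in> faces (coarse_grid S)" "0 < nfine S E"
  obtains z where "z \<in> snap_local S E - {\<lambda>_. 0}"
proof -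
  have "(1::nat) \<in> {1..nfine S E}" using assms(2) by simp
  then show ?thesis using that[of "eigfun S E 1"] spectral(3,4)[OF assms(1)] by simp
qed

lemma residual_norm_nonneg:
  assumes E: "E \<in> interior_faces S" "0 < nfine S E" and v: "v \<in> vel_h S" and p: "p \<in> pres_H S"
  shows "0 \<le> residual_norm S E v p"
proof -
  obtain z where z: "z \<in> snap_local S E - {\<lambda>_. 0}"
    using nonzero_snap_local E by (auto simp: interior_faces_def)
  have "0 \<le> \<bar>residual S E v p z\<bar> / hdiv_norm S (nbhd S E) z" using hdiv_norm_nonneg by simp
  also have "\<dots> \<le> residual_norm S E v p" by (rule residual_quotient_le[OF E(1) v p z])
  finally show ?thesis .
qed

lemma residual_norm_change:
  assumes E: "E \<in> interior_faces S" "0 < nfine S E"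
    and v: "v \<in> vel_h S" and p: "p \<in> pres_H S" and c: "0 \<le> c"
    and change: "\<And>z. z \<in> snap_local S E \<Longrightarrow>
      \<bar>residual S E w q z - residual S E v p z\<bar> \<le> c * hdiv_norm S (nbhd S E) z"
  shows "residual_norm S E w q \<le> residual_norm S E v p + c"
  unfolding residual_norm_def[of S E w q]
proof (rule cSUP_least)
  show "snap_local S E - {\<lambda>_. 0} \<noteq> {}"
    using nonzero_snap_local[of E] E by (auto simp: interior_faces_def)
  fix z assume z: "z \<in> snap_local S E - {\<lambda>_. 0}"
  let ?h = "hdiv_norm S (nbhd S E) z"
  show "\<bar>residual S E w q z\<bar> / ?h \<le> residual_norm S E v p + c"
  proof (cases "?h = 0")
    case True
    then show ?thesis using residual_norm_nonneg[OF E v p] c by simp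
  next
    case False
    then have h: "?h > 0" using hdiv_norm_nonneg[of E z] by simp
    have "\<bar>residual S E w q z\<bar> \<le> \<bar>residual S E v p z\<bar> + c * ?h"
      using change[of z] z by auto
    then have "\<bar>residual S E w q z\<bar> / ?h \<le> \<bar>residual S E v p z\<bar> / ?h + c"
      using h by (simp add: field_simps)
    then show ?thesis using residual_quotient_le[OF E(1) v p z] by simp
  qed
qed

lemma err_indicator_power2:
  assumes "E \<in> interior_faces S" "l E < nfine S E"
  shows "(err_indicator S l v p E)\<^sup>2 = (residual_norm S E v p)\<^sup>2 / eigval S E (l E + 1)"
proof -
  define x where "x = eigval S E (l E + 1)"
  have "0 < x"
    unfolding x_def using assms by (intro eigval_pos) (auto simp: interior_faces_def)
  have "(x powr (- 1 / 2))\<^sup>2 = x powr (- 1 / 2 + - 1 / 2)"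
    unfolding power2_eq_square by (rule powr_add[symmetric])
  also have "\<dots> = inverse x"
    using \<open>0 < x\<close> by (simp add: powr_minus)
  finally have sq: "(x powr (- 1 / 2))\<^sup>2 = inverse x" .
  show ?thesis
    unfolding err_indicator_def power_mult_distrib x_def[symmetric] sq by (simp only: divide_inverse)
qed

lemma err_indicator_step:
  assumes E: "E \<in> interior_faces S"
    and l: "\<And>E. E \<in> faces (coarse_grid S) \<Longrightarrow> l E \<le> l' E"
    and l': "\<And>E. E \<in> faces (coarse_grid S) \<Longrightarrow> l' E \<le> nfine S E" and l'E: "l' E < nfine S E"
    and v: "discrete_solution S (ms_space S l) v p"
    and w: "discrete_solution S (ms_space S l') w q"
    and ex: "\<exists>v\<in>ms_local S l E. \<exists>x\<in>cells S. divergence v x \<noteq> 0"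
    and \<alpha>: "0 < \<alpha>"
  shows "(err_indicator S l' w q E)\<^sup>2
    \<le> (1 + \<alpha>) * (eigval S E (l E + 1) / eigval S E (l' E + 1) * (err_indicator S l v p E)\<^sup>2)
      + (1 + inverse \<alpha>) * (2 * inverse (eigval S E (l' E + 1)) * (max (C_sup S l E) 1)\<^sup>2
          * wform S (nbhd S E) (\<lambda>x. w x - v x) (\<lambda>x. w x - v x))"
proof -
  have Ef: "E \<in> faces (coarse_grid S)" using E by (simp add: interior_faces_def)
  have lE: "l E < nfine S E" using l[OF Ef] l'E by simp
  define ev ev' where "ev = eigval S E (l E + 1)" and "ev' = eigval S E (l' E + 1)"
  have lam: "0 < ev" "0 < ev'" using lE l'E by (auto simp: ev_def ev'_def intro!: eigval_pos[OF Ef])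
  have "ms_space S l \<subseteq> snap_space S"
    unfolding ms_space_def snap_space_def
    by (intro sum_space_mono ms_local_subset) (use l l' le_trans in blast)+
  then have vel: "v \<in> vel_h S" and p: "p \<in> pres_H S"
    using v snap_space_vel_h by (auto simp: discrete_solution_def)
  define m d where "m = max (C_sup S l E) 1" and "d = wnorm S (nbhd S E) (\<lambda>x. w x - v x)"
  have d2: "d\<^sup>2 = wform S (nbhd S E) (\<lambda>x. w x - v x) (\<lambda>x. w x - v x)"
    unfolding d_def by (rule wnorm_power2[OF region_nbhd])
  have md: "0 \<le> sqrt 2 * m * d"
    using wnorm_nonneg[OF region_nbhd] by (auto simp: m_def d_def intro!: mult_nonneg_nonneg)
  have n: "0 < nfine S E" using lE by simp
  define r r' where "r = residual_norm S E v p" and "r' = residual_norm S E w q"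
  have le: "r' \<le> r + sqrt 2 * m * d"
    unfolding r_def r'_def
    by (rule residual_norm_change[OF E n vel p md])
      (use residual_change[OF E l l' v w ex] in \<open>auto simp: m_def d_def\<close>)
  have velw: "w \<in> vel_h S" and q: "q \<in> pres_H S"
    using w snap_space_vel_h sum_space_mono[of "faces (coarse_grid S)" "ms_local S l'" "snap_local S"]
      ms_local_subset l' unfolding discrete_solution_def ms_space_def snap_space_def by blast+
  have "0 \<le> r'" unfolding r'_def by (rule residual_norm_nonneg[OF E n velw q])
  then have "r'\<^sup>2 \<le> (r + sqrt 2 * m * d)\<^sup>2" using le by (intro power_mono)
  also have "\<dots> \<le> (1 + \<alpha>) * r\<^sup>2 + (1 + inverse \<alpha>) * (sqrt 2 * m * d)\<^sup>2"
    by (rule power2_add_le_weighted[OF \<alpha>])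
  finally have "r'\<^sup>2 / ev' \<le> ((1 + \<alpha>) * r\<^sup>2 + (1 + inverse \<alpha>) * (sqrt 2 * m * d)\<^sup>2) / ev'"
    using lam by (intro divide_right_mono) auto
  also have "\<dots> = (1 + \<alpha>) * (ev / ev' * (r\<^sup>2 / ev)) + (1 + inverse \<alpha>) * (2 * inverse ev' * m\<^sup>2 * d\<^sup>2)"
    using lam by (simp add: power_mult_distrib field_simps)
  finally show ?thesis
    unfolding err_indicator_power2[of E l, OF E lE] err_indicator_power2[of E l', OF E l'E]
      d2[symmetric]
    by (simp add: r_def r'_def ev_def ev'_def m_def)
qed

end

section \<open>Marking and contraction\<close>

lemma marked_bulk:
  fixes \<eta> :: "'i \<Rightarrow> real"
  assumes m: "marked \<theta> A \<eta> X" and A: "finite A" and \<theta>: "0 < \<theta>" "\<theta> < 1"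
  shows "X \<subseteq> A" "\<theta>\<^sup>2 * (\<Sum>i\<in>A. (\<eta> i)\<^sup>2) \<le> (\<Sum>i\<in>X. (\<eta> i)\<^sup>2)"
proof -
  define P where "P \<sigma> k \<longleftrightarrow> \<theta>\<^sup>2 * (\<Sum>i\<in>A. (\<eta> i)\<^sup>2) \<le> (\<Sum>a=1..k. (\<eta> (\<sigma> a))\<^sup>2)" for \<sigma> and k :: nat
  obtain \<sigma> where \<sigma>: "bij_betw \<sigma> {1..card A} A" and X: "X = \<sigma> ` {1..(LEAST k. P \<sigma> k)}"
    using m unfolding marked_def P_def by blast
  have "(\<Sum>a=1..card A. (\<eta> (\<sigma> a))\<^sup>2) = (\<Sum>i\<in>A. (\<eta> i)\<^sup>2)"
    using sum.reindex_bij_betw[OF \<sigma>, of "\<lambda>i. (\<eta> i)\<^sup>2"] by simp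
  moreover have "\<theta>\<^sup>2 * (\<Sum>i\<in>A. (\<eta> i)\<^sup>2) \<le> 1 * (\<Sum>i\<in>A. (\<eta> i)\<^sup>2)"
    using \<theta> by (intro mult_right_mono sum_nonneg) (auto simp: power_le_one)
  ultimately have P: "P \<sigma> (card A)" by (simp add: P_def)
  define k where "k = (LEAST k. P \<sigma> k)"
  have k: "k \<le> card A" "P \<sigma> k" using Least_le[of "P \<sigma>", OF P] LeastI[of "P \<sigma>", OF P] by (auto simp: k_def)
  have sub: "{1..k} \<subseteq> {1..card A}" using k by auto
  then show "X \<subseteq> A" using \<sigma> X by (auto simp: k_def bij_betw_def)
  have "inj_on \<sigma> {1..k}" by (rule inj_on_subset[OF bij_betw_imp_inj_on[OF \<sigma>] sub])
  then have "(\<Sum>i\<in>X. (\<eta> i)\<^sup>2) = (\<Sum>a=1..k. (\<eta> (\<sigma> a))\<^sup>2)"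
    unfolding X k_def[symmetric] by (simp add: sum.reindex)
  then show "\<theta>\<^sup>2 * (\<Sum>i\<in>A. (\<eta> i)\<^sup>2) \<le> (\<Sum>i\<in>X. (\<eta> i)\<^sup>2)" using k(2) by (simp add: P_def)
qed

text \<open>Here \<open>e\<close> and \<open>e'\<close> are squared errors, \<open>h\<close> and \<open>h'\<close> sums of squared indicators, at successive
  levels, and \<open>\<Delta>\<close> is the squared norm of the increment.\<close>

lemma contraction_step:
  fixes e e' h h' \<Delta> L Lm C \<rho> :: real
  assumes pyth: "e = e' + \<Delta>" and "0 \<le> \<Delta>" and h': "h' \<le> \<rho> * h + Lm * \<Delta>"
    and L: "Lm \<le> L" "0 < L" and C: "0 \<le> C" "e \<le> C * h" and \<rho>: "\<rho> < 1"
  shows "e' + 1 / L * h' \<le> (C * L + \<rho>) / (C * L + 1) * (e + 1 / L * h)"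
proof -
  have "h' \<le> \<rho> * h + L * \<Delta>"
    using h' mult_right_mono[OF L(1) \<open>0 \<le> \<Delta>\<close>] by simp
  then have "1 / L * h' \<le> 1 / L * (\<rho> * h + L * \<Delta>)" using L by (intro mult_left_mono) auto
  also have "\<dots> = \<rho> * h / L + \<Delta>" using L by (simp add: field_simps)
  finally have 1: "e' + 1 / L * h' \<le> e + \<rho> * h / L" using pyth by simp
  have CL: "0 < C * L + 1" using C L by (simp add: add_nonneg_pos)
  define g where "g = h / L"
  have h: "h = L * g" using L by (simp add: g_def)
  have "(1 - \<rho>) * e \<le> (1 - \<rho>) * (C * h)" using C \<rho> by (intro mult_left_mono) auto
  then have "(C * L + 1) * (e + \<rho> * g) \<le> (C * L + \<rho>) * (e + g)"
    by (simp add: h algebra_simps)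
  then have "(C * L + 1) * (e + \<rho> * h / L) \<le> (C * L + \<rho>) * (e + 1 / L * h)"
    by (simp add: g_def)
  then have "e + \<rho> * h / L \<le> (C * L + \<rho>) / (C * L + 1) * (e + 1 / L * h)"
    using CL by (simp add: pos_le_divide_eq mult.commute)
  then show ?thesis using 1 by simp
qed

section \<open>Runs of the adaptive method\<close>

lemma adaptive_runD:
  assumes run: "adaptive_run S \<theta> \<delta>0 M l sel v p"
  shows "E \<in> faces (coarse_grid S) \<Longrightarrow> l 0 E \<le> nfine S E"
    and "enat m \<le> M \<Longrightarrow> E \<in> interior_faces S \<Longrightarrow> l m E < nfine S E"
    and "enat m \<le> M \<Longrightarrow> discrete_solution S (ms_space S (l m)) (v m) (p m)"
    and "enat m < M \<Longrightarrow> marked \<theta> (interior_faces S) (err_indicator S (l m) (v m) (p m)) (sel m)"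
    and "enat m < M \<Longrightarrow> E \<in> sel m \<Longrightarrow>
      enriched \<delta>0 (nfine S E) (eigval S E) (l m E) (l (Suc m) E)"
    and "enat m < M \<Longrightarrow> E \<in> faces (coarse_grid S) \<Longrightarrow> E \<notin> sel m \<Longrightarrow> l (Suc m) E = l m E"
  using run by (auto simp: adaptive_run_def)

lemma adaptive_run_ratio:
  assumes "adaptive_run S \<theta> \<delta>0 M l sel v p" "enat m < M" "E \<in> sel m"
  shows "eigval S E (l m E + 1) / eigval S E (l (Suc m) E + 1) \<le> \<delta>0"
  using adaptive_runD(5)[OF assms] by (auto simp: enriched_def)

lemma adaptive_run_mono:
  assumes run: "adaptive_run S \<theta> \<delta>0 M l sel v p" and E: "E \<in> faces (coarse_grid S)"
    and jm: "j \<le> m" and m: "enat m \<le> M"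
  shows "l j E \<le> l m E"
  using jm m
proof (induction m rule: dec_induct)
  case (step m)
  have mM: "enat m < M" using step.prems by (simp add: Suc_ile_eq)
  have "l m E \<le> l (Suc m) E"
    using adaptive_runD(5,6)[OF run mM, of E] E by (cases "E \<in> sel m") (auto simp: enriched_def)
  then show ?case using step mM by (meson less_imp_le le_trans)
qed simp

context gms_method
begin

lemma finite_interior_faces: "finite (interior_faces S)"
  using coarse.finite_faces by (simp add: interior_faces_def)

lemma adaptive_run_le_nfine:
  assumes run: "adaptive_run S \<theta> \<delta>0 M l sel v p" and \<theta>: "0 < \<theta>" "\<theta> < 1"
    and E: "E \<in> faces (coarse_grid S)" and m: "enat m \<le> M"
  shows "l m E \<le> nfine S E"
  using m
proof (induction m)
  case 0
  then show ?case using adaptive_runD(1)[OF run E] by simp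
next
  case (Suc m)
  have mM: "enat m < M" using Suc.prems by (simp add: Suc_ile_eq)
  have "sel m \<subseteq> interior_faces S"
    using marked_bulk(1)[OF adaptive_runD(4)[OF run mM] finite_interior_faces \<theta>] .
  then show ?case
    using adaptive_runD(2)[OF run Suc.prems, of E] adaptive_runD(6)[OF run mM E] Suc.IH mM
    by (cases "E \<in> sel m") auto
qed

text \<open>Marking and enrichment reduce the indicators, up to a multiple of the squared increment of the
  velocity: on a selected neighborhood the eigenvalue ratio is at most \<open>\<delta>0\<close>, elsewhere it is one, and
  the selected neighborhoods carry the fraction \<open>\<theta>\<^sup>2\<close> of the sum.\<close>

lemma indicator_sum_step:
  assumes run: "adaptive_run S \<theta> \<delta>0 M l sel v p" and \<theta>: "0 < \<theta>" "\<theta> < 1" and \<delta>0: "\<delta>0 < 1"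
    and mM: "enat m < M" and \<alpha>: "0 < \<alpha>" and ne: "interior_faces S \<noteq> {}"
    and ex: "\<And>E. E \<in> interior_faces S \<Longrightarrow> \<exists>v\<in>ms_local S (l 0) E. \<exists>x\<in>cells S. divergence v x \<noteq> 0"
  defines "ind \<equiv> \<lambda>m. err_indicator S (l m) (v m) (p m)"
    and "D \<equiv> \<lambda>m E. 2 * inverse (eigval S E (l (Suc m) E + 1)) * (max (C_sup S (l m) E) 1)\<^sup>2"
  shows "(\<Sum>E\<in>interior_faces S. (ind (Suc m) E)\<^sup>2)
    \<le> (1 + \<alpha>) * (1 - (1 - \<delta>0) * \<theta>\<^sup>2) * (\<Sum>E\<in>interior_faces S. (ind m E)\<^sup>2)
      + real (max_faces (coarse_grid S)) * (1 + inverse \<alpha>) * Max (D m ` interior_faces S)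
        * (wnorm S (flow_dom S) (\<lambda>x. v (Suc m) x - v m x))\<^sup>2"
proof -
  let ?I = "interior_faces S" and ?\<delta> = "\<lambda>x. v (Suc m) x - v m x"
  have SM: "enat (Suc m) \<le> M" using mM by (simp add: Suc_ile_eq)
  have mM': "enat m \<le> M" using mM by simp
  have fin: "finite ?I" by (rule finite_interior_faces)
  define ratio where "ratio E = eigval S E (l m E + 1) / eigval S E (l (Suc m) E + 1)" for E
  define W where "W E = wform S (nbhd S E) ?\<delta> ?\<delta>" for E
  have mono: "l m E \<le> l (Suc m) E" if "E \<in> faces (coarse_grid S)" for E
    using adaptive_run_mono[OF run that _ SM] by simp
  have bound: "l (Suc m) E \<le> nfine S E" if "E \<in> faces (coarse_grid S)" for E
    using adaptive_run_le_nfine[OF run \<theta> that SM] .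
  have exm: "\<exists>v\<in>ms_local S (l m) E. \<exists>x\<in>cells S. divergence v x \<noteq> 0" if "E \<in> ?I" for E
  proof -
    have "l 0 E \<le> l m E"
      using adaptive_run_mono[OF run _ _ mM', of E 0] that interior_faces_subset by auto
    then show ?thesis using ex[OF that] ms_local_mono[of "l 0" E "l m"] by blast
  qed
  note sols = adaptive_runD(3)[OF run mM'] adaptive_runD(3)[OF run SM]
  have "(ind (Suc m) E)\<^sup>2 \<le> (1 + \<alpha>) * (ratio E * (ind m E)\<^sup>2) + (1 + inverse \<alpha>) * (D m E * W E)"
    if E: "E \<in> ?I" for E
    using err_indicator_step[OF E mono bound adaptive_runD(2)[OF run SM E] sols exm[OF E] \<alpha>]
    by (simp only: ind_def D_def W_def ratio_def)
  then have "(\<Sum>E\<in>?I. (ind (Suc m) E)\<^sup>2)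
      \<le> (\<Sum>E\<in>?I. (1 + \<alpha>) * (ratio E * (ind m E)\<^sup>2) + (1 + inverse \<alpha>) * (D m E * W E))"
    by (rule sum_mono)
  also have "\<dots> = (1 + \<alpha>) * (\<Sum>E\<in>?I. ratio E * (ind m E)\<^sup>2) + (1 + inverse \<alpha>) * (\<Sum>E\<in>?I. D m E * W E)"
    by (simp add: sum.distrib sum_distrib_left)
  also have "\<dots> \<le> (1 + \<alpha>) * ((1 - (1 - \<delta>0) * \<theta>\<^sup>2) * (\<Sum>E\<in>?I. (ind m E)\<^sup>2))
      + (1 + inverse \<alpha>) * (Max (D m ` ?I) * (real (max_faces (coarse_grid S)) * wform S (flow_dom S) ?\<delta> ?\<delta>))"
  proof (intro add_mono mult_left_mono)
    note bulk = marked_bulk[OF adaptive_runD(4)[OF run mM] fin \<theta>]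
    have "ratio E * (ind m E)\<^sup>2 \<le> (ind m E)\<^sup>2 - (if E \<in> sel m then (1 - \<delta>0) * (ind m E)\<^sup>2 else 0)"
      if E: "E \<in> ?I" for E
    proof (cases "E \<in> sel m")
      case True
      have "ratio E \<le> \<delta>0" unfolding ratio_def by (rule adaptive_run_ratio[OF run mM True])
      then have "ratio E * (ind m E)\<^sup>2 \<le> \<delta>0 * (ind m E)\<^sup>2" by (intro mult_right_mono) auto
      then show ?thesis using True by (simp add: algebra_simps)
    next
      case False
      have Ef: "E \<in> faces (coarse_grid S)" using E interior_faces_subset by blast
      have "0 < eigval S E (l m E + 1)"
        using eigval_pos[OF Ef] adaptive_runD(2)[OF run mM' E] by simp
      then have "ratio E = 1" using adaptive_runD(6)[OF run mM Ef False] by (simp add: ratio_def)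
      then show ?thesis using False by simp
    qed
    then have "(\<Sum>E\<in>?I. ratio E * (ind m E)\<^sup>2)
        \<le> (\<Sum>E\<in>?I. (ind m E)\<^sup>2 - (if E \<in> sel m then (1 - \<delta>0) * (ind m E)\<^sup>2 else 0))"
      by (rule sum_mono)
    also have "\<dots> = (\<Sum>E\<in>?I. (ind m E)\<^sup>2) - (1 - \<delta>0) * (\<Sum>E\<in>sel m. (ind m E)\<^sup>2)"
    proof -
      have "?I \<inter> sel m = sel m" using bulk(1) by blast
      then show ?thesis
        using fin by (simp add: sum_subtractf sum.If_cases sum_distrib_left Int_def[symmetric] sum.inter_restrict[symmetric])
    qed
    also have "\<dots> \<le> (\<Sum>E\<in>?I. (ind m E)\<^sup>2) - (1 - \<delta>0) * (\<theta>\<^sup>2 * (\<Sum>E\<in>?I. (ind m E)\<^sup>2))"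
      using bulk(2) \<delta>0 by (intro diff_left_mono mult_left_mono) (auto simp: ind_def)
    also have "\<dots> = (1 - (1 - \<delta>0) * \<theta>\<^sup>2) * (\<Sum>E\<in>?I. (ind m E)\<^sup>2)"
      by (simp add: algebra_simps)
    finally show "(\<Sum>E\<in>?I. ratio E * (ind m E)\<^sup>2) \<le> (1 - (1 - \<delta>0) * \<theta>\<^sup>2) * (\<Sum>E\<in>?I. (ind m E)\<^sup>2)" .
  next
    have W0: "0 \<le> W E" for E unfolding W_def by (rule wform_nonneg[OF region_nbhd])
    have le: "D m E \<le> Max (D m ` ?I)" if "E \<in> ?I" for E using fin that by (intro Max_ge) auto
    have Max0: "0 \<le> Max (D m ` ?I)"
    proof -
      obtain E where E: "E \<in> ?I" using ne by auto
      have "0 < eigval S E (l (Suc m) E + 1)"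
        using eigval_pos[of E] E interior_faces_subset adaptive_runD(2)[OF run SM E] by auto
      then have "0 \<le> D m E" by (simp add: D_def)
      then show ?thesis using le[OF E] by simp
    qed
    have "(\<Sum>E\<in>?I. D m E * W E) \<le> (\<Sum>E\<in>?I. Max (D m ` ?I) * W E)"
      using le W0 by (intro sum_mono mult_right_mono) auto
    also have "\<dots> = Max (D m ` ?I) * (\<Sum>E\<in>?I. W E)" by (simp add: sum_distrib_left)
    also have "\<dots> \<le> Max (D m ` ?I) * (real (max_faces (coarse_grid S)) * wform S (flow_dom S) ?\<delta> ?\<delta>)"
    proof (rule mult_left_mono[OF _ Max0])
      have "v k \<in> vel_h S" if "enat k \<le> M" for k
      proof -
        have "ms_space S (l k) \<subseteq> snap_space S"
          unfolding ms_space_def snap_space_def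
          by (intro sum_space_mono ms_local_subset adaptive_run_le_nfine[OF run \<theta> _ that])
        then show ?thesis
          using adaptive_runD(3)[OF run that] snap_space_vel_h by (auto simp: discrete_solution_def)
      qed
      then have "pw_continuous S ?\<delta>" using mM' SM by (intro pw_continuous_diff pw_continuous_vel_h)
      then show "(\<Sum>E\<in>?I. W E) \<le> real (max_faces (coarse_grid S)) * wform S (flow_dom S) ?\<delta> ?\<delta>"
        unfolding W_def by (rule sum_wform_nbhd_le)
    qed
    finally show "(\<Sum>E\<in>?I. D m E * W E)
        \<le> Max (D m ` ?I) * (real (max_faces (coarse_grid S)) * wform S (flow_dom S) ?\<delta> ?\<delta>)" .
  qed (use \<alpha> in auto)
  finally show ?thesis
    by (simp add: wnorm_power2[OF region_flow_dom] mult_ac)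
qed

lemma max_faces_pos:
  assumes "interior_faces S \<noteq> {}" shows "0 < max_faces (coarse_grid S)"
proof -
  obtain E where E: "E \<in> interior_faces S" using assms by auto
  obtain K where K: "K \<in> coarse_grid S" "E facet_of K"
    using interior_facesD[OF E] by metis
  have "0 < card {F. F facet_of K}"
    using coarse.finite_facets[OF K(1)] K(2) by (auto simp: card_gt_0_iff)
  also have "\<dots> \<le> max_faces (coarse_grid S)"
    unfolding max_faces_def using K(1) coarse.finite_T by (intro Max_ge) auto
  finally show ?thesis .
qed

end

theorem theorem4:
  fixes S :: "('a::euclidean_space) gms"
    and \<theta> \<delta>0 C_V C_err :: real
    and M :: enat
    and l :: "nat \<Rightarrow> 'a set \<Rightarrow> nat"
    and sel :: "nat \<Rightarrow> 'a set set"
    and v_snap :: "'a \<Rightarrow> 'a" and p_snap :: "'a \<Rightarrow> real"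
    and v_ms :: "nat \<Rightarrow> 'a \<Rightarrow> 'a" and p_ms :: "nat \<Rightarrow> 'a \<Rightarrow> real"
  defines "ind \<equiv> \<lambda>m. err_indicator S (l m) (v_ms m) (p_ms m)"
    and "err \<equiv> \<lambda>m. wnorm S (flow_dom S) (\<lambda>x. v_snap x - v_ms m x)"
    and "D \<equiv> \<lambda>m E. 2 * inverse (eigval S E (l (Suc m) E + 1)) * (max (C_sup S (l m) E) 1)\<^sup>2"
  assumes setting: "gms_setting S"
    and faces: "interior_faces S \<noteq> {}"
    and theta: "0 < \<theta>" "\<theta> < 1"
    and delta: "0 < \<delta>0" "\<delta>0 < 1"
    and snap: "discrete_solution S (snap_space S) v_snap p_snap"
    and run: "adaptive_run S \<theta> \<delta>0 M l sel v_ms p_ms"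
    and not_div_free: "\<And>E. E \<in> interior_faces S \<Longrightarrow>
          \<exists>v\<in>ms_local S (l 0) E. \<exists>x\<in>cells S. divergence v x \<noteq> 0"
    and C_V: "0 < C_V" "C_err = C_V * mesh_size (coarse_grid S) / mesh_size (fine_grid S)"
    and a_posteriori: "\<And>m. enat m \<le> M \<Longrightarrow>
          (err m)\<^sup>2 \<le> C_err * (\<Sum>E\<in>interior_faces S. (ind m E)\<^sup>2)"
  shows "\<exists>\<rho> \<alpha> :: real. \<exists>L :: nat \<Rightarrow> real.
     0 < \<rho> \<and> 0 < \<alpha> \<and> \<rho> = (1 + \<alpha>) * (1 - (1 - \<delta>0) * \<theta>\<^sup>2) \<and>
     (\<forall>m E. enat m < M \<and> E \<in> sel m \<longrightarrow>
        eigval S E (l m E + 1) / eigval S E (l (Suc m) E + 1) \<le> \<delta>0) \<and>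
     \<delta>0 < 1 - (1 - \<delta>0) * \<theta>\<^sup>2 \<and> 1 - (1 - \<delta>0) * \<theta>\<^sup>2 < \<rho> \<and> \<rho> < 1 \<and>
     (\<forall>m. enat m < M \<longrightarrow> 0 < L m \<and>
        L m = real (max_faces (coarse_grid S)) * (1 + inverse \<alpha>) * Max (D m ` interior_faces S)) \<and>
     (\<forall>j m. j \<le> m \<and> enat m < M \<longrightarrow> L m \<le> L j) \<and>
     (\<forall>j m. j \<le> m \<and> enat m < M \<longrightarrow>
        (err (Suc m))\<^sup>2 + 1 / L j * (\<Sum>E\<in>interior_faces S. (ind (Suc m) E)\<^sup>2)
        \<le> (C_err * L j + \<rho>) / (C_err * L j + 1) *
            ((err m)\<^sup>2 + 1 / L j * (\<Sum>E\<in>interior_faces S. (ind m E)\<^sup>2)))"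
proof -
  interpret gms_method S using setting by unfold_locales
  let ?I = "interior_faces S" and ?N = "real (max_faces (coarse_grid S))"
  define c where "c = 1 - (1 - \<delta>0) * \<theta>\<^sup>2"
  have "0 < \<theta>\<^sup>2" "\<theta>\<^sup>2 < 1" using theta by (auto simp: power_less_one_iff)
  then have "0 < (1 - \<delta>0) * \<theta>\<^sup>2" "0 < (1 - \<delta>0) * (1 - \<theta>\<^sup>2)" using delta by auto
  then have c: "\<delta>0 < c" "c < 1" by (auto simp: c_def algebra_simps)
  \<comment> \<open>Any \<open>\<rho>\<close> strictly between \<open>c\<close> and one serves; \<open>\<alpha>\<close> is then determined.\<close>
  define \<rho> where "\<rho> = (1 + c) / 2"
  define \<alpha> where "\<alpha> = \<rho> / c - 1"
  have \<rho>: "c < \<rho>" "\<rho> < 1" "0 < \<rho>" using c delta by (auto simp: \<rho>_def)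
  have \<alpha>: "0 < \<alpha>" "\<rho> = (1 + \<alpha>) * c" using c delta \<rho> by (auto simp: \<alpha>_def field_simps)
  define L where "L m = ?N * (1 + inverse \<alpha>) * Max (D m ` ?I)" for m
  have fin: "finite ?I" by (rule finite_interior_faces)
  have I_faces: "E \<in> faces (coarse_grid S)" if "E \<in> ?I" for E
    using that interior_faces_subset by blast
  have SM: "enat (Suc m) \<le> M" if "enat m < M" for m using that by (simp add: Suc_ile_eq)
  have eig: "0 < eigval S E (l (Suc m) E + 1)" if "enat m < M" "E \<in> ?I" for m E
    using eigval_pos[OF I_faces[OF that(2)], of "l (Suc m) E + 1"]
      adaptive_runD(2)[OF run SM[OF that(1)] that(2)] by simp
  have N: "0 < ?N * (1 + inverse \<alpha>)"
    using max_faces_pos[OF faces] \<alpha> by (intro mult_pos_pos add_pos_pos) auto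
  have Lpos: "0 < L m" if m: "enat m < M" for m
  proof -
    have "0 < D m E" if "E \<in> ?I" for E
      using eig[OF m that] by (auto simp: D_def intro!: mult_pos_pos)
    then have "0 < Max (D m ` ?I)" using fin faces by (subst Max_gr_iff) auto
    with N show ?thesis unfolding L_def by (rule mult_pos_pos)
  qed
  have Lmono: "L m \<le> L j" if jm: "j \<le> m" and m: "enat m < M" for j m
  proof -
    have j: "enat j < M" using jm m by (meson enat_ord_simps(1) le_less_trans)
    have "D m E \<le> Max (D j ` ?I)" if E: "E \<in> ?I" for E
    proof -
      note Ef = I_faces[OF E]
      have "l (Suc j) E \<le> l (Suc m) E"
        using adaptive_run_mono[OF run Ef _ SM[OF m]] jm by simp
      then have "eigval S E (l (Suc j) E + 1) \<le> eigval S E (l (Suc m) E + 1)"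
        using adaptive_runD(2)[OF run SM[OF m] E] by (intro spectral(2)[OF Ef]) auto
      then have 1: "inverse (eigval S E (l (Suc m) E + 1)) \<le> inverse (eigval S E (l (Suc j) E + 1))"
        using eig[OF j E] by (rule le_imp_inverse_le)
      have "l 0 E \<le> l j E" using adaptive_run_mono[OF run Ef, of 0 j] j by simp
      then have ex: "\<exists>v\<in>ms_local S (l j) E. \<exists>x\<in>cells S. divergence v x \<noteq> 0"
        using not_div_free[OF E] ms_local_mono[of "l 0" E "l j"] by blast
      have "C_sup S (l m) E \<le> C_sup S (l j) E"
        using adaptive_run_mono[OF run Ef jm] m adaptive_run_le_nfine[OF run theta Ef] j
        by (intro C_sup_antimono[OF E _ _ ex]) (auto intro: less_imp_le)
      then have 2: "(max (C_sup S (l m) E) 1)\<^sup>2 \<le> (max (C_sup S (l j) E) 1)\<^sup>2"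
        by (intro power_mono) auto
      have "D m E \<le> D j E"
        unfolding D_def using 1 2 eig[OF j E] eig[OF m E] by (intro mult_mono) auto
      also have "\<dots> \<le> Max (D j ` ?I)" using fin E by (intro Max_ge) auto
      finally show ?thesis .
    qed
    then have "Max (D m ` ?I) \<le> Max (D j ` ?I)" using fin faces by (subst Max_le_iff) auto
    then show ?thesis unfolding L_def using N by (intro mult_left_mono) auto
  qed
  have "coarse_grid S \<noteq> {}" "fine_grid S \<noteq> {}"
    using flow coarse.Union_T fine.Union_T by (auto simp: flow_problem_def)
  then have C: "0 \<le> C_err"
    using C_V coarse.mesh_size_nonneg fine.mesh_size_nonneg by simp
  have step: "(err (Suc m))\<^sup>2 + 1 / L j * (\<Sum>E\<in>?I. (ind (Suc m) E)\<^sup>2)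
      \<le> (C_err * L j + \<rho>) / (C_err * L j + 1) * ((err m)\<^sup>2 + 1 / L j * (\<Sum>E\<in>?I. (ind m E)\<^sup>2))"
    if jm: "j \<le> m" and m: "enat m < M" for j m
  proof (rule contraction_step)
    let ?\<Delta> = "(wnorm S (flow_dom S) (\<lambda>x. v_ms (Suc m) x - v_ms m x))\<^sup>2"
    have m': "enat m \<le> M" using m by simp
    show "(err m)\<^sup>2 = (err (Suc m))\<^sup>2 + ?\<Delta>"
      unfolding err_def
      using adaptive_run_mono[OF run _ _ SM[OF m], of _ m] adaptive_run_le_nfine[OF run theta _ SM[OF m]]
      by (intro galerkin_orthogonality[OF _ _ snap adaptive_runD(3)[OF run m'] adaptive_runD(3)[OF run SM[OF m]]]) auto
    show "(\<Sum>E\<in>?I. (ind (Suc m) E)\<^sup>2) \<le> \<rho> * (\<Sum>E\<in>?I. (ind m E)\<^sup>2) + L m * ?\<Delta>"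
      using indicator_sum_step[OF run theta delta(2) m \<alpha>(1) faces not_div_free]
      unfolding ind_def D_def L_def \<alpha>(2) c_def .
    have "enat j < M" using jm m by (meson enat_ord_simps(1) le_less_trans)
    then show "0 < L j" by (rule Lpos)
  qed (use Lmono[OF jm m] a_posteriori m C \<rho> in auto)
  show ?thesis
  proof (rule exI[of _ \<rho>], rule exI[of _ \<alpha>], rule exI[of _ L], intro conjI allI impI; (elim conjE)?)
    show "\<rho> = (1 + \<alpha>) * (1 - (1 - \<delta>0) * \<theta>\<^sup>2)" using \<alpha>(2) by (simp add: c_def)
    show "\<delta>0 < 1 - (1 - \<delta>0) * \<theta>\<^sup>2" "1 - (1 - \<delta>0) * \<theta>\<^sup>2 < \<rho>" using c \<rho> by (auto simp: c_def)
  qed (use \<rho> \<alpha> Lpos Lmono step adaptive_run_ratio[OF run] in \<open>auto simp: L_def\<close>)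
qed

end
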